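(* Fix constants $a>0$ and $g>0$. The initial value problem \[ \partial_t \rho + u\,\partial_x \rho = 0,\qquad u = g\,H_a\rho,\qquad \rho(\cdot,0)=\rho_0, \] posed on the circle $\mathbb{T}$, is locally well-posed in time in the class $C^\infty(\mathbb{T})$: for every $\rho_0\in C^\infty(\mathbb{T})$ there exist a time $T>0$ and a solution $\rho$ that is smooth and bounded on $\mathbb{T}\times[0,T)$ with $\rho(\cdot,t)\in C^\infty(\mathbb{T})$ for all $t\in[0,T)$, and this solution is unique among solutions in $C^\infty(\mathbb{T})$ with the same initial data.
   Context: $\mathbb{T}=[-\pi,\pi)$ denotes the circle; functions on $\mathbb{T}$ are identified with $2\pi$-periodic functions on $\mathbb{R}$, and $C^\infty(\mathbb{T})$ denotes smooth $2\pi$-periodic functions (bounded, with all derivatives bounded). For $a>0$, the operator $H_a$ acts on (the periodic extension to $\mathbb{R}$ of) a function $f$ by \[ H_a f(x) := \mathrm{P.V.}\int_{\mathbb{R}} f(x-y)\,K_a(y)\,dy,\qquad K_a(y) := \frac{1}{\pi y}\,\frac{a^2}{y^2+a^2}. \] *)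

theory Defs
  imports "HOL-Analysis.Analysis"
begin

definition K_kernel :: "real \<Rightarrow> real \<Rightarrow> real" where
  "K_kernel a y = (1 / (pi * y)) * (a^2 / (y^2 + a^2))"

definition H_op :: "real \<Rightarrow> (real \<Rightarrow> real) \<Rightarrow> real \<Rightarrow> real" where
  "H_op a f x = Lim (at_right 0)
     (\<lambda>\<epsilon>. integral {y. \<epsilon> \<le> \<bar>y\<bar>} (\<lambda>y. f (x - y) * K_kernel a y))"

definition C_inf_T :: "(real \<Rightarrow> real) \<Rightarrow> bool" where
  "C_inf_T f \<longleftrightarrow> (\<forall>x. f (x + 2 * pi) = f x)
     \<and> (\<forall>k. (deriv ^^ k) f differentiable_on UNIV)
     \<and> (\<forall>k. bounded (range ((deriv ^^ k) f)))"

text \<open>Joint smoothness of F on the strip R x [0,T) (one-sided at t = 0):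
  F is (Frechet) differentiable within the strip, with partial derivatives Fx, Ft
  that are again smooth on the strip, and so on (coinductively).\<close>
coinductive smooth_strip :: "real \<Rightarrow> (real \<times> real \<Rightarrow> real) \<Rightarrow> bool" for T :: real where
  "(\<And>p. p \<in> UNIV \<times> {0..<T} \<Longrightarrow>
      (F has_derivative (\<lambda>h. fst h * Fx p + snd h * Ft p)) (at p within UNIV \<times> {0..<T}))
   \<Longrightarrow> smooth_strip T Fx \<Longrightarrow> smooth_strip T Ft \<Longrightarrow> smooth_strip T F"

definition is_solution ::
  "real \<Rightarrow> real \<Rightarrow> (real \<Rightarrow> real) \<Rightarrow> real \<Rightarrow> (real \<Rightarrow> real \<Rightarrow> real) \<Rightarrow> bool" where
  "is_solution a g rho0 T rho \<longleftrightarrow>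
     smooth_strip T (\<lambda>p. rho (fst p) (snd p))
   \<and> bounded ((\<lambda>p. rho (fst p) (snd p)) ` (UNIV \<times> {0..<T}))
   \<and> (\<forall>t\<in>{0..<T}. C_inf_T (\<lambda>x. rho x t))
   \<and> (\<forall>x. rho x 0 = rho0 x)
   \<and> (\<forall>x. \<forall>t\<in>{0<..<T}.
        deriv (\<lambda>s. rho x s) t
        + g * H_op a (\<lambda>y. rho y t) x * deriv (\<lambda>y. rho y t) x = 0)"

end

theory Submission
  imports Defs "HOL-Probability.Discrete_Topology" "HOL-Real_Asymp.Real_Asymp"
begin

text \<open>
  On Fourier coefficients \<open>c\<^sub>k\<close> the operator \<open>H_op a\<close> is multiplication by a bounded sequence, so the
  equation becomes the quadratic system \<open>c\<^sub>k' = (\<Sum>l. v\<^sub>k\<^sub>-\<^sub>l (\<i> l) c\<^sub>l)\<close>, where \<open>v\<^sub>j = q\<^sub>j c\<^sub>j\<close> are the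
  coefficients of the velocity. Truncating to \<open>\<bar>k\<bar> \<le> N\<close> gives ordinary differential equations.
  Since \<open>v\<close> is the coefficient sequence of a real function, the top order term of the advection form
  is skew, and the energies \<open>E\<^sub>s = (\<Sum>k. (1 + \<bar>k\<bar>)\<^sup>2\<^sup>s \<bar>c\<^sub>k\<bar>\<^sup>2)\<close> satisfy \<open>E\<^sub>s' \<le> const * sqrt E\<^sub>2 * E\<^sub>s\<close>
  uniformly in \<open>N\<close>. The case \<open>s = 2\<close> is a Riccati inequality and fixes the existence time; for all
  other \<open>s\<close> the inequality is linear, so every order of smoothness survives on the same interval.
  The same skewness bounds the \<open>\<ell>\<^sup>2\<close> distance of two approximate solutions by Gronwall's inequality, which
  yields both the convergence of the truncations and uniqueness. Only the real part of \<open>c\<close> enters the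
  velocity, so the real part of the limit is the solution and no reality condition has to be
  propagated.
\<close>

section \<open>Weights on frequencies\<close>

text \<open>The obstacle is the loss of one derivative: \<open>adv\<close> multiplies by the
  frequency, so the right-hand side does not map a weighted sequence space into itself and no fixed
  point argument applies to the full system. Skewness repairs this, but it rests on rearranging
  sums; hence every energy estimate is made for finitely supported families, with constants that do
  not see the support. The velocity enters through one number, a bound \<open>A\<close> on the sums
  of \<open>jb j * norm (c j)\<close>, a Lipschitz norm. Cauchy-Schwarz bounds it by the root of the
  energy of order two, so this energy closes on itself. Exponents of \<open>jb\<close> form a
  budget: one power pays for a derivative, two pay for summation over a frequency, and one can be
  exchanged for a factor \<open>1 / (N + 1)\<close> outside the truncation. Boundedness of the
  multiplier rests on the kernel being odd, at most \<open>1 / (pi * y)\<close> and decreasing on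
  the positive half line; the resulting bound does not depend on \<open>a\<close>.\<close>

text \<open>The Japanese bracket.\<close>
definition jb :: "int \<Rightarrow> real" where
  "jb k = 1 + \<bar>real_of_int k\<bar>"

lemma jb_ge_1 [simp]: "1 \<le> jb k" and jb_pos [simp]: "0 < jb k" and jb_nonneg [simp]: "0 \<le> jb k"
  and jb_nonzero [simp]: "jb k \<noteq> 0" and jb_minus [simp]: "jb (- k) = jb k"
  and abs_le_jb: "\<bar>real_of_int k\<bar> \<le> jb k"
  by (auto simp: jb_def add_nonneg_eq_0_iff)

text \<open>Peetre's inequality; it distributes a weight at \<open>k\<close> over the two
  frequencies that a convolution pairs.\<close>

lemma jb_le_mult: "jb k \<le> jb (k - l) * jb l"
proof -
  have "\<bar>real_of_int k\<bar> \<le> \<bar>real_of_int (k - l)\<bar> + \<bar>real_of_int l\<bar>"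
    by linarith
  moreover have "0 \<le> \<bar>real_of_int (k - l)\<bar> * \<bar>real_of_int l\<bar>"
    by simp
  ultimately show ?thesis
    unfolding jb_def distrib_left distrib_right by linarith
qed

lemma jb_power_mono: "m \<le> n \<Longrightarrow> jb k ^ m \<le> jb k ^ n"
  by (simp add: power_increasing)

lemma summable_on_jb: "(\<lambda>k. 1 / jb k ^ 2) summable_on UNIV"
proof -
  have s: "(\<lambda>n::nat. 1 / (1 + real n) ^ 2) summable_on UNIV"
    using inverse_squares_sums
    by (intro norm_summable_imp_summable_on) (simp add: sums_iff add.commute)
  have "(\<lambda>k. 1 / jb k ^ 2) summable_on range int"
    using s by (subst summable_on_reindex) (auto simp: jb_def o_def)
  moreover have "(\<lambda>k. 1 / jb k ^ 2) summable_on range (\<lambda>n. - int n)"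
    using s by (subst summable_on_reindex) (auto simp: jb_def o_def inj_def)
  moreover have "range int \<union> range (\<lambda>n. - int n) = UNIV"
  proof -
    have "k \<in> range int \<union> range (\<lambda>n. - int n)" for k
      by (cases k rule: int_cases2) auto
    then show ?thesis by blast
  qed
  ultimately show ?thesis
    using summable_on_union by metis
qed

text \<open>Its value is pi^2/3 - 1. It is the constant paid whenever pointwise decay of order two
  is turned into a summed bound.\<close>

definition jsum :: real where
  "jsum = (\<Sum>\<^sub>\<infinity>k. 1 / jb k ^ 2)"

lemma sum_jb_le_jsum: "finite F \<Longrightarrow> (\<Sum>k\<in>F. 1 / jb k ^ 2) \<le> jsum"
  unfolding jsum_def by (rule finite_sum_le_infsum[OF summable_on_jb]) auto

lemma jsum_ge_1: "1 \<le> jsum"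
  using sum_jb_le_jsum[of "{0}"] by (simp add: jb_def)

text \<open>Testing finite sets controls a family without a separate summability proof, and
  translating or reflecting the index costs nothing, since it only changes the finite set. The empty
  set makes the bound nonnegative.\<close>

definition sums_le :: "(int \<Rightarrow> real) \<Rightarrow> real \<Rightarrow> bool" where
  "sums_le f A \<longleftrightarrow> (\<forall>F. finite F \<longrightarrow> sum f F \<le> A)"

lemma sums_leD: "sums_le f A \<Longrightarrow> finite F \<Longrightarrow> sum f F \<le> A"
  by (simp add: sums_le_def)

lemma sums_le_nonneg: "sums_le f A \<Longrightarrow> 0 \<le> A"
  using sums_leD[of f A "{}"] by simp

lemma sums_le_mono:
  assumes "sums_le f A" "\<And>k. g k \<le> f k" "A \<le> B"
  shows "sums_le g B"
  unfolding sums_le_def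
proof (intro allI impI)
  fix F :: "int set" assume "finite F"
  have "sum g F \<le> sum f F" by (intro sum_mono assms)
  also have "\<dots> \<le> B" using sums_leD[OF assms(1) \<open>finite F\<close>] assms(3) by simp
  finally show "sum g F \<le> B" .
qed

lemma sums_le_shift: "sums_le f A \<Longrightarrow> finite F \<Longrightarrow> (\<Sum>k\<in>F. f (k - l)) \<le> A"
proof -
  assume a: "sums_le f A" "finite F"
  have "(\<Sum>k\<in>F. f (k - l)) = sum f ((\<lambda>k. k - l) ` F)"
    by (subst sum.reindex) (auto simp: inj_on_def)
  then show ?thesis using a by (simp add: sums_leD)
qed

lemma sums_le_reflect: "sums_le f A \<Longrightarrow> finite F \<Longrightarrow> (\<Sum>k\<in>F. f (l - k)) \<le> A"
proof -
  assume a: "sums_le f A" "finite F"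
  have "(\<Sum>k\<in>F. f (l - k)) = sum f ((\<lambda>k. l - k) ` F)"
    by (subst sum.reindex) (auto simp: inj_on_def)
  then show ?thesis using a by (simp add: sums_leD)
qed

lemma sums_le_cmult: "sums_le f A \<Longrightarrow> 0 \<le> c \<Longrightarrow> sums_le (\<lambda>k. c * f k) (c * A)"
  unfolding sums_le_def by (auto simp: sum_distrib_left[symmetric] intro!: mult_left_mono)

text \<open>\<open>vel\<close> averages the coefficients at \<open>j\<close> and \<open>- j\<close>;
  reflection preserves the bound, so the average inherits it.\<close>

lemma sums_le_symm: "sums_le f A \<Longrightarrow> sums_le (\<lambda>k. (f k + f (- k)) / 2) A"
  unfolding sums_le_def
proof (intro allI impI)
  fix F :: "int set" assume a: "\<forall>F. finite F \<longrightarrow> sum f F \<le> A" "finite F"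
  then have s: "sums_le f A" by (simp add: sums_le_def)
  have "(\<Sum>k\<in>F. (f k + f (- k)) / 2) = (sum f F + (\<Sum>k\<in>F. f (0 - k))) / 2"
    by (simp add: sum.distrib sum_divide_distrib[symmetric])
  also have "\<dots> \<le> (A + A) / 2"
    using a sums_le_reflect[OF s, of F 0] by (intro divide_right_mono add_mono) auto
  finally show "(\<Sum>k\<in>F. (f k + f (- k)) / 2) \<le> A" by simp
qed

lemma sums_le_support:
  assumes "finite I" "\<And>k. k \<notin> I \<Longrightarrow> f k = 0" "\<And>k. 0 \<le> f k"
  shows "sums_le f (sum f I)"
  unfolding sums_le_def
proof (intro allI impI)
  fix F :: "int set" assume F: "finite F"
  have "sum f F = sum f (F \<inter> I)"
    using F assms(2) by (intro sum.mono_neutral_right) auto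
  also have "\<dots> \<le> sum f I"
    using assms by (intro sum_mono2) auto
  finally show "sum f F \<le> sum f I" .
qed

lemma sums_le_decay:
  assumes "\<And>k. f k \<le> C / jb k ^ 2" "0 \<le> C"
  shows "sums_le f (C * jsum)"
proof -
  have "sums_le (\<lambda>k. 1 / jb k ^ 2) jsum"
    by (simp add: sums_le_def sum_jb_le_jsum)
  from sums_le_cmult[OF this \<open>0 \<le> C\<close>] show ?thesis
    by (rule sums_le_mono) (use assms in auto)
qed

section \<open>The advection form on Fourier coefficients\<close>

text \<open>This is the \<open>k\<close>-th Fourier coefficient of a product: the function with
  coefficients \<open>v\<close> times the derivative of the function with coefficients
  \<open>b\<close>. \<open>infsum\<close> returns 0 for families that are not summable, so uses
  outside finite support come with decay bounds.\<close>

definition adv :: "(int \<Rightarrow> complex) \<Rightarrow> (int \<Rightarrow> complex) \<Rightarrow> int \<Rightarrow> complex" where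
  "adv v b k = (\<Sum>\<^sub>\<infinity>l. v (k - l) * (\<i> * of_int l) * b l)"

lemma adv_finite:
  assumes "finite I" "\<And>l. l \<notin> I \<Longrightarrow> b l = 0"
  shows "adv v b k = (\<Sum>l\<in>I. v (k - l) * (\<i> * of_int l) * b l)"
  unfolding adv_def
  by (subst infsum_finite[OF assms(1), symmetric], rule infsum_cong_neutral) (use assms(2) in auto)

text \<open>If \<open>c\<close> are the Fourier coefficients of a complex function, then \<open>(c j + cnj (c (- j))) / 2\<close> are
  those of its real part.\<close>
definition vel :: "(int \<Rightarrow> complex) \<Rightarrow> (int \<Rightarrow> complex) \<Rightarrow> int \<Rightarrow> complex" where
  "vel q c j = q j * ((c j + cnj (c (- j))) / 2)"

lemma vel_cnj: "(\<And>j. q (- j) = cnj (q j)) \<Longrightarrow> vel q c (- j) = cnj (vel q c j)"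
  by (simp add: vel_def add.commute)

lemma vel_diff: "vel q (\<lambda>k. c k - d k) j = vel q c j - vel q d j"
  by (simp add: vel_def algebra_simps add_divide_distrib diff_divide_distrib)

lemma norm_vel_le:
  assumes "\<And>j. norm (q j) \<le> Q"
  shows "norm (vel q c j) \<le> Q * ((norm (c j) + norm (c (- j))) / 2)"
proof -
  have "norm ((c j + cnj (c (- j))) / 2) \<le> (norm (c j) + norm (c (- j))) / 2"
    by (simp add: norm_divide) (metis complex_mod_cnj norm_triangle_ineq)
  then show ?thesis
    unfolding vel_def norm_mult by (intro mult_mono) (use assms in \<open>auto intro: order_trans[OF norm_ge_zero]\<close>)
qed

lemma sums_le_vel:
  assumes q: "\<And>j. norm (q j) \<le> Q"
    and w: "\<And>j. w (- j) = w j" "\<And>j. 0 \<le> w j"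
    and c: "sums_le (\<lambda>j. w j * norm (c j)) A"
  shows "sums_le (\<lambda>j. w j * norm (vel q c j)) (Q * A)"
proof -
  have Q: "0 \<le> Q" using q[of 0] norm_ge_zero order_trans by blast
  from sums_le_cmult[OF sums_le_symm[OF c] Q] show ?thesis
  proof (rule sums_le_mono)
    fix k
    have "w k * norm (vel q c k) \<le> w k * (Q * ((norm (c k) + norm (c (- k))) / 2))"
      by (intro mult_left_mono norm_vel_le q w)
    then show "w k * norm (vel q c k) \<le> Q * ((w k * norm (c k) + w (- k) * norm (c (- k))) / 2)"
      by (simp add: w algebra_simps)
  qed simp
qed

lemma sums_le_vel_sq:
  assumes q: "\<And>j. norm (q j) \<le> Q"
    and w: "\<And>j. w (- j) = w j"
    and c: "sums_le (\<lambda>j. (w j * norm (c j))\<^sup>2) A"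
  shows "sums_le (\<lambda>j. (w j * norm (vel q c j))\<^sup>2) (Q\<^sup>2 * A)"
proof -
  from sums_le_cmult[OF sums_le_symm[OF c] zero_le_power2[of Q]] show ?thesis
  proof (rule sums_le_mono)
    fix k
    let ?x = "norm (c k)" and ?y = "norm (c (- k))"
    have "(norm (vel q c k))\<^sup>2 \<le> (Q * ((?x + ?y) / 2))\<^sup>2"
      by (intro power_mono norm_vel_le q) auto
    also have "\<dots> = Q\<^sup>2 * ((?x + ?y) / 2)\<^sup>2"
      by (rule power_mult_distrib)
    also have "\<dots> \<le> Q\<^sup>2 * ((?x\<^sup>2 + ?y\<^sup>2) / 2)"
      using zero_le_power2[of "?x - ?y"]
      by (intro mult_left_mono) (auto simp: power2_eq_square algebra_simps)
    finally have "(w k)\<^sup>2 * (norm (vel q c k))\<^sup>2 \<le> (w k)\<^sup>2 * (Q\<^sup>2 * ((?x\<^sup>2 + ?y\<^sup>2) / 2))"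
      by (intro mult_left_mono) auto
    then show "(w k * norm (vel q c k))\<^sup>2 \<le> Q\<^sup>2 * (((w k * ?x)\<^sup>2 + (w (- k) * ?y)\<^sup>2) / 2)"
      by (simp add: w power_mult_distrib algebra_simps)
  qed simp
qed

text \<open>Young's inequality for a convolution: each product is split by the arithmetic-geometric
  mean, after which the row sums and column sums of \<open>\<alpha> (k - l)\<close> are at most
  \<open>A\<close>, by reflection and translation respectively.\<close>

lemma schur_difference:
  assumes I: "finite I" and \<alpha>: "sums_le \<alpha> A" "\<And>k. 0 \<le> \<alpha> k"
  shows "(\<Sum>k\<in>I. \<Sum>l\<in>I. \<alpha> (k - l) * \<beta> k * \<gamma> l) \<le> A / 2 * ((\<Sum>k\<in>I. (\<beta> k)\<^sup>2) + (\<Sum>k\<in>I. (\<gamma> k)\<^sup>2))"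
proof -
  have "(\<Sum>k\<in>I. \<Sum>l\<in>I. \<alpha> (k - l) * \<beta> k * \<gamma> l)
      \<le> (\<Sum>k\<in>I. \<Sum>l\<in>I. \<alpha> (k - l) * (\<beta> k)\<^sup>2 / 2 + \<alpha> (k - l) * (\<gamma> l)\<^sup>2 / 2)"
  proof (intro sum_mono)
    fix k l
    have "\<beta> k * \<gamma> l \<le> (\<beta> k)\<^sup>2 / 2 + (\<gamma> l)\<^sup>2 / 2"
      using zero_le_power2[of "\<beta> k - \<gamma> l"] by (simp add: power2_eq_square algebra_simps)
    from mult_left_mono[OF this \<alpha>(2)[of "k - l"]]
    show "\<alpha> (k - l) * \<beta> k * \<gamma> l \<le> \<alpha> (k - l) * (\<beta> k)\<^sup>2 / 2 + \<alpha> (k - l) * (\<gamma> l)\<^sup>2 / 2"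
      by (simp add: algebra_simps)
  qed
  also have "\<dots> = (\<Sum>k\<in>I. \<Sum>l\<in>I. \<alpha> (k - l) * (\<beta> k)\<^sup>2 / 2) + (\<Sum>l\<in>I. \<Sum>k\<in>I. \<alpha> (k - l) * (\<gamma> l)\<^sup>2 / 2)"
    by (simp add: sum.distrib) (rule sum.swap)
  also have "\<dots> = (\<Sum>k\<in>I. (\<Sum>l\<in>I. \<alpha> (k - l)) * ((\<beta> k)\<^sup>2 / 2)) + (\<Sum>l\<in>I. (\<Sum>k\<in>I. \<alpha> (k - l)) * ((\<gamma> l)\<^sup>2 / 2))"
    by (simp add: sum_distrib_right sum_divide_distrib)
  also have "\<dots> \<le> (\<Sum>k\<in>I. A * ((\<beta> k)\<^sup>2 / 2)) + (\<Sum>l\<in>I. A * ((\<gamma> l)\<^sup>2 / 2))"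
    by (intro add_mono sum_mono mult_right_mono sums_le_shift sums_le_reflect \<alpha> I) auto
  also have "\<dots> = A / 2 * ((\<Sum>k\<in>I. (\<beta> k)\<^sup>2) + (\<Sum>k\<in>I. (\<gamma> k)\<^sup>2))"
    by (simp add: sum_distrib_left sum.distrib algebra_simps)
  finally show ?thesis .
qed

text \<open>Here the summable factor depends on \<open>l\<close> alone and the square-summable one
  on the difference. Since \<open>k - l\<close> leaves \<open>I\<close>, the bound on
  \<open>\<gamma>\<close> ranges over all frequencies.\<close>

lemma schur_right:
  assumes I: "finite I" and \<alpha>: "sums_le \<alpha> A" "\<And>k. 0 \<le> \<alpha> k"
    and \<gamma>: "sums_le (\<lambda>k. (\<gamma> k)\<^sup>2) G"
  shows "(\<Sum>k\<in>I. \<Sum>l\<in>I. \<alpha> l * \<beta> k * \<gamma> (k - l)) \<le> A / 2 * ((\<Sum>k\<in>I. (\<beta> k)\<^sup>2) + G)"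
proof -
  have G: "0 \<le> G" using sums_le_nonneg[OF \<gamma>] .
  have "(\<Sum>k\<in>I. \<Sum>l\<in>I. \<alpha> l * \<beta> k * \<gamma> (k - l))
      \<le> (\<Sum>k\<in>I. \<Sum>l\<in>I. \<alpha> l * ((\<beta> k)\<^sup>2 / 2 + (\<gamma> (k - l))\<^sup>2 / 2))"
  proof (intro sum_mono)
    fix k l
    have "\<beta> k * \<gamma> (k - l) \<le> (\<beta> k)\<^sup>2 / 2 + (\<gamma> (k - l))\<^sup>2 / 2"
      using zero_le_power2[of "\<beta> k - \<gamma> (k - l)"] by (simp add: power2_eq_square algebra_simps)
    from mult_left_mono[OF this \<alpha>(2)[of l]]
    show "\<alpha> l * \<beta> k * \<gamma> (k - l) \<le> \<alpha> l * ((\<beta> k)\<^sup>2 / 2 + (\<gamma> (k - l))\<^sup>2 / 2)"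
      by (simp add: algebra_simps)
  qed
  also have "\<dots> = (\<Sum>l\<in>I. \<Sum>k\<in>I. \<alpha> l * ((\<beta> k)\<^sup>2 / 2 + (\<gamma> (k - l))\<^sup>2 / 2))"
    by (rule sum.swap)
  also have "\<dots> = (\<Sum>l\<in>I. \<alpha> l * (((\<Sum>k\<in>I. (\<beta> k)\<^sup>2) + (\<Sum>k\<in>I. (\<gamma> (k - l))\<^sup>2)) / 2))"
    by (simp add: sum_distrib_left[symmetric] sum.distrib sum_divide_distrib[symmetric] add_divide_distrib)
  also have "\<dots> \<le> (\<Sum>l\<in>I. \<alpha> l * (((\<Sum>k\<in>I. (\<beta> k)\<^sup>2) + G) / 2))"
    using sums_le_shift[OF \<gamma> I] by (intro sum_mono mult_left_mono divide_right_mono add_left_mono \<alpha>) auto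
  also have "\<dots> = (\<Sum>l\<in>I. \<alpha> l) * (((\<Sum>k\<in>I. (\<beta> k)\<^sup>2) + G) / 2)"
    by (simp add: sum_distrib_right)
  also have "\<dots> \<le> A * (((\<Sum>k\<in>I. (\<beta> k)\<^sup>2) + G) / 2)"
    using G by (intro mult_right_mono sums_leD[OF \<alpha>(1) I]) (auto intro!: divide_nonneg_pos add_nonneg_nonneg sum_nonneg)
  finally show ?thesis by simp
qed

text \<open>Adding the complex conjugate turns the factor \<open>l\<close> into \<open>l - k\<close>: this replaces the integration
  by parts \<open>2 \<integral> u b' b = - \<integral> u' b\<^sup>2\<close>.\<close>
lemma advection_skew:
  assumes I: "finite I" and v: "\<And>j. v (- j) = cnj (v j)"
    and A: "sums_le (\<lambda>j. jb j * norm (v j)) A"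
  shows "Re (\<Sum>k\<in>I. \<Sum>l\<in>I. cnj (b k) * (v (k - l) * (\<i> * of_int l) * b l)) \<le> A / 2 * (\<Sum>k\<in>I. (norm (b k))\<^sup>2)"
proof -
  define X where "X = (\<Sum>k\<in>I. \<Sum>l\<in>I. cnj (b k) * (v (k - l) * (\<i> * of_int l) * b l))"
  have cv: "cnj (v (k - l)) = v (l - k)" for k l
    using v[of "k - l"] by simp
  have "cnj X = (\<Sum>k\<in>I. \<Sum>l\<in>I. b k * (v (l - k) * (- \<i> * of_int l) * cnj (b l)))"
    unfolding X_def cnj_sum complex_cnj_mult cv by simp
  also have "\<dots> = (\<Sum>k\<in>I. \<Sum>l\<in>I. b l * (v (k - l) * (- \<i> * of_int k) * cnj (b k)))"
    by (rule sum.swap)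
  finally have "X + cnj X = (\<Sum>k\<in>I. \<Sum>l\<in>I. cnj (b k) * (v (k - l) * (\<i> * of_int (l - k)) * b l))"
    unfolding X_def by (simp add: sum.distrib[symmetric] algebra_simps)
  then have "2 * Re X = Re (\<Sum>k\<in>I. \<Sum>l\<in>I. cnj (b k) * (v (k - l) * (\<i> * of_int (l - k)) * b l))"
    by (metis complex_add_cnj Re_complex_of_real)
  also have "\<dots> \<le> norm (\<Sum>k\<in>I. \<Sum>l\<in>I. cnj (b k) * (v (k - l) * (\<i> * of_int (l - k)) * b l))"
    by (rule complex_Re_le_cmod)
  also have "\<dots> \<le> (\<Sum>k\<in>I. \<Sum>l\<in>I. (jb (k - l) * norm (v (k - l))) * norm (b k) * norm (b l))"
  proof (intro sum_norm_le)
    fix k l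
    have "norm (complex_of_int (l - k)) \<le> jb (k - l)"
      by (metis abs_le_jb abs_minus_commute norm_of_int of_int_diff)
    then have "norm (cnj (b k) * (v (k - l) * (\<i> * of_int (l - k)) * b l))
      \<le> norm (b k) * (norm (v (k - l)) * jb (k - l) * norm (b l))"
      by (simp add: norm_mult mult_left_mono mult_right_mono)
    then show "norm (cnj (b k) * (v (k - l) * (\<i> * of_int (l - k)) * b l))
       \<le> jb (k - l) * norm (v (k - l)) * norm (b k) * norm (b l)"
      by (simp add: mult_ac)
  qed
  also have "\<dots> \<le> A / 2 * ((\<Sum>k\<in>I. (norm (b k))\<^sup>2) + (\<Sum>k\<in>I. (norm (b k))\<^sup>2))"
    by (rule schur_difference[OF I A]) auto
  finally show ?thesis unfolding X_def by simp
qed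

section \<open>Commuting the frequency weight with multiplication by the velocity\<close>

lemma power_diff_abs_le:
  fixes x y :: real
  assumes "0 \<le> x" "0 \<le> y"
  shows "\<bar>x ^ Suc n - y ^ Suc n\<bar> \<le> Suc n * (\<bar>x - y\<bar> * (max x y) ^ n)"
proof -
  have "\<bar>x ^ Suc n - y ^ Suc n\<bar> = \<bar>x - y\<bar> * \<bar>\<Sum>p<Suc n. x ^ p * y ^ (n - p)\<bar>"
    unfolding diff_power_eq_sum by (simp only: abs_mult)
  also have "\<dots> \<le> \<bar>x - y\<bar> * (\<Sum>p<Suc n. (max x y) ^ n)"
  proof (intro mult_left_mono order_trans[OF sum_abs sum_mono])
    fix p assume p: "p \<in> {..<Suc n}"
    have "x ^ p * y ^ (n - p) \<le> max x y ^ p * max x y ^ (n - p)"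
      using assms by (intro mult_mono power_mono) auto
    also have "\<dots> = max x y ^ n" using p by (simp add: power_add[symmetric])
    finally show "\<bar>x ^ p * y ^ (n - p)\<bar> \<le> max x y ^ n" using assms by simp
  qed simp
  also have "\<dots> = Suc n * (\<bar>x - y\<bar> * (max x y) ^ n)" by simp
  finally show ?thesis .
qed

text \<open>A commutator estimate in the style of Kato and Ponce. The difference of the weights
  gains a factor \<open>jb (k - l)\<close> and loses one power of the weight, and this lost power is
  what the factor \<open>l\<close> from the derivative restores. Expanding
  \<open>(J + L) ^ n\<close> leaves one of the two frequencies with the full weight \<open>s\<close>
  and the other with a single power.\<close>

lemma jb_power_commutator:
  "\<bar>jb k ^ s - jb l ^ s\<bar> * \<bar>real_of_int l\<bar> \<le> real s * 2 ^ s * (jb (k - l) * jb l ^ s + jb (k - l) ^ s * jb l)"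
proof (cases s)
  case (Suc n)
  define J where "J = jb (k - l)"
  define L where "L = jb l"
  have JL: "1 \<le> J" "1 \<le> L" by (simp_all add: J_def L_def)
  have d: "\<bar>jb k - jb l\<bar> \<le> J" unfolding jb_def J_def by linarith
  have m: "max (jb k) (jb l) \<le> J + L" unfolding jb_def J_def L_def by linarith
  have mm: "0 \<le> max (jb k) (jb l)" by (simp add: le_max_iff_disj)
  have "\<bar>jb k ^ s - jb l ^ s\<bar> \<le> s * (\<bar>jb k - jb l\<bar> * (max (jb k) (jb l)) ^ n)"
    unfolding Suc by (rule power_diff_abs_le) auto
  also have "\<dots> \<le> s * (J * (J + L) ^ n)"
    using d m mm JL by (intro mult_left_mono mult_mono power_mono) auto
  also have "\<dots> \<le> s * (J * (2 ^ n * (J ^ n + L ^ n)))"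
  proof -
    have "(J + L) ^ n \<le> (2 * max J L) ^ n"
      using JL by (intro power_mono) auto
    also have "\<dots> = 2 ^ n * max J L ^ n" by (simp add: power_mult_distrib)
    also have "max J L ^ n \<le> J ^ n + L ^ n" using JL by (auto simp: max_def)
    finally show ?thesis using JL by (intro mult_left_mono) auto
  qed
  finally have "\<bar>jb k ^ s - jb l ^ s\<bar> * \<bar>real_of_int l\<bar> \<le> s * (J * (2 ^ n * (J ^ n + L ^ n))) * L"
    using JL abs_le_jb[of l] by (intro mult_mono) (auto simp: L_def)
  also have "\<dots> = real s * 2 ^ n * (J * L ^ s + J ^ s * L)"
    unfolding Suc by (simp add: algebra_simps)
  also have "\<dots> \<le> real s * 2 ^ s * (J * L ^ s + J ^ s * L)"
    using JL by (intro mult_right_mono mult_left_mono) (auto simp: Suc)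
  finally show ?thesis by (simp add: J_def L_def)
qed simp

text \<open>\<open>Q / 2\<close> is the price of the skew part. In the commutator part
  \<open>real s * 2 ^ s\<close> comes from \<open>jb_power_commutator\<close>, \<open>Q\<close> from
  its term with the high weight on \<open>c\<close> (\<open>schur_difference\<close>), and
  \<open>(1 + Q\<^sup>2) / 2\<close> from its term with the high weight on the velocity
  (\<open>schur_right\<close>).\<close>

definition energy_const :: "real \<Rightarrow> nat \<Rightarrow> real" where
  "energy_const Q s = Q / 2 + real s * 2 ^ s * (Q + (1 + Q\<^sup>2) / 2)"

lemma energy_const_nonneg: "0 \<le> Q \<Longrightarrow> 0 \<le> energy_const Q s"
  by (simp add: energy_const_def)

text \<open>Writing \<open>jb k ^ s\<close> as \<open>jb l ^ s\<close> plus a difference gives the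
  skew form of the weighted family \<open>z\<close>, where no derivative is lost, and the commutator
  remainder \<open>R\<close>. The result is linear in the energy of order \<open>s\<close>, with
  only \<open>A\<close> as a factor; this is what lets all higher orders follow from the one that
  controls \<open>A\<close>.\<close>

lemma advection_energy:
  assumes I: "finite I" and c0: "\<And>k. k \<notin> I \<Longrightarrow> c k = 0"
    and q: "\<And>j. q (- j) = cnj (q j)" "\<And>j. norm (q j) \<le> Q"
    and A: "sums_le (\<lambda>j. jb j * norm (c j)) A"
  shows "Re (\<Sum>k\<in>I. of_real ((jb k ^ s)\<^sup>2) * (cnj (c k) * adv (vel q c) c k))
    \<le> energy_const Q s * A * (\<Sum>k\<in>I. (jb k ^ s * norm (c k))\<^sup>2)"
proof -
  define v where "v = vel q c"
  define z where "z k = of_real (jb k ^ s) * c k" for k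
  define E where "E = (\<Sum>k\<in>I. (jb k ^ s * norm (c k))\<^sup>2)"
  have nz: "norm (z k) = jb k ^ s * norm (c k)" for k by (simp add: z_def norm_mult norm_power)
  have vA: "sums_le (\<lambda>j. jb j * norm (v j)) (Q * A)"
    unfolding v_def by (rule sums_le_vel[OF q(2) _ _ A]) auto
  have cE: "sums_le (\<lambda>j. (jb j ^ s * norm (c j))\<^sup>2) E"
    unfolding E_def by (rule sums_le_support[OF I]) (auto simp: c0)
  have vE: "sums_le (\<lambda>j. (jb j ^ s * norm (v j))\<^sup>2) (Q\<^sup>2 * E)"
    unfolding v_def by (rule sums_le_vel_sq[OF q(2) _ cE]) auto
  define R where "R k l = cnj (z k) * (v (k - l) * (\<i> * of_int l) * (of_real (jb k ^ s - jb l ^ s) * c l))" for k l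
  have "(\<Sum>k\<in>I. of_real ((jb k ^ s)\<^sup>2) * (cnj (c k) * adv (vel q c) c k))
     = (\<Sum>k\<in>I. \<Sum>l\<in>I. of_real ((jb k ^ s)\<^sup>2) * (cnj (c k) * (v (k - l) * (\<i> * of_int l) * c l)))"
    by (simp add: adv_finite[OF I c0] v_def sum_distrib_left)
  also have "\<dots> = (\<Sum>k\<in>I. \<Sum>l\<in>I. cnj (z k) * (v (k - l) * (\<i> * of_int l) * z l) + R k l)"
    by (intro sum.cong refl) (simp add: z_def R_def power2_eq_square algebra_simps)
  also have "\<dots> = (\<Sum>k\<in>I. \<Sum>l\<in>I. cnj (z k) * (v (k - l) * (\<i> * of_int l) * z l)) + (\<Sum>k\<in>I. \<Sum>l\<in>I. R k l)"
    by (simp add: sum.distrib)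
  finally have eq: "Re (\<Sum>k\<in>I. of_real ((jb k ^ s)\<^sup>2) * (cnj (c k) * adv (vel q c) c k))
     = Re (\<Sum>k\<in>I. \<Sum>l\<in>I. cnj (z k) * (v (k - l) * (\<i> * of_int l) * z l)) + Re (\<Sum>k\<in>I. \<Sum>l\<in>I. R k l)"
    by simp
  have first: "Re (\<Sum>k\<in>I. \<Sum>l\<in>I. cnj (z k) * (v (k - l) * (\<i> * of_int l) * z l)) \<le> Q * A / 2 * E"
    using advection_skew[OF I _ vA, of z] vel_cnj[of q c] q(1) by (simp add: E_def nz v_def)
  have "Re (\<Sum>k\<in>I. \<Sum>l\<in>I. R k l) \<le> norm (\<Sum>k\<in>I. \<Sum>l\<in>I. R k l)"
    by (rule complex_Re_le_cmod)
  also have "\<dots> \<le> (\<Sum>k\<in>I. \<Sum>l\<in>I. real s * 2 ^ s * ((jb (k - l) * norm (v (k - l))) * norm (z k) * norm (z l)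
      + (jb l * norm (c l)) * norm (z k) * (jb (k - l) ^ s * norm (v (k - l)))))"
  proof (intro sum_norm_le)
    fix k l
    have "norm (R k l) = norm (z k) * norm (v (k - l)) * norm (c l) * (\<bar>jb k ^ s - jb l ^ s\<bar> * \<bar>real_of_int l\<bar>)"
      unfolding R_def by (simp only: norm_mult complex_mod_cnj norm_of_real norm_of_int norm_ii) (simp add: mult_ac)
    also have "\<dots> \<le> norm (z k) * norm (v (k - l)) * norm (c l) * (real s * 2 ^ s * (jb (k - l) * jb l ^ s + jb (k - l) ^ s * jb l))"
      by (intro mult_left_mono jb_power_commutator) auto
    finally show "norm (R k l) \<le> real s * 2 ^ s * ((jb (k - l) * norm (v (k - l))) * norm (z k) * norm (z l)
      + (jb l * norm (c l)) * norm (z k) * (jb (k - l) ^ s * norm (v (k - l))))"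
      by (simp add: nz[of l] algebra_simps)
  qed
  also have "\<dots> = real s * 2 ^ s * ((\<Sum>k\<in>I. \<Sum>l\<in>I. (jb (k - l) * norm (v (k - l))) * norm (z k) * norm (z l))
      + (\<Sum>k\<in>I. \<Sum>l\<in>I. (jb l * norm (c l)) * norm (z k) * (jb (k - l) ^ s * norm (v (k - l)))))"
    by (simp only: sum_distrib_left[symmetric] sum.distrib)
  also have "\<dots> \<le> real s * 2 ^ s * (Q * A / 2 * ((\<Sum>k\<in>I. (norm (z k))\<^sup>2) + (\<Sum>k\<in>I. (norm (z k))\<^sup>2))
      + A / 2 * ((\<Sum>k\<in>I. (norm (z k))\<^sup>2) + Q\<^sup>2 * E))"
    by (intro mult_left_mono add_mono schur_difference schur_right I vA A vE) auto
  also have "\<dots> = real s * 2 ^ s * (Q + (1 + Q\<^sup>2) / 2) * A * E"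
    unfolding nz E_def[symmetric] by (simp add: field_simps)
  finally show ?thesis
    using eq first unfolding energy_const_def E_def[symmetric] by (simp add: algebra_simps)
qed

text \<open>The difference of the two quadratic terms is the velocity of \<open>y\<close>
  transporting \<open>d\<close> plus the velocity of \<open>d\<close> transporting \<open>x\<close>.
  The first is skew in \<open>d\<close>; in the second the derivative falls on \<open>x\<close>,
  where \<open>A\<close> controls it. Thus only the unweighted norm of \<open>d\<close>
  appears.\<close>

lemma advection_difference:
  assumes I: "finite I" and xy0: "\<And>k. k \<notin> I \<Longrightarrow> x k = 0" "\<And>k. k \<notin> I \<Longrightarrow> y k = 0"
    and q: "\<And>j. q (- j) = cnj (q j)" "\<And>j. norm (q j) \<le> Q"
    and A: "sums_le (\<lambda>j. jb j * norm (x j)) A" "sums_le (\<lambda>j. jb j * norm (y j)) A"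
  shows "Re (\<Sum>k\<in>I. cnj (x k - y k) * (adv (vel q x) x k - adv (vel q y) y k))
    \<le> (Q / 2 + (1 + Q\<^sup>2) / 2) * A * (\<Sum>k\<in>I. (norm (x k - y k))\<^sup>2)"
proof -
  define d where "d k = x k - y k" for k
  define E where "E = (\<Sum>k\<in>I. (norm (d k))\<^sup>2)"
  have d0: "d k = 0" if "k \<notin> I" for k using that by (simp add: d_def xy0)
  have yA: "sums_le (\<lambda>j. jb j * norm (vel q y j)) (Q * A)"
    by (rule sums_le_vel[OF q(2) _ _ A(2)]) auto
  have "sums_le (\<lambda>j. (1 * norm (d j))\<^sup>2) E"
    using sums_le_support[OF I, of "\<lambda>j. (1 * norm (d j))\<^sup>2"] by (simp add: E_def d0)
  from sums_le_vel_sq[OF q(2) _ this] have dE: "sums_le (\<lambda>j. (norm (vel q d j))\<^sup>2) (Q\<^sup>2 * E)"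
    by simp
  have ax: "adv v x k = (\<Sum>l\<in>I. v (k - l) * (\<i> * of_int l) * x l)" for v k
    by (rule adv_finite[OF I]) (rule xy0)
  have ay: "adv v y k = (\<Sum>l\<in>I. v (k - l) * (\<i> * of_int l) * y l)" for v k
    by (rule adv_finite[OF I]) (rule xy0)
  have "adv (vel q x) x k - adv (vel q y) y k
     = (\<Sum>l\<in>I. vel q y (k - l) * (\<i> * of_int l) * d l + vel q d (k - l) * (\<i> * of_int l) * x l)" for k
    unfolding ax ay sum_subtractf[symmetric]
    by (intro sum.cong refl) (simp add: d_def [abs_def] vel_diff algebra_simps)
  then have "Re (\<Sum>k\<in>I. cnj (d k) * (adv (vel q x) x k - adv (vel q y) y k))
    = Re (\<Sum>k\<in>I. \<Sum>l\<in>I. cnj (d k) * (vel q y (k - l) * (\<i> * of_int l) * d l))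
     + Re (\<Sum>k\<in>I. \<Sum>l\<in>I. cnj (d k) * (vel q d (k - l) * (\<i> * of_int l) * x l))"
    by (simp only: sum_distrib_left sum.distrib distrib_left plus_complex.sel)
  moreover have "Re (\<Sum>k\<in>I. \<Sum>l\<in>I. cnj (d k) * (vel q y (k - l) * (\<i> * of_int l) * d l)) \<le> Q * A / 2 * E"
    unfolding E_def by (rule advection_skew[OF I _ yA]) (simp add: vel_cnj q)
  moreover have "Re (\<Sum>k\<in>I. \<Sum>l\<in>I. cnj (d k) * (vel q d (k - l) * (\<i> * of_int l) * x l)) \<le> A / 2 * (E + Q\<^sup>2 * E)"
  proof -
    have "Re (\<Sum>k\<in>I. \<Sum>l\<in>I. cnj (d k) * (vel q d (k - l) * (\<i> * of_int l) * x l))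
       \<le> norm (\<Sum>k\<in>I. \<Sum>l\<in>I. cnj (d k) * (vel q d (k - l) * (\<i> * of_int l) * x l))"
      by (rule complex_Re_le_cmod)
    also have "\<dots> \<le> (\<Sum>k\<in>I. \<Sum>l\<in>I. (jb l * norm (x l)) * norm (d k) * norm (vel q d (k - l)))"
    proof (intro sum_norm_le)
      fix k l
      have "norm (cnj (d k) * (vel q d (k - l) * (\<i> * of_int l) * x l))
        = norm (d k) * (norm (vel q d (k - l)) * \<bar>real_of_int l\<bar> * norm (x l))"
        by (simp add: norm_mult)
      also have "\<dots> \<le> norm (d k) * (norm (vel q d (k - l)) * jb l * norm (x l))"
        by (intro mult_left_mono mult_right_mono abs_le_jb) auto
      finally show "norm (cnj (d k) * (vel q d (k - l) * (\<i> * of_int l) * x l))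
         \<le> (jb l * norm (x l)) * norm (d k) * norm (vel q d (k - l))"
        by (simp add: mult_ac)
    qed
    also have "\<dots> \<le> A / 2 * ((\<Sum>k\<in>I. (norm (d k))\<^sup>2) + Q\<^sup>2 * E)"
      by (intro schur_right I A dE) auto
    finally show ?thesis by (simp add: E_def)
  qed
  moreover have "Q * A / 2 * E + A / 2 * (E + Q\<^sup>2 * E) = (Q / 2 + (1 + Q\<^sup>2) / 2) * A * E"
    by (simp add: field_simps)
  ultimately show ?thesis
    unfolding d_def[symmetric] E_def[symmetric] by linarith
qed

section \<open>Ordinary differential equations with quadratic right-hand side\<close>

text \<open>Makes the bounded functions on the discrete integers a Banach space, the state space of
  the truncated systems.\<close>

instance bcontfun :: (metric_space, banach) banach ..

text \<open>Picard iteration for the weighted unknown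
  \<open>exp (- (2 * L * t)) *\<^sub>R x t\<close>. In this norm of Bielecki the integral operator
  contracts by one half on an interval of any length, so no short intervals have to be
  glued.\<close>

lemma global_picard:
  fixes f :: "'a::banach \<Rightarrow> 'a"
  assumes L: "0 < L" and lip: "\<And>x y. norm (f x - f y) \<le> L * norm (x - y)" and T: "0 \<le> T"
  obtains x where "x 0 = x0" "\<And>t. t \<in> {0..T} \<Longrightarrow> (x has_vector_derivative f (x t)) (at t within {0..T})"
proof -
  \<comment> \<open>Freezing time outside \<open>{0..T}\<close> turns a function on the interval
    into a bounded continuous function on the line, the space in which the fixed point is
    taken.\<close>
  define clip where "clip t = max 0 (min T t)" for t :: real
  have clip_in: "clip t \<in> {0..T}" for t using T by (auto simp: clip_def)
  have clip_id: "clip t = t" if "t \<in> {0..T}" for t using that by (auto simp: clip_def)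
  have clip_cont: "continuous_on S clip" for S unfolding clip_def by (intro continuous_intros)
  have fcont: "continuous_on S f" for S
  proof -
    have "L-lipschitz_on UNIV f"
      using L lip by (auto simp: lipschitz_on_def dist_norm)
    then show ?thesis by (meson continuous_on_subset lipschitz_on_continuous_on subset_UNIV)
  qed
  define h where "h y s = f (exp (2 * L * s) *\<^sub>R apply_bcontfun y s)" for y :: "real \<Rightarrow>\<^sub>C 'a" and s
  have hcont: "continuous_on S (h y)" for S y
    unfolding h_def by (rule continuous_on_compose2[OF fcont[of UNIV]]) (auto intro!: continuous_intros)
  define G where "G y t = exp (- (2 * L * t)) *\<^sub>R (x0 + integral {0..t} (h y))" for y t
  define \<Phi> where "\<Phi> y = Bcontfun (\<lambda>t. G y (clip t))" for y
  have Gcont: "continuous_on {0..T} (G y)" for y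
    unfolding G_def by (intro continuous_intros indefinite_integral_continuous_1 integrable_continuous_real hcont)
  have mem: "(\<lambda>t. G y (clip t)) \<in> bcontfun" for y
  proof -
    have "continuous_on UNIV (\<lambda>t. G y (clip t))"
      by (rule continuous_on_compose2[OF Gcont clip_cont]) (use clip_in in auto)
    moreover have "bounded (range (\<lambda>t. G y (clip t)))"
      by (rule bounded_subset[OF compact_imp_bounded[OF compact_continuous_image[OF Gcont compact_Icc]]])
        (use clip_in in auto)
    ultimately show ?thesis by (simp add: bcontfun_def)
  qed
  have \<Phi>: "apply_bcontfun (\<Phi> y) t = G y (clip t)" for y t
    unfolding \<Phi>_def using mem by (simp add: Bcontfun_inverse)
  have contr: "dist (\<Phi> y) (\<Phi> z) \<le> (1/2) * dist y z" for y z
  proof (rule dist_bound)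
    fix t
    define \<tau> where "\<tau> = clip t"
    have \<tau>: "0 \<le> \<tau>" using clip_in[of t] by (simp add: \<tau>_def)
    have ex: "((\<lambda>s. L * exp (2 * L * s)) has_integral (exp (2 * L * \<tau>) / 2 - exp (2 * L * 0) / 2)) {0..\<tau>}"
      by (rule fundamental_theorem_of_calculus[OF \<tau>])
        (use L in \<open>auto intro!: derivative_eq_intros simp: has_real_derivative_iff_has_vector_derivative[symmetric]\<close>)
    have "norm (integral {0..\<tau>} (h y) - integral {0..\<tau>} (h z)) = norm (integral {0..\<tau>} (\<lambda>s. h y s - h z s))"
      by (subst Henstock_Kurzweil_Integration.integral_diff) (auto intro!: integrable_continuous_real hcont)
    also have "\<dots> \<le> integral {0..\<tau>} (\<lambda>s. L * exp (2 * L * s) * dist y z)"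
    proof (rule integral_norm_bound_integral)
      show "(\<lambda>s. h y s - h z s) integrable_on {0..\<tau>}"
        by (intro integrable_continuous_real continuous_intros hcont)
      show "(\<lambda>s. L * exp (2 * L * s) * dist y z) integrable_on {0..\<tau>}"
        by (intro integrable_continuous_real continuous_intros)
      fix s assume "s \<in> {0..\<tau>}"
      have "norm (h y s - h z s) \<le> L * norm (exp (2 * L * s) *\<^sub>R (apply_bcontfun y s - apply_bcontfun z s))"
        unfolding h_def scaleR_diff_right by (rule lip)
      also have "\<dots> = L * exp (2 * L * s) * dist (apply_bcontfun y s) (apply_bcontfun z s)"
        by (simp add: dist_norm)
      also have "\<dots> \<le> L * exp (2 * L * s) * dist y z"
        using L by (intro mult_left_mono dist_bounded) auto
      finally show "norm (h y s - h z s) \<le> L * exp (2 * L * s) * dist y z" .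
    qed
    also have "\<dots> = (exp (2 * L * \<tau>) / 2 - exp (2 * L * 0) / 2) * dist y z"
      using has_integral_mult_left[OF ex, of "dist y z"] by (rule integral_unique)
    also have "\<dots> \<le> exp (2 * L * \<tau>) / 2 * dist y z"
      by (intro mult_right_mono) auto
    finally have "exp (- (2 * L * \<tau>)) * norm (integral {0..\<tau>} (h y) - integral {0..\<tau>} (h z))
        \<le> exp (- (2 * L * \<tau>)) * (exp (2 * L * \<tau>) / 2 * dist y z)"
      by (intro mult_left_mono) auto
    also have "\<dots> = 1/2 * dist y z" by (simp add: exp_minus)
    finally show "dist (apply_bcontfun (\<Phi> y) t) (apply_bcontfun (\<Phi> z) t) \<le> 1/2 * dist y z"
      unfolding \<Phi> \<tau>_def[symmetric] G_def dist_norm scaleR_diff_right[symmetric] by simp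
  qed
  have "\<exists>!y. \<Phi> y = y"
    by (rule banach_fix_type[of "1/2"]) (use contr in auto)
  then obtain y where y: "\<Phi> y = y" by blast
  define x where "x t = x0 + integral {0..t} (h y)" for t
  have hx: "h y t = f (x t)" if "t \<in> {0..T}" for t
  proof -
    have "apply_bcontfun y t = exp (- (2 * L * t)) *\<^sub>R x t"
      using \<Phi>[of y t] y clip_id[OF that] by (simp add: G_def x_def)
    then show ?thesis by (simp add: h_def exp_minus)
  qed
  show ?thesis
  proof (rule that)
    show "x 0 = x0" by (simp add: x_def)
    fix t assume t: "t \<in> {0..T}"
    have "((\<lambda>t. integral {0..t} (h y)) has_vector_derivative h y t) (at t within {0..T})"
      by (rule integral_has_vector_derivative[OF hcont t])
    then show "(x has_vector_derivative f (x t)) (at t within {0..T})"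
      unfolding hx[OF t] x_def by (auto intro!: derivative_eq_intros)
  qed
qed

definition retract :: "real \<Rightarrow> 'a::real_normed_vector \<Rightarrow> 'a" where
  "retract R x = (R / max R (norm x)) *\<^sub>R x"

lemma norm_retract_le: "0 < R \<Longrightarrow> norm (retract R x) \<le> R"
  by (auto simp: retract_def max_def field_simps)

lemma retract_lipschitz:
  assumes R: "0 < R"
  shows "norm (retract R x - retract R y) \<le> 2 * norm (x - y)"
proof -
  define p where "p x = max R (norm x)" for x :: 'a
  have p: "0 < p x" "R \<le> p x" "norm x \<le> p x" for x using R by (auto simp: p_def less_max_iff_disj)
  have pd: "\<bar>p y - p x\<bar> \<le> norm (x - y)"
    using norm_triangle_ineq3[of x y] unfolding p_def by linarith
  have "retract R x - retract R y = (R / p x) *\<^sub>R (x - y) + (R / p x - R / p y) *\<^sub>R y"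
    by (simp add: retract_def p_def algebra_simps)
  also have "norm \<dots> \<le> norm ((R / p x) *\<^sub>R (x - y)) + norm ((R / p x - R / p y) *\<^sub>R y)"
    by (rule norm_triangle_ineq)
  also have "\<dots> = R / p x * norm (x - y) + \<bar>R / p x - R / p y\<bar> * norm y"
    using R p(1)[of x] by simp
  also have "\<dots> \<le> 1 * norm (x - y) + norm (x - y)"
  proof (intro add_mono mult_right_mono)
    show "R / p x \<le> 1" using p(1,2)[of x] by simp
    have "R / p x - R / p y = R * (p y - p x) / (p x * p y)"
      using p(1)[of x] p(1)[of y] by (simp add: field_simps)
    then have "\<bar>R / p x - R / p y\<bar> * norm y = R / p x * (norm y / p y) * \<bar>p y - p x\<bar>"
      using R p(1)[of x] p(1)[of y] by (simp add: abs_mult abs_divide)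
    also have "\<dots> \<le> 1 * 1 * norm (x - y)"
      using R p[of x] p[of y] pd by (intro mult_mono) auto
    finally show "\<bar>R / p x - R / p y\<bar> * norm y \<le> norm (x - y)" by simp
  qed simp
  finally show ?thesis by simp
qed

text \<open>The damping factor only rescales time, so it does not affect monotonicity properties of the
  quadratic flow; once an a priori bound \<open>norm (x t) \<le> R\<close> is known, it disappears.\<close>
lemma damped_quadratic_ode:
  fixes B :: "'a::banach \<Rightarrow> 'a \<Rightarrow> 'a"
  assumes B: "bounded_bilinear B" and R: "0 < R" and T: "0 \<le> T"
  obtains x \<phi> where "x 0 = x0"
    "\<And>t. t \<in> {0..T} \<Longrightarrow> (x has_vector_derivative (\<phi> t *\<^sub>R B (x t) (x t))) (at t within {0..T})"
    "\<And>t. 0 \<le> \<phi> t" "\<And>t. \<phi> t \<le> (1::real)" "\<And>t. norm (x t) \<le> R \<Longrightarrow> \<phi> t = 1"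
proof -
  interpret bounded_bilinear B by fact
  obtain K where K: "0 < K" "\<And>a b. norm (B a b) \<le> norm a * norm b * K" using pos_bounded by blast
  define f where "f x = B (retract R x) (retract R x)" for x
  have lip: "norm (f x - f y) \<le> 4 * R * K * norm (x - y)" for x y
  proof -
    let ?x = "retract R x" and ?y = "retract R y"
    have "f x - f y = B (?x - ?y) ?x + B ?y (?x - ?y)"
      by (simp add: f_def diff_left diff_right)
    also have "norm \<dots> \<le> norm (?x - ?y) * norm ?x * K + norm ?y * norm (?x - ?y) * K"
      by (rule order_trans[OF norm_triangle_ineq add_mono[OF K(2) K(2)]])
    also have "\<dots> \<le> (2 * norm (x - y)) * R * K + R * (2 * norm (x - y)) * K"
      using R K by (intro add_mono mult_mono retract_lipschitz norm_retract_le) auto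
    finally show ?thesis by (simp add: algebra_simps)
  qed
  have "0 < 4 * R * K" using R K by simp
  from global_picard[OF this lip T] obtain x where
    x: "x 0 = x0" "\<And>t. t \<in> {0..T} \<Longrightarrow> (x has_vector_derivative f (x t)) (at t within {0..T})" by blast
  \<comment> \<open>Both arguments of the quadratic field are retracted, hence the square.\<close>
  define \<phi> where "\<phi> t = (R / max R (norm (x t)))\<^sup>2" for t
  have f\<phi>: "f (x t) = \<phi> t *\<^sub>R B (x t) (x t)" for t
    by (simp add: f_def retract_def scaleR_left scaleR_right \<phi>_def power2_eq_square)
  show ?thesis
  proof (rule that[of x \<phi>])
    show "\<phi> t \<le> 1" for t using R unfolding \<phi>_def by (intro power_le_one) (auto simp: max_def divide_le_eq)
    show "norm (x t) \<le> R \<Longrightarrow> \<phi> t = 1" for t using R by (simp add: \<phi>_def max_def)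
  qed (use x f\<phi> in \<open>auto simp: \<phi>_def\<close>)
qed

section \<open>Galerkin approximation\<close>

text \<open>\<open>exp (- (A * s)) * f s - B * s\<close> decreases, because the exponential is at
  most 1 where it multiplies \<open>B\<close>. The derivative is asked for at interior times only,
  so one-sided derivatives at the endpoints never arise.\<close>

lemma gronwall:
  fixes f :: "real \<Rightarrow> real"
  assumes t: "0 \<le> t" and cont: "continuous_on {0..t} f"
    and der: "\<And>s. 0 < s \<Longrightarrow> s < t \<Longrightarrow> \<exists>D. (f has_real_derivative D) (at s) \<and> D \<le> A * f s + B"
    and A: "0 \<le> A" and B: "0 \<le> B"
  shows "f t \<le> (f 0 + B * t) * exp (A * t)"
proof -
  define h where "h s = exp (- (A * s)) * f s - B * s" for s
  have "h 0 \<ge> h t"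
  proof (rule DERIV_nonpos_imp_decreasing_open[OF t])
    show "continuous_on {0..t} h" unfolding h_def by (intro continuous_intros cont)
    fix s assume s: "0 < s" "s < t"
    from der[OF s] obtain D where D: "(f has_real_derivative D) (at s)" "D \<le> A * f s + B" by blast
    have "(h has_real_derivative (exp (- (A * s)) * (D - A * f s) - B)) (at s)"
      unfolding h_def using D(1) by (auto intro!: derivative_eq_intros simp: algebra_simps)
    moreover have "exp (- (A * s)) * (D - A * f s) \<le> exp (- (A * s)) * B"
      using D(2) by (intro mult_left_mono) auto
    moreover have "exp (- (A * s)) * B \<le> 1 * B"
      using A B s by (intro mult_right_mono) auto
    ultimately show "\<exists>y. (h has_real_derivative y) (at s) \<and> y \<le> 0"
      by (intro exI[of _ "exp (- (A * s)) * (D - A * f s) - B"] conjI) linarith+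
  qed
  then have "exp (- (A * t)) * f t \<le> f 0 + B * t" by (simp add: h_def)
  then have "exp (A * t) * (exp (- (A * t)) * f t) \<le> exp (A * t) * (f 0 + B * t)"
    by (intro mult_left_mono) auto
  then show ?thesis by (simp add: exp_minus mult_ac)
qed

text \<open>The substitution \<open>1 / sqrt F\<close> linearises the inequality: this quantity
  decreases at rate at most \<open>K / 2\<close>. The smallness of \<open>t\<close> lets it lose at
  most half of the initial lower bound \<open>1 / sqrt F0\<close>, and squaring gives the factor
  4.\<close>

lemma riccati_bound:
  fixes F :: "real \<Rightarrow> real"
  assumes t: "0 \<le> t" and cont: "continuous_on {0..t} F" and pos: "\<And>s. s \<in> {0..t} \<Longrightarrow> 0 < F s"
    and der: "\<And>s. 0 < s \<Longrightarrow> s < t \<Longrightarrow> \<exists>D. (F has_real_derivative D) (at s) \<and> D \<le> K * (F s * sqrt (F s))"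
    and F0: "F 0 \<le> F0" and small: "K * t * sqrt F0 \<le> 1" and K: "0 \<le> K"
  shows "F t \<le> 4 * F0"
proof -
  have F0pos: "0 < F0" using pos[of 0] F0 t by simp
  define h where "h s = inverse (sqrt (F s)) + K / 2 * s" for s
  have "h 0 \<le> h t"
  proof (rule DERIV_nonneg_imp_increasing_open[OF t])
    show "continuous_on {0..t} h" unfolding h_def using pos
      by (intro continuous_intros cont) (auto, fastforce)
    fix s assume s: "0 < s" "s < t"
    then have Fs: "0 < F s" using pos[of s] by simp
    from der[OF s] obtain D where D: "(F has_real_derivative D) (at s)" "D \<le> K * (F s * sqrt (F s))" by blast
    have "((\<lambda>s. sqrt (F s)) has_real_derivative (inverse (sqrt (F s)) / 2 * D)) (at s)"
      by (rule DERIV_chain2[OF DERIV_real_sqrt[OF Fs] D(1)])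
    then have "((\<lambda>s. inverse (sqrt (F s))) has_real_derivative
        - (inverse (sqrt (F s)) * (inverse (sqrt (F s)) / 2 * D) * inverse (sqrt (F s)))) (at s)"
      using Fs by (intro DERIV_inverse') auto
    from DERIV_add[OF this DERIV_cmult_Id[of "K / 2"]] have
      "(h has_real_derivative (- (inverse (sqrt (F s)) * (inverse (sqrt (F s)) / 2 * D) * inverse (sqrt (F s))) + K / 2)) (at s)"
      unfolding h_def .
    moreover have "inverse (sqrt (F s)) * (inverse (sqrt (F s)) / 2 * D) * inverse (sqrt (F s)) \<le> K / 2"
      using Fs D(2) by (simp add: field_simps)
    ultimately show "\<exists>y. (h has_real_derivative y) (at s) \<and> 0 \<le> y" by fastforce
  qed
  moreover have "inverse (sqrt F0) \<le> inverse (sqrt (F 0))"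
    using F0 pos[of 0] t by (intro le_imp_inverse_le) auto
  ultimately have "inverse (sqrt F0) \<le> inverse (sqrt (F t)) + K / 2 * t"
    by (simp add: h_def)
  moreover have "K / 2 * t \<le> inverse (sqrt F0) / 2"
    using small F0pos by (simp add: field_simps)
  ultimately have "inverse (sqrt F0) / 2 \<le> inverse (sqrt (F t))"
    by simp
  then have "sqrt (F t) \<le> 2 * sqrt F0"
    using F0pos pos[of t] t by (simp add: field_simps)
  then have "(sqrt (F t))\<^sup>2 \<le> (2 * sqrt F0)\<^sup>2"
    using pos[of t] t by (intro power_mono) auto
  then show ?thesis using F0pos pos[of t] t by (simp add: power_mult_distrib)
qed

lemma has_real_derivative_norm_sq:
  assumes "(c has_vector_derivative d) (at t within S)"
  shows "((\<lambda>s. (norm (c s))\<^sup>2) has_real_derivative (2 * Re (cnj (c t) * d))) (at t within S)"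
proof -
  have "((\<lambda>s. c s \<bullet> c s) has_derivative (\<lambda>h. c t \<bullet> (h *\<^sub>R d) + (h *\<^sub>R d) \<bullet> c t)) (at t within S)"
    using assms unfolding has_vector_derivative_def by (intro has_derivative_inner)
  moreover have "(\<lambda>h. c t \<bullet> (h *\<^sub>R d) + (h *\<^sub>R d) \<bullet> c t) = (*) (2 * Re (cnj (c t) * d))"
    by (rule ext) (simp add: inner_complex_def algebra_simps)
  ultimately show ?thesis
    unfolding has_field_derivative_def by (simp add: power2_norm_eq_inner)
qed

text \<open>\<open>q_cnj\<close> expresses that the multiplier maps real functions to real
  functions; \<open>advection_skew\<close> relies on it for the velocity.\<close>

locale multiplier =
  fixes q :: "int \<Rightarrow> complex" and Q :: real
  assumes q_cnj: "q (- j) = cnj (q j)" and q_bound: "norm (q j) \<le> Q"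
begin

lemma Q_nonneg: "0 \<le> Q"
  using q_bound[of 0] norm_ge_zero order_trans by blast

definition freqs :: "nat \<Rightarrow> int set" where
  "freqs N = {- int N..int N}"

lemma finite_freqs [simp]: "finite (freqs N)"
  by (simp add: freqs_def)

lemma jb_ge_notin_freqs: "k \<notin> freqs N \<Longrightarrow> real N + 1 \<le> jb k"
  by (auto simp: freqs_def jb_def)

text \<open>The number of frequencies varies with \<open>N\<close>, so all truncations share one
  state space, the bounded functions on the discrete integers. \<open>cut\<close> discards the
  coordinates outside \<open>freqs N\<close>; the field then depends on finitely many numbers, is
  bounded bilinear, and falls under \<open>damped_quadratic_ode\<close>.\<close>

lemma galerkin_damped:
  assumes T: "0 \<le> T" and R: "0 < R"
  obtains c \<phi> where
    "\<And>k. c 0 k = (if k \<in> freqs N then c0 k else 0)"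
    "\<And>t k. k \<notin> freqs N \<Longrightarrow> c t k = 0"
    "\<And>t k. t \<in> {0..T} \<Longrightarrow> k \<in> freqs N \<Longrightarrow>
       ((\<lambda>t. c t k) has_vector_derivative (\<phi> t *\<^sub>R adv (vel q (c t)) (c t) k)) (at t within {0..T})"
    "\<And>t. 0 \<le> \<phi> t" "\<And>t. \<phi> t \<le> (1::real)" "\<And>t. t \<in> {0..T} \<Longrightarrow> (\<And>k. norm (c t k) \<le> R) \<Longrightarrow> \<phi> t = 1"
proof -
  define I where "I = freqs N"
  define cut :: "(int discrete \<Rightarrow>\<^sub>C complex) \<Rightarrow> int \<Rightarrow> complex" where
    "cut x k = (if k \<in> I then apply_bcontfun x (discrete k) else 0)" for x k
  have fin: "finite I" by (simp add: I_def)
  have cont: "continuous_on UNIV f" for f :: "int discrete \<Rightarrow> complex"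
    by (simp add: continuous_on_open_vimage Discrete_Topology.open_discrete)
  have eqI: "f = h" if "\<And>k. apply_bcontfun f (discrete k) = apply_bcontfun h (discrete k)" for f h :: "int discrete \<Rightarrow>\<^sub>C complex"
    using that by (intro bcontfun_eqI) (metis of_discrete_inverse)
  define b where "b x y k = (if k \<in> I then \<Sum>l\<in>I. vel q (cut x) (k - l) * (\<i> * of_int l) * cut y l else 0)"
    for x y k
  define K where "K = (\<Sum>l\<in>I. Q * \<bar>real_of_int l\<bar>)"
  have cut_le: "norm (cut x k) \<le> norm x" for x k by (simp add: cut_def norm_bounded)
  have b_le: "norm (b x y k) \<le> norm x * norm y * K" for x y k
  proof (cases "k \<in> I")
    case True
    have "norm (b x y k) \<le> (\<Sum>l\<in>I. norm x * norm y * (Q * \<bar>real_of_int l\<bar>))"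
      unfolding b_def using True
    proof (simp, intro sum_norm_le)
      fix l
      have "norm (vel q (cut x) (k - l)) \<le> Q * ((norm (cut x (k - l)) + norm (cut x (- (k - l)))) / 2)"
        by (rule norm_vel_le[OF q_bound])
      also have "\<dots> \<le> Q * norm x"
        using cut_le[of x "k - l"] cut_le[of x "- (k - l)"] Q_nonneg by (intro mult_left_mono) auto
      finally have "norm (vel q (cut x) (k - l)) * \<bar>real_of_int l\<bar> * norm (cut y l) \<le> Q * norm x * \<bar>real_of_int l\<bar> * norm y"
        using Q_nonneg by (intro mult_mono cut_le) auto
      then show "norm (vel q (cut x) (k - l) * (\<i> * of_int l) * cut y l) \<le> norm x * norm y * (Q * \<bar>real_of_int l\<bar>)"
        by (simp add: norm_mult mult_ac)
    qed
    then show ?thesis by (simp add: K_def sum_distrib_left)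
  next
    case False
    then show ?thesis using Q_nonneg by (simp add: b_def K_def sum_nonneg)
  qed
  define B where "B x y = Bcontfun (\<lambda>k. b x y (of_discrete k))" for x y
  have B: "apply_bcontfun (B x y) (discrete k) = b x y k" for x y k
    unfolding B_def using bcontfun_normI[OF cont b_le[of x y]] by (simp add: Bcontfun_inverse discrete_inverse)
  have cut_add: "cut (x + y) = (\<lambda>k. cut x k + cut y k)" and cut_scale: "cut (r *\<^sub>R x) = (\<lambda>k. r *\<^sub>R cut x k)" for x y r
    by (auto simp: cut_def)
  have vel_add: "vel q (\<lambda>k. c k + d k) j = vel q c j + vel q d j" 
    and vel_scale: "vel q (\<lambda>k. r *\<^sub>R c k) j = r *\<^sub>R vel q c j" for c d j r
    by (simp_all add: vel_def scaleR_conv_of_real field_simps)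
  have "bounded_bilinear B"
  proof (unfold_locales)
    show "\<exists>K. \<forall>a b. norm (B a b) \<le> norm a * norm b * K"
      by (intro exI[of _ K] allI norm_bound) (metis B b_le of_discrete_inverse)
  qed (rule eqI, force simp: B b_def cut_add cut_scale vel_add vel_scale sum.distrib[symmetric]
        scaleR_sum_right algebra_simps)+
  from damped_quadratic_ode[OF this R T, of "Bcontfun (\<lambda>k. let k = of_discrete k in if k \<in> I then c0 k else 0)"]
  obtain x \<phi> where x: "x 0 = Bcontfun (\<lambda>k. let k = of_discrete k in if k \<in> I then c0 k else 0)"
    "\<And>t. t \<in> {0..T} \<Longrightarrow> (x has_vector_derivative (\<phi> t *\<^sub>R B (x t) (x t))) (at t within {0..T})"
    "\<And>t. 0 \<le> \<phi> t" "\<And>t. \<phi> t \<le> (1::real)" "\<And>t. norm (x t) \<le> R \<Longrightarrow> \<phi> t = 1" by blast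
  have ini: "apply_bcontfun (x 0) (discrete k) = (if k \<in> I then c0 k else 0)" for k
  proof -
    have "norm (if k \<in> I then c0 k else 0) \<le> (\<Sum>k\<in>I. norm (c0 k))" for k
      using fin by (auto intro: member_le_sum sum_nonneg)
    from bcontfun_normI[OF cont this, of "\<lambda>k. of_discrete k"] show ?thesis
      by (simp add: x(1) Bcontfun_inverse discrete_inverse Let_def)
  qed
  have ap: "bounded_linear (\<lambda>x::int discrete \<Rightarrow>\<^sub>C complex. apply_bcontfun x (discrete k))" for k
    by (rule bounded_linear_intro[of _ 1]) (auto simp: norm_bounded)
  have coord: "((\<lambda>t. apply_bcontfun (x t) (discrete k)) has_vector_derivative (\<phi> t *\<^sub>R b (x t) (x t) k)) (at t within {0..T})"
    if "t \<in> {0..T}" for t k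
    using bounded_linear.has_vector_derivative[OF ap x(2)[OF that], of k] by (simp add: B)
  \<comment> \<open>Discarded coordinates have zero time derivative and zero initial value. Hence
    the retained ones control the norm of the whole state, which is what switches the damping
    off.\<close>
  have out: "apply_bcontfun (x t) (discrete k) = 0" if "k \<notin> I" "t \<in> {0..T}" for k t
  proof -
    have "((\<lambda>t. apply_bcontfun (x t) (discrete k)) has_vector_derivative 0) (at t within {0..T})" if "t \<in> {0..T}" for t
      using coord[OF that, of k] \<open>k \<notin> I\<close> by (simp add: b_def)
    then obtain c where "\<And>s. s \<in> {0..T} \<Longrightarrow> apply_bcontfun (x s) (discrete k) = c"
      using has_vector_derivative_zero_constant[of "{0..T}" "\<lambda>t. apply_bcontfun (x t) (discrete k)"] by auto
    then show ?thesis using ini[of k] \<open>k \<notin> I\<close> that(2) T by (metis atLeastAtMost_iff order_refl)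
  qed
  show ?thesis
  proof (rule that[of "\<lambda>t. cut (x t)" \<phi>])
    show "cut (x 0) k = (if k \<in> freqs N then c0 k else 0)" for k
      by (simp add: cut_def ini I_def)
    show "k \<notin> freqs N \<Longrightarrow> cut (x t) k = 0" for t k by (simp add: cut_def I_def)
    show "((\<lambda>t. cut (x t) k) has_vector_derivative (\<phi> t *\<^sub>R adv (vel q (cut (x t))) (cut (x t)) k)) (at t within {0..T})"
      if "t \<in> {0..T}" "k \<in> freqs N" for t k
    proof -
      have "adv (vel q (cut (x t))) (cut (x t)) k = b (x t) (x t) k"
        using that(2) by (subst adv_finite[OF fin]) (auto simp: b_def cut_def I_def)
      then show ?thesis using coord[OF that(1), of k] that(2) by (simp add: cut_def I_def)
    qed
    show "\<phi> t = 1" if "t \<in> {0..T}" "\<And>k. norm (cut (x t) k) \<le> R" for t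
    proof (rule x(5), rule norm_bound)
      have "norm (apply_bcontfun (x t) (discrete k)) \<le> R" for k
        using that(2)[of k] out[of k t] that(1) R by (cases "k \<in> I") (auto simp: cut_def)
      then show "norm (apply_bcontfun (x t) k) \<le> R" for k by (metis of_discrete_inverse)
    qed
  qed (use x in auto)
qed


definition energy :: "nat \<Rightarrow> nat \<Rightarrow> (int \<Rightarrow> complex) \<Rightarrow> real" where
  "energy N s c = (\<Sum>k\<in>freqs N. (jb k ^ s * norm (c k))\<^sup>2)"

lemma energy_nonneg: "0 \<le> energy N s c"
  by (simp add: energy_def sum_nonneg)

lemma norm_le_energy:
  assumes "k \<in> freqs N"
  shows "norm (c k) \<le> sqrt (energy N s c) / jb k ^ s"
proof -
  have "(jb k ^ s * norm (c k))\<^sup>2 \<le> energy N s c"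
    unfolding energy_def using assms by (intro member_le_sum) auto
  then have "jb k ^ s * norm (c k) \<le> sqrt (energy N s c)"
    by (rule real_le_rsqrt)
  then show ?thesis by (simp add: field_simps)
qed

lemma energy_le_decay:
  assumes "\<And>k. norm (c k) \<le> C / jb k ^ Suc s"
  shows "energy N s c \<le> C\<^sup>2 * jsum"
proof -
  have "energy N s c \<le> (\<Sum>k\<in>freqs N. C\<^sup>2 * (1 / jb k ^ 2))"
    unfolding energy_def
  proof (rule sum_mono)
    fix k
    have "jb k ^ s * norm (c k) \<le> jb k ^ s * (C / jb k ^ Suc s)"
      by (intro mult_left_mono assms) auto
    also have "\<dots> = C / jb k" by (simp add: field_simps)
    finally have "(jb k ^ s * norm (c k))\<^sup>2 \<le> (C / jb k)\<^sup>2" by (intro power_mono) auto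
    then show "(jb k ^ s * norm (c k))\<^sup>2 \<le> C\<^sup>2 * (1 / jb k ^ 2)" by (simp add: power_divide)
  qed
  also have "\<dots> = C\<^sup>2 * (\<Sum>k\<in>freqs N. 1 / jb k ^ 2)" by (simp add: sum_distrib_left)
  also have "\<dots> \<le> C\<^sup>2 * jsum" by (intro mult_left_mono sum_jb_le_jsum) auto
  finally show ?thesis .
qed

text \<open>Cauchy-Schwarz for \<open>jb k ^ 2 * norm (c k)\<close> against \<open>1 / jb k\<close>;
  this singles out order two as the energy that controls the Lipschitz norm of the velocity.\<close>

lemma sums_le_energy:
  assumes "\<And>k. k \<notin> freqs N \<Longrightarrow> c k = 0"
  shows "sums_le (\<lambda>k. jb k * norm (c k)) (sqrt jsum * sqrt (energy N 2 c))"
proof -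
  have "(\<Sum>k\<in>freqs N. jb k * norm (c k)) = (\<Sum>k\<in>freqs N. (1 / jb k) * (jb k ^ 2 * norm (c k)))"
    by (intro sum.cong) (auto simp: power2_eq_square)
  then have "(\<Sum>k\<in>freqs N. jb k * norm (c k))\<^sup>2 \<le> (\<Sum>k\<in>freqs N. (1 / jb k)\<^sup>2) * energy N 2 c"
    unfolding energy_def by (simp only: Cauchy_Schwarz_ineq_sum)
  also have "\<dots> \<le> jsum * energy N 2 c"
    using sum_jb_le_jsum[of "freqs N"] energy_nonneg by (intro mult_right_mono) (auto simp: power_divide)
  finally have "(\<Sum>k\<in>freqs N. jb k * norm (c k)) \<le> sqrt (jsum * energy N 2 c)"
    by (rule real_le_rsqrt)
  moreover have "sums_le (\<lambda>k. jb k * norm (c k)) (\<Sum>k\<in>freqs N. jb k * norm (c k))"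
    using assms by (intro sums_le_support) auto
  ultimately show ?thesis
    by (elim sums_le_mono) (auto simp: real_sqrt_mult)
qed

text \<open>The 2 comes from differentiating a square, \<open>sqrt jsum\<close> from
  \<open>sums_le_energy\<close>.\<close>

definition growth :: "nat \<Rightarrow> real" where
  "growth s = 2 * energy_const Q s * sqrt jsum"

lemma growth_nonneg: "0 \<le> growth s"
  using energy_const_nonneg[OF Q_nonneg] jsum_ge_1 by (simp add: growth_def)

lemma energy_derivative:
  assumes supp: "\<And>k. k \<notin> freqs N \<Longrightarrow> c t k = 0"
    and der: "\<And>k. k \<in> freqs N \<Longrightarrow> ((\<lambda>t. c t k) has_vector_derivative (\<phi> *\<^sub>R adv (vel q (c t)) (c t) k)) (at t within S)"
    and \<phi>: "0 \<le> \<phi>" "\<phi> \<le> (1::real)"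
  shows "\<exists>D. ((\<lambda>t. energy N s (c t)) has_real_derivative D) (at t within S)
    \<and> D \<le> growth s * sqrt (energy N 2 (c t)) * energy N s (c t)"
proof (intro exI conjI)
  let ?a = "\<lambda>k. adv (vel q (c t)) (c t) k"
  let ?D = "\<Sum>k\<in>freqs N. (jb k ^ s)\<^sup>2 * (2 * Re (cnj (c t k) * (\<phi> *\<^sub>R ?a k)))"
  show "((\<lambda>t. energy N s (c t)) has_real_derivative ?D) (at t within S)"
    unfolding energy_def power_mult_distrib
    by (intro DERIV_sum DERIV_cmult has_real_derivative_norm_sq der)
  have "?D = 2 * \<phi> * Re (\<Sum>k\<in>freqs N. of_real ((jb k ^ s)\<^sup>2) * (cnj (c t k) * ?a k))"
    unfolding Re_sum sum_distrib_left by (intro sum.cong) (auto simp: algebra_simps)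
  also have "\<dots> \<le> 2 * \<phi> * (energy_const Q s * (sqrt jsum * sqrt (energy N 2 (c t))) * energy N s (c t))"
    unfolding energy_def[of N s] using \<phi>
    by (intro mult_left_mono advection_energy q_cnj q_bound sums_le_energy supp) auto
  also have "\<dots> = \<phi> * (growth s * sqrt (energy N 2 (c t)) * energy N s (c t))"
    by (simp add: growth_def)
  \<comment> \<open>The bound is nonnegative, so a damping factor between 0 and 1 preserves it. The
    energy estimates are therefore available before the damping is known to be inactive, and the
    argument that removes it is not circular.\<close>
  also have "\<dots> \<le> 1 * (growth s * sqrt (energy N 2 (c t)) * energy N s (c t))"
    using \<phi> growth_nonneg energy_nonneg by (intro mult_right_mono) auto
  finally show "?D \<le> growth s * sqrt (energy N 2 (c t)) * energy N s (c t)" by simp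
qed

lemma energy_continuous:
  assumes "\<And>k. k \<in> freqs N \<Longrightarrow> continuous_on S (\<lambda>t. c t k)"
  shows "continuous_on S (\<lambda>t. energy N s (c t))"
  unfolding energy_def by (intro continuous_intros assms)

definition rapid :: "(int \<Rightarrow> complex) \<Rightarrow> bool" where
  "rapid c \<longleftrightarrow> (\<forall>s. \<exists>C. \<forall>k. norm (c k) \<le> C / jb k ^ s)"

lemma galerkin:
  assumes c0: "rapid c0"
  obtains T M c where "0 < T"
    "\<And>N k. c N 0 k = (if k \<in> freqs N then c0 k else 0)"
    "\<And>N t k. k \<notin> freqs N \<Longrightarrow> c N t k = 0"
    "\<And>N t k. t \<in> {0..T} \<Longrightarrow> k \<in> freqs N \<Longrightarrow>
       ((\<lambda>t. c N t k) has_vector_derivative adv (vel q (c N t)) (c N t) k) (at t within {0..T})"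
    "\<And>N t k s. t \<in> {0..T} \<Longrightarrow> norm (c N t k) \<le> M s / jb k ^ s"
proof -
  have "\<exists>C. \<forall>s k. norm (c0 k) \<le> C s / jb k ^ Suc s"
    using c0 unfolding rapid_def by (intro choice allI) blast
  then obtain C where C: "\<And>s k. norm (c0 k) \<le> C s / jb k ^ Suc s" by blast
  \<comment> \<open>An energy may vanish, while \<open>riccati_bound\<close> divides by its root. It
    is applied to the energy plus 1, which accounts for the summand 1.\<close>
  define F0 where "F0 = (C 2)\<^sup>2 * jsum + 1"
  have F0: "1 \<le> F0" using jsum_ge_1 by (simp add: F0_def)
  \<comment> \<open>The time is fixed by the data at order two alone, before \<open>N\<close> and
    \<open>s\<close>. Since \<open>growth 2\<close> is only known to be nonnegative, 1 is added to
    keep the denominator positive.\<close>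
  define T where "T = 1 / ((growth 2 + 1) * sqrt F0)"
  have T: "0 < T" using F0 growth_nonneg[of 2] by (simp add: T_def)
  have small: "growth 2 * t * sqrt F0 \<le> 1" if "t \<in> {0..T}" for t
  proof -
    have "growth 2 * t * sqrt F0 \<le> (growth 2 + 1) * T * sqrt F0"
      using that growth_nonneg[of 2] F0 by (intro mult_right_mono mult_mono) auto
    also have "\<dots> = 1" using growth_nonneg[of 2] F0 by (simp add: T_def)
    finally show ?thesis .
  qed
  define G where "G s = growth s * (2 * sqrt F0)" for s
  define M where "M s = sqrt ((C s)\<^sup>2 * jsum * exp (G s * T))" for s
  have G0: "0 \<le> G s" for s using growth_nonneg F0 by (simp add: G_def)
  have M0: "0 \<le> M s" for s using jsum_ge_1 by (simp add: M_def)
  have "\<exists>c. (\<forall>k. c 0 k = (if k \<in> freqs N then c0 k else 0)) \<and> (\<forall>t k. k \<notin> freqs N \<longrightarrow> c t k = 0) \<and>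
     (\<forall>t\<in>{0..T}. \<forall>k\<in>freqs N. ((\<lambda>t. c t k) has_vector_derivative adv (vel q (c t)) (c t) k) (at t within {0..T})) \<and>
     (\<forall>t\<in>{0..T}. \<forall>k s. norm (c t k) \<le> M s / jb k ^ s)" for N
  proof -
    \<comment> \<open>The radius equals the bound on the root of the energy obtained in
      \<open>sE2\<close>, so the trajectory stays where the damping factor is 1.\<close>
    have "0 < 2 * sqrt F0" using F0 by simp
    from galerkin_damped[OF less_imp_le[OF T] this, of N c0] obtain c \<phi> where
      c: "\<And>k. c 0 k = (if k \<in> freqs N then c0 k else 0)"
      "\<And>t k. k \<notin> freqs N \<Longrightarrow> c t k = 0"
      "\<And>t k. t \<in> {0..T} \<Longrightarrow> k \<in> freqs N \<Longrightarrow>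
         ((\<lambda>t. c t k) has_vector_derivative (\<phi> t *\<^sub>R adv (vel q (c t)) (c t) k)) (at t within {0..T})"
      "\<And>t. 0 \<le> \<phi> t" "\<And>t. \<phi> t \<le> (1::real)"
      "\<And>t. t \<in> {0..T} \<Longrightarrow> (\<And>k. norm (c t k) \<le> 2 * sqrt F0) \<Longrightarrow> \<phi> t = 1" by blast
    have cont: "continuous_on S (\<lambda>t. energy N s (c t))" if "S \<subseteq> {0..T}" for S s
    proof (rule energy_continuous)
      show "continuous_on S (\<lambda>t. c t k)" if "k \<in> freqs N" for k
        using c(3)[OF _ that] \<open>S \<subseteq> {0..T}\<close>
        by (meson continuous_on_subset continuous_on_vector_derivative)
    qed
    have der: "\<exists>D. ((\<lambda>t. energy N s (c t)) has_real_derivative D) (at t)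
      \<and> D \<le> growth s * sqrt (energy N 2 (c t)) * energy N s (c t)" if "0 < t" "t < T" for t s
    proof (rule energy_derivative[OF c(2)])
      show "((\<lambda>t. c t k) has_vector_derivative (\<phi> t *\<^sub>R adv (vel q (c t)) (c t) k)) (at t)" if "k \<in> freqs N" for k
        using c(3)[of t k] that \<open>0 < t\<close> \<open>t < T\<close> at_within_Icc_at[of 0 t T] by simp
    qed (use c in auto)
    have ini: "energy N s (c 0) \<le> (C s)\<^sup>2 * jsum" for s
    proof (rule energy_le_decay)
      show "norm (c 0 k) \<le> C s / jb k ^ Suc s" for k
      proof (cases "k \<in> freqs N")
        case False
        have "0 \<le> C s / jb k ^ Suc s" using C[of k s] norm_ge_zero order_trans by blast
        then show ?thesis using False by (simp add: c(1))
      qed (use C[of k s] in \<open>simp add: c(1)\<close>)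
    qed
    have E2: "energy N 2 (c t) \<le> 4 * F0" if t: "t \<in> {0..T}" for t
    proof -
      have "energy N 2 (c t) + 1 \<le> 4 * F0"
      proof (rule riccati_bound[where K = "growth 2" and F = "\<lambda>t. energy N 2 (c t) + 1"])
        show "continuous_on {0..t} (\<lambda>t. energy N 2 (c t) + 1)"
          using t by (intro continuous_intros cont) auto
        show "0 < energy N 2 (c s) + 1" for s using energy_nonneg[of N 2 "c s"] by simp
        show "\<exists>D. ((\<lambda>t. energy N 2 (c t) + 1) has_real_derivative D) (at s)
             \<and> D \<le> growth 2 * ((energy N 2 (c s) + 1) * sqrt (energy N 2 (c s) + 1))"
          if s: "0 < s" "s < t" for s
        proof -
          obtain D where D: "((\<lambda>t. energy N 2 (c t)) has_real_derivative D) (at s)"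
            "D \<le> growth 2 * sqrt (energy N 2 (c s)) * energy N 2 (c s)"
            using der[of s 2] s t by auto
          have "growth 2 * sqrt (energy N 2 (c s)) * energy N 2 (c s)
            \<le> growth 2 * sqrt (energy N 2 (c s) + 1) * (energy N 2 (c s) + 1)"
            using growth_nonneg[of 2] energy_nonneg[of N 2 "c s"] by (intro mult_mono mult_left_mono) auto
          with D(2) have "D \<le> growth 2 * ((energy N 2 (c s) + 1) * sqrt (energy N 2 (c s) + 1))"
            by (simp add: mult_ac)
          moreover have "((\<lambda>t. energy N 2 (c t) + 1) has_real_derivative D) (at s)"
            using DERIV_add[OF D(1) DERIV_const[of 1]] by simp
          ultimately show ?thesis by blast
        qed
        show "energy N 2 (c 0) + 1 \<le> F0" using ini[of 2] by (simp add: F0_def)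
      qed (use t small growth_nonneg in auto)
      then show ?thesis by simp
    qed
    have sE2: "sqrt (energy N 2 (c t)) \<le> 2 * sqrt F0" if "t \<in> {0..T}" for t
      using real_sqrt_le_mono[OF E2[OF that]] by (simp add: real_sqrt_mult)
    have \<phi>1: "\<phi> t = 1" if t: "t \<in> {0..T}" for t
    proof (rule c(6)[OF t])
      show "norm (c t k) \<le> 2 * sqrt F0" for k
      proof (cases "k \<in> freqs N")
        case True
        have "norm (c t k) \<le> sqrt (energy N 2 (c t)) / jb k ^ 2" by (rule norm_le_energy[OF True])
        also have "\<dots> \<le> sqrt (energy N 2 (c t)) / 1"
          using energy_nonneg by (intro divide_left_mono) auto
        finally show ?thesis using sE2[OF t] by simp
      qed (use F0 c(2) in auto)
    qed
    have Es: "energy N s (c t) \<le> (C s)\<^sup>2 * jsum * exp (G s * T)" if t: "t \<in> {0..T}" for s t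
    proof -
      have "energy N s (c t) \<le> (energy N s (c 0) + 0 * t) * exp (G s * t)"
      proof (rule gronwall)
        show "continuous_on {0..t} (\<lambda>t. energy N s (c t))" using t by (intro cont) auto
        show "\<exists>D. ((\<lambda>t. energy N s (c t)) has_real_derivative D) (at r) \<and> D \<le> G s * energy N s (c r) + 0"
          if r: "0 < r" "r < t" for r
        proof -
          obtain D where D: "((\<lambda>t. energy N s (c t)) has_real_derivative D) (at r)"
            "D \<le> growth s * sqrt (energy N 2 (c r)) * energy N s (c r)"
            using der[of r s] r t by auto
          have "growth s * sqrt (energy N 2 (c r)) * energy N s (c r) \<le> G s * energy N s (c r)"
            unfolding G_def using r t growth_nonneg energy_nonneg
            by (intro mult_right_mono mult_left_mono sE2) auto
          then show ?thesis using D by auto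
        qed
      qed (use t G0 in auto)
      also have "\<dots> \<le> ((C s)\<^sup>2 * jsum) * exp (G s * T)"
        using t ini[of s] G0[of s] jsum_ge_1 by (intro mult_mono) (auto intro: mult_left_mono)
      finally show ?thesis by simp
    qed
    have "norm (c t k) \<le> M s / jb k ^ s" if t: "t \<in> {0..T}" for t k s
    proof (cases "k \<in> freqs N")
      case True
      have "norm (c t k) \<le> sqrt (energy N s (c t)) / jb k ^ s" by (rule norm_le_energy[OF True])
      also have "\<dots> \<le> M s / jb k ^ s"
        unfolding M_def by (intro divide_right_mono real_sqrt_le_mono Es t) auto
      finally show ?thesis .
    qed (use c(2) M0 in auto)
    then show ?thesis
      using c(1,2,3) \<phi>1 by (intro exI[of _ c] conjI) auto
  qed
  then obtain c where "\<And>N. (\<forall>k. c N 0 k = (if k \<in> freqs N then c0 k else 0)) \<and> (\<forall>t k. k \<notin> freqs N \<longrightarrow> c N t k = 0) \<and>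
     (\<forall>t\<in>{0..T}. \<forall>k\<in>freqs N. ((\<lambda>t. c N t k) has_vector_derivative adv (vel q (c N t)) (c N t) k) (at t within {0..T})) \<and>
     (\<forall>t\<in>{0..T}. \<forall>k s. norm (c N t k) \<le> M s / jb k ^ s)"
    by metis
  with that[of T c M] T show ?thesis by blast
qed

end

section \<open>The limit and uniqueness on the Fourier side\<close>

lemma infsum_jb_bound:
  fixes f :: "int \<Rightarrow> complex"
  assumes "\<And>l. norm (f l) \<le> D / jb l ^ 2"
  shows "f summable_on UNIV" "norm (infsum f UNIV) \<le> D * jsum"
proof -
  have s: "(\<lambda>l. D / jb l ^ 2) summable_on UNIV"
    using summable_on_cmult_right[OF summable_on_jb, of D] by simp
  have a: "(\<lambda>l. norm (f l)) summable_on UNIV"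
    by (rule summable_on_comparison_test[OF s]) (use assms in auto)
  then show "f summable_on UNIV" by (rule abs_summable_summable)
  have "norm (infsum f UNIV) \<le> (\<Sum>\<^sub>\<infinity>l. norm (f l))" by (rule norm_infsum_bound[OF a])
  also have "\<dots> \<le> (\<Sum>\<^sub>\<infinity>l. D * (1 / jb l ^ 2))"
    using s assms by (intro infsum_mono a) auto
  also have "\<dots> = D * jsum" unfolding jsum_def by (rule infsum_cmult_right') 
  finally show "norm (infsum f UNIV) \<le> D * jsum" .
qed

lemma infsum_difference:
  fixes f g :: "'a \<Rightarrow> 'b::{topological_ab_group_add, t2_space}"
  assumes "f summable_on A" "g summable_on A"
  shows "infsum (\<lambda>x. f x - g x) A = infsum f A - infsum g A"
  using infsum_add[of f A "\<lambda>x. - g x"] assms by (simp add: infsum_uminus summable_on_uminus)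

lemma decay_const_nonneg: "norm (x::complex) \<le> C / jb k ^ s \<Longrightarrow> 0 \<le> C"
proof -
  assume "norm x \<le> C / jb k ^ s"
  then have "0 \<le> C / jb k ^ s" by (rule order_trans[OF norm_ge_zero])
  then have "0 * jb k ^ s \<le> C / jb k ^ s * jb k ^ s" by (intro mult_right_mono) auto
  then show ?thesis by simp
qed

lemma decay_weaken:
  assumes "norm (x::complex) \<le> C / jb k ^ s" "r \<le> s"
  shows "norm x \<le> C / jb k ^ r"
proof -
  have "C / jb k ^ s \<le> C / jb k ^ r"
    using decay_const_nonneg[OF assms(1)] assms(2) by (intro divide_left_mono jb_power_mono) auto
  with assms(1) show ?thesis by simp
qed

text \<open>One power of decay is exchanged for a factor \<open>1 / (N + 1)\<close>; the convergence
  rates of the truncation all originate here.\<close>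

lemma decay_notin:
  assumes "norm (x::complex) \<le> C / jb k ^ Suc s" "real N + 1 \<le> jb k"
  shows "norm x \<le> (C / (real N + 1)) / jb k ^ s"
proof -
  have C: "0 \<le> C" using decay_const_nonneg[OF assms(1)] .
  have "C / jb k ^ Suc s = (C / jb k) / jb k ^ s" by simp
  also have "\<dots> \<le> (C / (real N + 1)) / jb k ^ s"
    using assms(2) C by (intro divide_right_mono divide_left_mono) auto
  finally show ?thesis using assms(1) by simp
qed

lemma freq_decay:
  assumes "norm (z::complex) \<le> C / jb k ^ Suc s"
  shows "norm (\<i> * of_int k * z) \<le> C / jb k ^ s"
proof -
  have "norm (\<i> * of_int k * z) = \<bar>real_of_int k\<bar> * norm z" by (simp add: norm_mult)
  also have "\<dots> \<le> jb k * (C / jb k ^ Suc s)" by (intro mult_mono assms abs_le_jb) auto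
  finally show ?thesis by simp
qed

text \<open>Of the \<open>s + 3\<close> powers on \<open>b\<close>, \<open>s\<close> combine with
  those on \<open>v\<close> into the weight at \<open>k\<close> by \<open>jb_le_mult\<close>, one
  absorbs the factor \<open>l\<close>, and two remain for the summation over
  \<open>l\<close>.\<close>

lemma advection_term_decay:
  assumes v: "\<And>j. norm (v j) \<le> V / jb j ^ s" and b: "\<And>l. norm (b l) \<le> W / jb l ^ (s + 3)"
  shows "norm (v (k - l) * (\<i> * of_int l) * b l) \<le> (V * W / jb k ^ s) / jb l ^ 2"
proof -
  have V: "0 \<le> V" and W: "0 \<le> W" using decay_const_nonneg[OF v] decay_const_nonneg[OF b] by auto
  have "norm (v (k - l) * (\<i> * of_int l) * b l) = norm (v (k - l)) * \<bar>real_of_int l\<bar> * norm (b l)"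
    by (simp add: norm_mult)
  also have "\<dots> \<le> (V / jb (k - l) ^ s) * jb l * (W / jb l ^ (s + 3))"
    using V W by (intro mult_mono v b abs_le_jb) auto
  also have "\<dots> = V * W / ((jb (k - l) * jb l) ^ s) / jb l ^ 2"
    by (simp add: field_simps power_add power_mult_distrib power2_eq_square power3_eq_cube)
  also have "\<dots> \<le> V * W / jb k ^ s / jb l ^ 2"
    using V W by (intro divide_right_mono divide_left_mono power_mono jb_le_mult) auto
  finally show ?thesis .
qed

lemma advection_decay:
  assumes v: "\<And>j. norm (v j) \<le> V / jb j ^ s" and b: "\<And>l. norm (b l) \<le> W / jb l ^ (s + 3)"
  shows "(\<lambda>l. v (k - l) * (\<i> * of_int l) * b l) summable_on UNIV"
    and "norm (adv v b k) \<le> (V * W * jsum) / jb k ^ s"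
proof -
  note t = advection_term_decay[OF v b, of k]
  show "(\<lambda>l. v (k - l) * (\<i> * of_int l) * b l) summable_on UNIV"
    by (rule infsum_jb_bound(1)[OF t])
  show "norm (adv v b k) \<le> (V * W * jsum) / jb k ^ s"
    using infsum_jb_bound(2)[OF t] by (simp add: adv_def)
qed

text \<open>Puts the summation index on the velocity, for the case that \<open>b\<close> is merely
  bounded and the decay of \<open>v\<close> has to carry the sum.\<close>

lemma adv_reflect: "adv v b k = (\<Sum>\<^sub>\<infinity>j. v j * (\<i> * of_int (k - j)) * b (k - j))"
  unfolding adv_def
  by (rule infsum_reindex_bij_witness[of _ "\<lambda>l. k - l" "\<lambda>l. k - l"]) auto

lemma vel_decay:
  assumes q: "\<And>j. norm (q j) \<le> Q" and c: "\<And>k. norm (c k) \<le> C / jb k ^ s"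
  shows "norm (vel q c j) \<le> (Q * C) / jb j ^ s"
proof -
  have Q: "0 \<le> Q" using q[of 0] norm_ge_zero order_trans by blast
  have "norm (vel q c j) \<le> Q * ((norm (c j) + norm (c (- j))) / 2)" by (rule norm_vel_le[OF q])
  also have "\<dots> \<le> Q * (C / jb j ^ s)"
  proof (rule mult_left_mono[OF _ Q])
    have "norm (c (- j)) \<le> C / jb j ^ s" using c[of "- j"] by simp
    with c[of j] have "norm (c j) + norm (c (- j)) \<le> C / jb j ^ s + C / jb j ^ s" by (intro add_mono)
    then show "(norm (c j) + norm (c (- j))) / 2 \<le> C / jb j ^ s" by (simp add: mult.commute)
  qed
  finally show ?thesis by simp
qed

context multiplier begin

lemma adv_vel_diff:
  assumes x: "\<And>k. norm (x k) \<le> C / jb k ^ 3" and y: "\<And>k. norm (y k) \<le> C / jb k ^ 3"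
  shows "adv (vel q x) x k - adv (vel q y) y k = adv (vel q (\<lambda>k. x k - y k)) x k + adv (vel q y) (\<lambda>k. x k - y k) k"
proof -
  have vx: "norm (vel q z j) \<le> (Q * C) / jb j ^ 0" if "\<And>k. norm (z k) \<le> C / jb k ^ 3" for z j
    by (rule vel_decay[OF q_bound decay_weaken[OF that]]) simp
  have sm: "(\<lambda>l. vel q z (k - l) * (\<i> * of_int l) * w l) summable_on UNIV"
    if "\<And>k. norm (z k) \<le> C / jb k ^ 3" "\<And>k. norm (w k) \<le> C / jb k ^ 3" for z w
    by (rule advection_decay(1)[OF vx[OF that(1)], of w C]) (use that in auto)
  have "adv (vel q (\<lambda>k. x k - y k)) x k = adv (vel q x) x k - adv (vel q y) x k"
    unfolding adv_def infsum_difference[OF sm[OF x x] sm[OF y x], symmetric] vel_diff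
    by (intro infsum_cong) (simp add: algebra_simps)
  moreover have "adv (vel q y) (\<lambda>k. x k - y k) k = adv (vel q y) x k - adv (vel q y) y k"
    unfolding adv_def infsum_difference[OF sm[OF y x] sm[OF y y], symmetric]
    by (intro infsum_cong) (simp add: algebra_simps)
  ultimately show ?thesis by simp
qed

text \<open>\<open>e\<close> is the residual by which the difference misses the difference of the
  truncated right-hand sides. Its product with the difference is split into two squares: one adds
  the summand 1 to the exponential rate, the other, summed through \<open>jb k ^ 1\<close>, gives
  \<open>\<eta>\<^sup>2 * jsum\<close>. The order-zero energy is the one in which
  \<open>advection_difference\<close> closes.\<close>

lemma stability:
  assumes t: "0 \<le> \<tau>"
    and supp: "\<And>t k. k \<notin> freqs N \<Longrightarrow> x t k = 0" "\<And>t k. k \<notin> freqs N \<Longrightarrow> y t k = 0"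
    and cont: "\<And>k. k \<in> freqs N \<Longrightarrow> continuous_on {0..\<tau>} (\<lambda>t. x t k - y t k)"
    and der: "\<And>t k. 0 < t \<Longrightarrow> t < \<tau> \<Longrightarrow> k \<in> freqs N \<Longrightarrow> ((\<lambda>t. x t k - y t k) has_vector_derivative
        (adv (vel q (x t)) (x t) k - adv (vel q (y t)) (y t) k + e t k)) (at t)"
    and e: "\<And>t k. 0 < t \<Longrightarrow> t < \<tau> \<Longrightarrow> k \<in> freqs N \<Longrightarrow> norm (e t k) \<le> \<eta> / jb k ^ 1"
    and A: "\<And>t. 0 < t \<Longrightarrow> t < \<tau> \<Longrightarrow> sums_le (\<lambda>j. jb j * norm (x t j)) A"
           "\<And>t. 0 < t \<Longrightarrow> t < \<tau> \<Longrightarrow> sums_le (\<lambda>j. jb j * norm (y t j)) A" "0 \<le> A"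
  shows "energy N 0 (\<lambda>k. x \<tau> k - y \<tau> k)
    \<le> (energy N 0 (\<lambda>k. x 0 k - y 0 k) + \<eta>\<^sup>2 * jsum * \<tau>) * exp (((Q + (1 + Q\<^sup>2)) * A + 1) * \<tau>)"
proof (rule gronwall[OF t, of "\<lambda>t. energy N 0 (\<lambda>k. x t k - y t k)"])
  show "continuous_on {0..\<tau>} (\<lambda>t. energy N 0 (\<lambda>k. x t k - y t k))"
    by (rule energy_continuous[OF cont])
  show "0 \<le> (Q + (1 + Q\<^sup>2)) * A + 1" using Q_nonneg A(3) by simp
  show "0 \<le> \<eta>\<^sup>2 * jsum" using jsum_ge_1 by simp
  fix t assume t: "0 < t" "t < \<tau>"
  define d where "d k = x t k - y t k" for k
  define a where "a k = adv (vel q (x t)) (x t) k - adv (vel q (y t)) (y t) k" for k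
  let ?D = "\<Sum>k\<in>freqs N. (jb k ^ 0)\<^sup>2 * (2 * Re (cnj (d k) * (a k + e t k)))"
  have "((\<lambda>t. energy N 0 (\<lambda>k. x t k - y t k)) has_real_derivative ?D) (at t)"
    unfolding energy_def power_mult_distrib d_def a_def
    by (intro DERIV_sum DERIV_cmult has_real_derivative_norm_sq der t)
  moreover have "?D \<le> ((Q + (1 + Q\<^sup>2)) * A + 1) * energy N 0 d + \<eta>\<^sup>2 * jsum"
  proof -
    have "?D = 2 * Re (\<Sum>k\<in>freqs N. cnj (d k) * a k) + (\<Sum>k\<in>freqs N. 2 * Re (cnj (d k) * e t k))"
      unfolding Re_sum sum_distrib_left sum.distrib[symmetric] by (intro sum.cong) (auto simp: algebra_simps)
    also have "\<dots> \<le> 2 * ((Q / 2 + (1 + Q\<^sup>2) / 2) * A * (\<Sum>k\<in>freqs N. (norm (d k))\<^sup>2))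
        + (\<Sum>k\<in>freqs N. (norm (d k))\<^sup>2 + \<eta>\<^sup>2 * (1 / jb k ^ 2))"
    proof (intro add_mono mult_left_mono sum_mono)
      show "Re (\<Sum>k\<in>freqs N. cnj (d k) * a k) \<le> (Q / 2 + (1 + Q\<^sup>2) / 2) * A * (\<Sum>k\<in>freqs N. (norm (d k))\<^sup>2)"
        unfolding d_def a_def using supp A t by (intro advection_difference q_cnj q_bound) auto
      fix k assume k: "k \<in> freqs N"
      have "2 * Re (cnj (d k) * e t k) \<le> 2 * (norm (d k) * norm (e t k))"
        using complex_Re_le_cmod[of "cnj (d k) * e t k"] by (simp add: norm_mult)
      also have "\<dots> \<le> (norm (d k))\<^sup>2 + (norm (e t k))\<^sup>2"
        using zero_le_power2[of "norm (d k) - norm (e t k)"] by (simp add: power2_eq_square algebra_simps)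
      also have "(norm (e t k))\<^sup>2 \<le> (\<eta> / jb k)\<^sup>2"
        using e[OF t k] by (intro power_mono) auto
      finally show "2 * Re (cnj (d k) * e t k) \<le> (norm (d k))\<^sup>2 + \<eta>\<^sup>2 * (1 / jb k ^ 2)"
        by (simp add: power_divide)
    qed simp
    also have "\<dots> = ((Q + (1 + Q\<^sup>2)) * A + 1) * energy N 0 d + \<eta>\<^sup>2 * (\<Sum>k\<in>freqs N. 1 / jb k ^ 2)"
      unfolding sum.distrib sum_distrib_left[symmetric] energy_def by (simp add: algebra_simps)
    also have "\<dots> \<le> ((Q + (1 + Q\<^sup>2)) * A + 1) * energy N 0 d + \<eta>\<^sup>2 * jsum"
      by (intro add_left_mono mult_left_mono sum_jb_le_jsum) auto
    finally show ?thesis .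
  qed
  ultimately show "\<exists>D. ((\<lambda>t. energy N 0 (\<lambda>k. x t k - y t k)) has_real_derivative D) (at t) \<and>
      D \<le> ((Q + (1 + Q\<^sup>2)) * A + 1) * energy N 0 (\<lambda>k. x t k - y t k) + \<eta>\<^sup>2 * jsum"
    unfolding d_def by blast
qed

lemma sums_le_of_decay:
  fixes c :: "int \<Rightarrow> complex"
  assumes "\<And>k. norm (c k) \<le> C / jb k ^ 3"
  shows "sums_le (\<lambda>j. jb j * norm (c j)) (C * jsum)"
proof (rule sums_le_decay)
  show "jb k * norm (c k) \<le> C / jb k ^ 2" for k
  proof -
    have "jb k * norm (c k) \<le> jb k * (C / jb k ^ 3)" by (intro mult_left_mono assms) auto
    then show ?thesis by (simp add: power3_eq_cube power2_eq_square)
  qed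
qed (rule decay_const_nonneg[OF assms])

text \<open>The skew estimate is available for finite support only, so both solutions are cut off at
  \<open>N\<close>. The cut-off families solve the truncated system up to a residual of size
  \<open>1 / (N + 1)\<close> and start from equal values; \<open>stability\<close> then bounds their
  difference at a fixed frequency by a multiple of \<open>1 / (N + 1)\<close>.\<close>

theorem fourier_solution_unique:
  assumes x: "\<And>t k. t \<in> {0..\<tau>} \<Longrightarrow> norm (x t k) \<le> C / jb k ^ 6"
      "\<And>k. continuous_on {0..\<tau>} (\<lambda>t. x t k)"
      "\<And>t k. 0 < t \<Longrightarrow> t < \<tau> \<Longrightarrow> ((\<lambda>t. x t k) has_vector_derivative adv (vel q (x t)) (x t) k) (at t)"
    and y: "\<And>t k. t \<in> {0..\<tau>} \<Longrightarrow> norm (y t k) \<le> C / jb k ^ 6"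
      "\<And>k. continuous_on {0..\<tau>} (\<lambda>t. y t k)"
      "\<And>t k. 0 < t \<Longrightarrow> t < \<tau> \<Longrightarrow> ((\<lambda>t. y t k) has_vector_derivative adv (vel q (y t)) (y t) k) (at t)"
    and ini: "\<And>k. x 0 k = y 0 k" and \<tau>: "0 \<le> \<tau>"
  shows "x \<tau> k = y \<tau> k"
proof -
  have C: "0 \<le> C" by (rule decay_const_nonneg[OF x(1)[of 0 0]]) (use \<tau> in auto)
  define X where "X N t k = (if k \<in> freqs N then x t k else 0)" for N t k
  define Y where "Y N t k = (if k \<in> freqs N then y t k else 0)" for N t k
  \<comment> \<open>The factor 2 counts the two terms of \<open>adv_vel_diff\<close>, each of which
    contains one tail of \<open>z\<close>.\<close>
  define P where "P = 2 * (Q * C * C * jsum)"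
  have trunc: "norm (adv (vel q z) z k - adv (vel q (\<lambda>k. if k \<in> freqs N then z k else 0)) (\<lambda>k. if k \<in> freqs N then z k else 0) k)
      \<le> (P / (real N + 1)) / jb k ^ 1"
    if z: "\<And>k. norm (z k) \<le> C / jb k ^ 6" for z N k
  proof -
    define w where "w k = (if k \<in> freqs N then z k else 0)" for k
    have w: "norm (w k) \<le> C / jb k ^ 6" for k using z[of k] C by (simp add: w_def)
    \<comment> \<open>Outside \<open>freqs N\<close> one power becomes \<open>1 / (N + 1)\<close>;
      the four left over are the \<open>1 + 3\<close> that \<open>advection_decay\<close> requires
      for a result of order one.\<close>
    have d: "norm (z k - w k) \<le> (C / (real N + 1)) / jb k ^ 4" for k
    proof (cases "k \<in> freqs N")
      case False
      have "norm (z k) \<le> C / jb k ^ Suc 4" by (rule decay_weaken[OF z]) simp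
      from decay_notin[OF this jb_ge_notin_freqs[OF False]] show ?thesis using False by (simp add: w_def)
    qed (use C in \<open>simp add: w_def\<close>)
    have "adv (vel q z) z k - adv (vel q w) w k = adv (vel q (\<lambda>k. z k - w k)) z k + adv (vel q w) (\<lambda>k. z k - w k) k"
      by (rule adv_vel_diff[OF decay_weaken[OF z] decay_weaken[OF w]]) auto
    moreover have "norm (adv (vel q (\<lambda>k. z k - w k)) z k) \<le> (Q * (C / (real N + 1)) * C * jsum) / jb k ^ 1"
    proof (rule advection_decay(2))
      show "norm (vel q (\<lambda>k. z k - w k) j) \<le> Q * (C / (real N + 1)) / jb j ^ 1" for j
        by (rule vel_decay[OF q_bound decay_weaken[OF d]]) simp
      show "norm (z l) \<le> C / jb l ^ (1 + 3)" for l by (rule decay_weaken[OF z]) simp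
    qed
    moreover have "norm (adv (vel q w) (\<lambda>k. z k - w k) k) \<le> (Q * C * (C / (real N + 1)) * jsum) / jb k ^ 1"
    proof (rule advection_decay(2))
      show "norm (vel q w j) \<le> Q * C / jb j ^ 1" for j
        by (rule vel_decay[OF q_bound decay_weaken[OF w]]) simp
      show "norm (z l - w l) \<le> C / (real N + 1) / jb l ^ (1 + 3)" for l using d[of l] by simp
    qed
    ultimately have "norm (adv (vel q z) z k - adv (vel q w) w k) \<le>
       (Q * (C / (real N + 1)) * C * jsum) / jb k ^ 1 + (Q * C * (C / (real N + 1)) * jsum) / jb k ^ 1"
      by (metis norm_triangle_mono)
    also have "\<dots> = (P / (real N + 1)) / jb k ^ 1" by (simp add: P_def field_simps)
    finally show ?thesis by (simp add: w_def[abs_def])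
  qed
  define A where "A = C * jsum"
  define Z where "Z = (2 * P)\<^sup>2 * jsum * \<tau> * exp (((Q + (1 + Q\<^sup>2)) * A + 1) * \<tau>)"
  have main: "energy N 0 (\<lambda>k. X N \<tau> k - Y N \<tau> k) \<le> Z / (real N + 1)\<^sup>2" for N
  proof -
    define e where "e t k = (adv (vel q (x t)) (x t) k - adv (vel q (X N t)) (X N t) k)
       - (adv (vel q (y t)) (y t) k - adv (vel q (Y N t)) (Y N t) k)" for t k
    have "energy N 0 (\<lambda>k. X N \<tau> k - Y N \<tau> k) \<le> (energy N 0 (\<lambda>k. X N 0 k - Y N 0 k) + (2 * P / (real N + 1))\<^sup>2 * jsum * \<tau>)
       * exp (((Q + (1 + Q\<^sup>2)) * A + 1) * \<tau>)"
    proof (rule stability[OF \<tau>, where e = e])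
      show "continuous_on {0..\<tau>} (\<lambda>t. X N t k - Y N t k)" if "k \<in> freqs N" for k
        using that x(2) y(2) by (auto simp: X_def Y_def intro!: continuous_intros)
      show "((\<lambda>t. X N t k - Y N t k) has_vector_derivative
        (adv (vel q (X N t)) (X N t) k - adv (vel q (Y N t)) (Y N t) k + e t k)) (at t)"
        if "0 < t" "t < \<tau>" "k \<in> freqs N" for t k
        using has_vector_derivative_diff[OF x(3)[of t k] y(3)[of t k]] that by (simp add: X_def Y_def e_def)
      show "norm (e t k) \<le> 2 * P / (real N + 1) / jb k ^ 1" if t: "0 < t" "t < \<tau>" for t k
      proof -
        have "norm (e t k) \<le> (P / (real N + 1)) / jb k ^ 1 + (P / (real N + 1)) / jb k ^ 1"
          unfolding e_def X_def[abs_def] Y_def[abs_def] using t x(1) y(1)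
          by (intro order_trans[OF norm_triangle_ineq4 add_mono] trunc) auto
        then show ?thesis by (simp add: field_simps)
      qed
      have X6: "norm (X N t k) \<le> C / jb k ^ 3" "norm (Y N t k) \<le> C / jb k ^ 3" if "0 < t" "t < \<tau>" for t k
        using decay_weaken[OF x(1)[of t k], of 3] decay_weaken[OF y(1)[of t k], of 3] that C
        by (auto simp: X_def Y_def)
      show "sums_le (\<lambda>j. jb j * norm (X N t j)) A" "sums_le (\<lambda>j. jb j * norm (Y N t j)) A" if "0 < t" "t < \<tau>" for t
        unfolding A_def using X6[OF that] by (auto intro: sums_le_of_decay)
      show "0 \<le> A" using C jsum_ge_1 by (simp add: A_def)
    qed (auto simp: X_def Y_def)
    also have "energy N 0 (\<lambda>k. X N 0 k - Y N 0 k) = 0" by (simp add: energy_def X_def Y_def ini)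
    finally show ?thesis by (simp add: Z_def power_divide)
  qed
  have "norm (x \<tau> k - y \<tau> k) \<le> sqrt Z / (real N + 1)" if "nat \<bar>k\<bar> \<le> N" for N
  proof -
    have k: "k \<in> freqs N" using that by (auto simp: freqs_def)
    have "norm (X N \<tau> k - Y N \<tau> k) \<le> sqrt (energy N 0 (\<lambda>k. X N \<tau> k - Y N \<tau> k)) / jb k ^ 0"
      by (rule norm_le_energy[OF k, of "\<lambda>k. X N \<tau> k - Y N \<tau> k" 0])
    also have "\<dots> \<le> sqrt (Z / (real N + 1)\<^sup>2)" using main[of N] by simp
    finally show ?thesis using k by (simp add: X_def Y_def real_sqrt_divide)
  qed
  moreover have "(\<lambda>N. sqrt Z / (real N + 1)) \<longlonglongrightarrow> 0" by real_asymp
  ultimately have "norm (x \<tau> k - y \<tau> k) \<le> 0"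
    by (intro tendsto_lowerbound[of _ 0 sequentially]) (auto simp: eventually_sequentially)
  then show ?thesis by simp
qed

text \<open>\<open>stability\<close> in the larger of two truncated systems makes the coefficients
  Cauchy, uniformly in time. At each frequency the right-hand sides then converge uniformly as well,
  which justifies differentiating the limit. The decay bounds are uniform in \<open>N\<close> and
  pass to the limit.\<close>

theorem fourier_solution_exists:
  assumes c0: "rapid c0"
  obtains T c where "0 < T" "\<And>k. c 0 k = c0 k"
    "\<And>s. \<exists>C. \<forall>t\<in>{0..T}. \<forall>k. norm (c t k) \<le> C / jb k ^ s"
    "\<And>t k. t \<in> {0..T} \<Longrightarrow> ((\<lambda>t. c t k) has_vector_derivative adv (vel q (c t)) (c t) k) (at t within {0..T})"
proof -
  obtain T M c where T: "0 < T"
    and ini: "\<And>N k. c N 0 k = (if k \<in> freqs N then c0 k else 0)"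
    and supp: "\<And>N t k. k \<notin> freqs N \<Longrightarrow> c N t k = 0"
    and der: "\<And>N t k. t \<in> {0..T} \<Longrightarrow> k \<in> freqs N \<Longrightarrow>
       ((\<lambda>t. c N t k) has_vector_derivative adv (vel q (c N t)) (c N t) k) (at t within {0..T})"
    and M: "\<And>N t k s. t \<in> {0..T} \<Longrightarrow> norm (c N t k) \<le> M s / jb k ^ s"
    by (rule galerkin[OF c0]) (rule that)
  have M0: "0 \<le> M s" for s by (rule decay_const_nonneg[OF M[of 0 _ 0]]) (use T in auto)
  define der' where "der' N t k = (if k \<in> freqs N then adv (vel q (c N t)) (c N t) k else 0)" for N t k
  have der': "((\<lambda>t. c N t k) has_vector_derivative der' N t k) (at t within {0..T})" if "t \<in> {0..T}" for N t k
    using der[OF that, of k N] supp by (cases "k \<in> freqs N") (auto simp: der'_def)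
  define P where "P = Q * M 2 * M 5 * jsum"
  have P: "0 \<le> P" using Q_nonneg M0 jsum_ge_1 by (simp add: P_def)
  have advP: "norm (adv (vel q (c N t)) (c N t) k) \<le> P / jb k ^ 2" if t: "t \<in> {0..T}" for N t k
    unfolding P_def
    by (rule advection_decay(2)[OF vel_decay[OF q_bound M[OF t]]]) (use M[OF t, of _ _ 5] in simp)
  define A where "A = M 3 * jsum"
  have A0: "0 \<le> A" using M0 jsum_ge_1 by (simp add: A_def)
  define Z where "Z = ((M 2)\<^sup>2 * jsum + P\<^sup>2 * jsum * T) * exp (((Q + (1 + Q\<^sup>2)) * A + 1) * T)"
  have Z0: "0 \<le> Z" using T jsum_ge_1 by (simp add: Z_def)
  have main: "norm (c N t k - c N' t k) \<le> sqrt Z / (real N + 1)" if N: "N \<le> N'" and t: "t \<in> {0..T}" for N N' t k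
  proof (cases "k \<in> freqs N'")
    case False
    then have "k \<notin> freqs N" using N by (auto simp: freqs_def)
    then show ?thesis using False supp Z0 by simp
  next
    case True
    have sub: "k \<in> freqs N'" if "k \<in> freqs N" for k using that N by (auto simp: freqs_def)
    \<comment> \<open>\<open>c N\<close> solves the system with \<open>N'\<close> frequencies except
      between the two cutoffs. There it stays 0, and the advection term it ignores is the
      residual.\<close>
    define e where "e t k = (if k \<in> freqs N then 0 else - adv (vel q (c N t)) (c N t) k)" for t k
    have "energy N' 0 (\<lambda>k. c N t k - c N' t k) \<le> (energy N' 0 (\<lambda>k. c N 0 k - c N' 0 k) + (P / (real N + 1))\<^sup>2 * jsum * t)
       * exp (((Q + (1 + Q\<^sup>2)) * A + 1) * t)"
    proof (rule stability[where e = e])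
      show "0 \<le> t" using t by simp
      show "c N s k = 0" if "k \<notin> freqs N'" for s k using that supp[of k N s] sub[of k] by blast
      show "continuous_on {0..t} (\<lambda>t. c N t k - c N' t k)" for k
      proof -
        have "continuous_on {0..T} (\<lambda>t. c N t k)" for N by (rule continuous_on_vector_derivative[OF der'])
        then have "continuous_on {0..t} (\<lambda>t. c N t k)" for N
          by (rule continuous_on_subset) (use t in auto)
        then show ?thesis by (intro continuous_intros)
      qed
      show "((\<lambda>t. c N t k - c N' t k) has_vector_derivative
        (adv (vel q (c N s)) (c N s) k - adv (vel q (c N' s)) (c N' s) k + e s k)) (at s)"
        if s: "0 < s" "s < t" "k \<in> freqs N'" for s k
      proof -
        have "at s within {0..T} = at s" using s t by (intro at_within_Icc_at) auto
        moreover have "s \<in> {0..T}" using s t by auto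
        ultimately have "((\<lambda>t. c N t k - c N' t k) has_vector_derivative (der' N s k - der' N' s k)) (at s)"
          using has_vector_derivative_diff[OF der'[of s N k] der'[of s N' k]] by simp
        then show ?thesis using s(3) by (simp add: der'_def e_def split: if_splits)
      qed
      show "norm (e s k) \<le> P / (real N + 1) / jb k ^ 1" if s: "0 < s" "s < t" for s k
      proof (cases "k \<in> freqs N")
        case False
        have "norm (adv (vel q (c N s)) (c N s) k) \<le> P / jb k ^ Suc 1"
          using advP[of s N k] s t by (simp add: numeral_2_eq_2)
        from decay_notin[OF this jb_ge_notin_freqs[OF False]] show ?thesis using False by (simp add: e_def)
      qed (use P in \<open>simp add: e_def\<close>)
      show "sums_le (\<lambda>j. jb j * norm (c N s j)) A" "sums_le (\<lambda>j. jb j * norm (c N' s j)) A" if "0 < s" "s < t" for s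
        unfolding A_def using that t by (auto intro!: sums_le_of_decay M)
    qed (use supp A0 in auto)
    also have "\<dots> \<le> ((M 2)\<^sup>2 * jsum / (real N + 1)\<^sup>2 + (P / (real N + 1))\<^sup>2 * jsum * T) * exp (((Q + (1 + Q\<^sup>2)) * A + 1) * T)"
    proof (intro mult_mono add_mono mult_left_mono)
      have "energy N' 0 (\<lambda>k. c N 0 k - c N' 0 k) \<le> (M 2 / (real N + 1))\<^sup>2 * jsum"
      proof (rule energy_le_decay)
        fix k
        show "norm (c N 0 k - c N' 0 k) \<le> (M 2 / (real N + 1)) / jb k ^ Suc 0"
        proof (cases "k \<in> freqs N")
          case True
          then show ?thesis using sub[OF True] M0[of 2] by (simp add: ini)
        next
          case False
          have "norm (c N' 0 k) \<le> M 2 / jb k ^ Suc (Suc 0)" using M[of 0 N' k 2] T by (simp add: numeral_2_eq_2)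
          from decay_notin[OF this jb_ge_notin_freqs[OF False]] show ?thesis using False by (simp add: supp)
        qed
      qed
      then show "energy N' 0 (\<lambda>k. c N 0 k - c N' 0 k) \<le> (M 2)\<^sup>2 * jsum / (real N + 1)\<^sup>2" by (simp add: power_divide)
      show "exp (((Q + (1 + Q\<^sup>2)) * A + 1) * t) \<le> exp (((Q + (1 + Q\<^sup>2)) * A + 1) * T)"
        using t A0 Q_nonneg by (simp add: mult_left_mono)
      show "0 \<le> (M 2)\<^sup>2 * jsum / (real N + 1)\<^sup>2 + (P / (real N + 1))\<^sup>2 * jsum * T" using T jsum_ge_1 by simp
    qed (use t jsum_ge_1 in auto)
    also have "\<dots> = Z / (real N + 1)\<^sup>2" by (simp add: Z_def power_divide add_divide_distrib algebra_simps)
    finally have "sqrt (energy N' 0 (\<lambda>k. c N t k - c N' t k)) \<le> sqrt (Z / (real N + 1)\<^sup>2)" by simp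
    with norm_le_energy[OF True, of "\<lambda>k. c N t k - c N' t k" 0] show ?thesis
      by (simp add: real_sqrt_divide)
  qed
  define S where "S = sqrt Z"
  have S0: "0 \<le> S" by (simp add: S_def Z0)
  have S_lim: "(\<lambda>N. K * (S / (real N + 1))) \<longlonglongrightarrow> 0" for K by real_asymp
  have conv: "convergent (\<lambda>N. c N t k)" if t: "t \<in> {0..T}" for t k
  proof (rule Cauchy_convergent, rule metric_CauchyI)
    fix \<epsilon> :: real assume \<epsilon>: "0 < \<epsilon>"
    have "\<forall>\<^sub>F N in sequentially. 2 * (S / (real N + 1)) < \<epsilon>"
      using order_tendstoD(2)[OF S_lim \<epsilon>] .
    then obtain N0 where N0: "2 * (S / (real N0 + 1)) < \<epsilon>" by (auto simp: eventually_sequentially)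
    show "\<exists>N0. \<forall>m\<ge>N0. \<forall>n\<ge>N0. dist (c m t k) (c n t k) < \<epsilon>"
    proof (intro exI allI impI)
      fix m n assume mn: "N0 \<le> m" "N0 \<le> n"
      have "dist (c m t k) (c n t k) \<le> dist (c N0 t k) (c m t k) + dist (c N0 t k) (c n t k)"
        by (metis dist_commute dist_triangle)
      also have "\<dots> \<le> S / (real N0 + 1) + S / (real N0 + 1)"
        using main[OF mn(1) t, of k] main[OF mn(2) t, of k] by (intro add_mono) (auto simp: dist_norm S_def)
      finally show "dist (c m t k) (c n t k) < \<epsilon>" using N0 by simp
    qed
  qed
  define u where "u t k = lim (\<lambda>N. c N t k)" for t k
  have u: "(\<lambda>N. c N t k) \<longlonglongrightarrow> u t k" if "t \<in> {0..T}" for t k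
    using conv[OF that, of k] unfolding u_def by (simp add: convergent_LIMSEQ_iff)
  have uM: "norm (u t k) \<le> M s / jb k ^ s" if t: "t \<in> {0..T}" for t k s
    by (rule tendsto_upperbound[OF tendsto_norm[OF u[OF t]]]) (use M[OF t] in auto)
  have rate: "norm (c N t k - u t k) \<le> S / (real N + 1)" if t: "t \<in> {0..T}" for t k N
  proof (rule tendsto_upperbound[OF tendsto_norm[OF tendsto_diff[OF tendsto_const u[OF t]]]])
    show "\<forall>\<^sub>F N' in sequentially. norm (c N t k - c N' t k) \<le> S / (real N + 1)"
      using main[OF _ t] by (auto simp: S_def eventually_sequentially)
  qed simp
  \<comment> \<open>The difference of the coefficients is small but not known to decay, so the
    derivative cannot be charged to it. The second summand charges it to the velocity, through
    \<open>adv_reflect\<close>, at the price of a factor \<open>jb k\<close>; this is harmless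
    because convergence is wanted at each fixed \<open>k\<close>.\<close>
  define K where "K k = Q * M 3 * jsum + jb k * (Q * M 3) * jsum" for k
  have adv_conv: "norm (adv (vel q (c N t)) (c N t) k - adv (vel q (u t)) (u t) k) \<le> K k * (S / (real N + 1))"
    if t: "t \<in> {0..T}" for N t k
  proof -
    define \<delta> where "\<delta> = S / (real N + 1)"
    define d where "d k = c N t k - u t k" for k
    have d: "norm (d k) \<le> \<delta> / jb k ^ 0" for k using rate[OF t] by (simp add: d_def \<delta>_def)
    have "adv (vel q (c N t)) (c N t) k - adv (vel q (u t)) (u t) k = adv (vel q d) (c N t) k + adv (vel q (u t)) d k"
      unfolding d_def by (rule adv_vel_diff[OF M[OF t] uM[OF t]])
    moreover have "norm (adv (vel q d) (c N t) k) \<le> (Q * \<delta> * M 3 * jsum) / jb k ^ 0"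
      by (rule advection_decay(2)[OF vel_decay[OF q_bound d]]) (use M[OF t, of _ _ 3] in simp)
    moreover have "norm (adv (vel q (u t)) d k) \<le> (jb k * (Q * M 3) * \<delta>) * jsum"
      unfolding adv_reflect
    proof (rule infsum_jb_bound(2))
      fix j
      have "norm (vel q (u t) j) \<le> (Q * M 3) / jb j ^ 3" by (rule vel_decay[OF q_bound uM[OF t]])
      moreover have "\<bar>real_of_int (k - j)\<bar> \<le> jb k * jb j"
        using abs_le_jb[of "k - j"] jb_le_mult[of "k - j" "- j"] by simp
      ultimately have "norm (vel q (u t) j) * \<bar>real_of_int (k - j)\<bar> * norm (d (k - j)) \<le> (Q * M 3) / jb j ^ 3 * (jb k * jb j) * \<delta>"
        using d[of "k - j"] M0 Q_nonneg by (intro mult_mono) auto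
      also have "\<dots> = (jb k * (Q * M 3) * \<delta>) / jb j ^ 2"
        by (simp add: power3_eq_cube power2_eq_square)
      finally show "norm (vel q (u t) j * (\<i> * of_int (k - j)) * d (k - j)) \<le> (jb k * (Q * M 3) * \<delta>) / jb j ^ 2"
        unfolding norm_mult norm_of_int by simp
    qed
    ultimately have "norm (adv (vel q (c N t)) (c N t) k - adv (vel q (u t)) (u t) k)
       \<le> (Q * \<delta> * M 3 * jsum) / jb k ^ 0 + (jb k * (Q * M 3) * \<delta>) * jsum"
      by (metis norm_triangle_mono)
    then show ?thesis unfolding K_def \<delta>_def[symmetric] by (simp add: algebra_simps)
  qed
  show ?thesis
  proof (rule that[OF T, of u])
    show "u 0 k = c0 k" for k
    proof -
      have "(\<lambda>N. c N 0 k) \<longlonglongrightarrow> c0 k"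
        by (rule tendsto_eventually, unfold eventually_sequentially, rule exI[of _ "nat \<bar>k\<bar>"])
          (auto simp: ini freqs_def)
      then show ?thesis using LIMSEQ_unique u[of 0 k] T by auto
    qed
    show "\<exists>C. \<forall>t\<in>{0..T}. \<forall>k. norm (u t k) \<le> C / jb k ^ s" for s
      using uM by blast
    fix t k assume t: "t \<in> {0..T}"
    have "\<exists>g. \<forall>t\<in>{0..T}. (\<lambda>N. c N t k) \<longlonglongrightarrow> g t \<and>
       (g has_derivative (\<lambda>h. h *\<^sub>R adv (vel q (u t)) (u t) k)) (at t within {0..T})"
    proof (rule has_derivative_sequence[where f = "\<lambda>N t. c N t k" and f' = "\<lambda>N t h. h *\<^sub>R der' N t k" and ?x0.0 = t])
      show "((\<lambda>t. c N t k) has_derivative (\<lambda>h. h *\<^sub>R der' N t k)) (at t within {0..T})" if "t \<in> {0..T}" for N t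
        using der'[OF that] by (simp add: has_vector_derivative_def)
      fix \<epsilon> :: real assume \<epsilon>: "0 < \<epsilon>"
      have "\<forall>\<^sub>F N in sequentially. K k * (S / (real N + 1)) < \<epsilon>"
        by (rule order_tendstoD(2)[OF S_lim \<epsilon>])
      moreover have "\<forall>\<^sub>F N in sequentially. k \<in> freqs N"
        unfolding eventually_sequentially by (rule exI[of _ "nat \<bar>k\<bar>"]) (auto simp: freqs_def)
      ultimately show "\<forall>\<^sub>F N in sequentially. \<forall>t\<in>{0..T}. \<forall>h. norm (h *\<^sub>R der' N t k - h *\<^sub>R adv (vel q (u t)) (u t) k) \<le> \<epsilon> * norm h"
      proof eventually_elim
        case (elim N)
        show ?case
        proof (intro ballI allI)
          fix t h :: real assume t: "t \<in> {0..T}"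
          have "norm (der' N t k - adv (vel q (u t)) (u t) k) \<le> \<epsilon>"
            using adv_conv[OF t, of N k] elim by (simp add: der'_def)
          then show "norm (h *\<^sub>R der' N t k - h *\<^sub>R adv (vel q (u t)) (u t) k) \<le> \<epsilon> * norm h"
            unfolding scaleR_diff_right[symmetric] norm_scaleR mult.commute[of \<epsilon>] real_norm_def
            by (intro mult_left_mono) auto
        qed
      qed
    qed (use t u[OF t] in auto)
    then obtain g where g: "\<And>t. t \<in> {0..T} \<Longrightarrow> (\<lambda>N. c N t k) \<longlonglongrightarrow> g t"
      "\<And>t. t \<in> {0..T} \<Longrightarrow> (g has_derivative (\<lambda>h. h *\<^sub>R adv (vel q (u t)) (u t) k)) (at t within {0..T})"
      by blast
    have "g s = u s k" if "s \<in> {0..T}" for s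
      using LIMSEQ_unique[OF g(1)[OF that] u[OF that]] .
    then show "((\<lambda>t. u t k) has_vector_derivative adv (vel q (u t)) (u t) k) (at t within {0..T})"
      unfolding has_vector_derivative_def
      using has_derivative_transform[OF t _ g(2)[OF t], of "\<lambda>t. u t k"] by simp
  qed
qed

end

section \<open>Fourier series\<close>

text \<open>Enumerating the integers turns unordered sums into series, so that the theorems on
  termwise differentiation and integration apply.\<close>

lemma sums_int_decode:
  fixes f :: "int \<Rightarrow> 'a::banach"
  assumes "f summable_on UNIV"
  shows "(\<lambda>n. f (int_decode n)) sums infsum f UNIV"
proof -
  have "(f has_sum infsum f UNIV) (int_decode ` UNIV)"
    using assms surj_int_decode by (simp add: has_sum_infsum)
  then have "((f \<circ> int_decode) has_sum infsum f UNIV) UNIV"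
    by (subst (asm) has_sum_reindex[OF inj_int_decode])
  then show ?thesis by (auto dest: has_sum_imp_sums simp: o_def)
qed

lemma summable_jb_decode: "summable (\<lambda>n. D / jb (int_decode n) ^ 2)"
  using sums_int_decode[OF summable_on_cmult_right[OF summable_on_jb, of D]] by (simp add: sums_iff)

text \<open>The Weierstrass test for derivatives: the majorant does not depend on the point, so the
  tails of the differentiated series are uniformly small relative to \<open>norm h\<close>. A
  general convex \<open>S\<close> covers closed time intervals as well as the half-open
  strip.\<close>

lemma has_derivative_infsum:
  fixes f :: "int \<Rightarrow> 'a::real_normed_vector \<Rightarrow> complex"
  assumes S: "convex S" and x: "x \<in> S"
    and der: "\<And>l x. x \<in> S \<Longrightarrow> (f l has_derivative f' l x) (at x within S)"
    and bd': "\<And>l x h. x \<in> S \<Longrightarrow> norm (f' l x h) \<le> D / jb l ^ 2 * norm h"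
    and bd: "\<And>l x. x \<in> S \<Longrightarrow> norm (f l x) \<le> D / jb l ^ 2"
  shows "((\<lambda>x. \<Sum>\<^sub>\<infinity>l. f l x) has_derivative (\<lambda>h. \<Sum>\<^sub>\<infinity>l. f' l x h)) (at x within S)"
proof -
  define g where "g n = D / jb (int_decode n) ^ 2" for n
  have sg: "summable g" unfolding g_def by (rule summable_jb_decode)
  have s: "(\<lambda>n. f (int_decode n) x) sums (\<Sum>\<^sub>\<infinity>l. f l x)" if "x \<in> S" for x
    by (rule sums_int_decode, rule infsum_jb_bound(1)) (use bd that in auto)
  have bd'': "norm (f' l x h) \<le> (D * norm h) / jb l ^ 2" if "x \<in> S" for l x h
    using bd'[OF that, of l h] by simp
  have s': "(\<lambda>n. f' (int_decode n) x h) sums (\<Sum>\<^sub>\<infinity>l. f' l x h)" if "x \<in> S" for x h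
    by (rule sums_int_decode, rule infsum_jb_bound(1)[OF bd''[OF that]])
  have tail: "norm ((\<Sum>i<n. f' (int_decode i) x h) - (\<Sum>\<^sub>\<infinity>l. f' l x h)) \<le> (suminf g - sum g {..<n}) * norm h"
    if "x \<in> S" for x h n
  proof -
    have sm: "summable (\<lambda>i. f' (int_decode i) x h)" using s'[OF that] by (simp add: sums_iff)
    have eq: "(\<Sum>\<^sub>\<infinity>l. f' l x h) - (\<Sum>i<n. f' (int_decode i) x h) = (\<Sum>i. f' (int_decode (i + n)) x h)"
      using suminf_minus_initial_segment[OF sm, of n] s'[OF that, of h] by (simp add: sums_iff)
    have sg': "summable (\<lambda>i. g (i + n) * norm h)"
      using sg by (intro summable_mult2) (simp add: summable_iff_shift)
    have "norm (\<Sum>i. f' (int_decode (i + n)) x h) \<le> (\<Sum>i. g (i + n) * norm h)"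
      by (rule norm_suminf_le[OF _ sg']) (use bd'[OF that] in \<open>simp add: g_def\<close>)
    also have "\<dots> = (\<Sum>i. g (i + n)) * norm h"
      using sg by (intro suminf_mult2[symmetric]) (simp add: summable_iff_shift)
    also have "(\<Sum>i. g (i + n)) = suminf g - sum g {..<n}"
      by (rule suminf_minus_initial_segment[OF sg])
    finally show ?thesis unfolding eq[symmetric] by (simp add: norm_minus_commute)
  qed
  have "\<exists>F. \<forall>x\<in>S. (\<lambda>n. f (int_decode n) x) sums F x \<and> (F has_derivative (\<lambda>h. \<Sum>\<^sub>\<infinity>l. f' l x h)) (at x within S)"
  proof (rule has_derivative_series[where f = "\<lambda>n. f (int_decode n)" and f' = "\<lambda>n. f' (int_decode n)", OF S])
    show "(f (int_decode n) has_derivative f' (int_decode n) x) (at x within S)" if "x \<in> S" for n x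
      by (rule der[OF that])
    fix e :: real assume e: "0 < e"
    have "(\<lambda>n. suminf g - sum g {..<n}) \<longlonglongrightarrow> suminf g - suminf g"
      by (intro tendsto_intros summable_LIMSEQ sg)
    then have "\<forall>\<^sub>F n in sequentially. suminf g - sum g {..<n} < e"
      using e by (auto dest: order_tendstoD(2))
    then show "\<forall>\<^sub>F n in sequentially. \<forall>x\<in>S. \<forall>h. norm ((\<Sum>i<n. f' (int_decode i) x h) - (\<Sum>\<^sub>\<infinity>l. f' l x h)) \<le> e * norm h"
    proof eventually_elim
      case (elim n)
      show ?case
      proof (intro ballI allI)
        fix x h :: 'a assume x: "x \<in> S"
        have "(suminf g - sum g {..<n}) * norm h \<le> e * norm h"
          using elim by (intro mult_right_mono) auto
        with tail[OF x, of h n]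
        show "norm ((\<Sum>i<n. f' (int_decode i) x h) - (\<Sum>\<^sub>\<infinity>l. f' l x h)) \<le> e * norm h" by linarith
      qed
    qed
  qed (use x s[OF x] in auto)
  then obtain F where F: "\<And>x. x \<in> S \<Longrightarrow> (\<lambda>n. f (int_decode n) x) sums F x"
    "\<And>x. x \<in> S \<Longrightarrow> (F has_derivative (\<lambda>h. \<Sum>\<^sub>\<infinity>l. f' l x h)) (at x within S)" by blast
  have eq: "(\<Sum>\<^sub>\<infinity>l. f l x) = F x" if "x \<in> S" for x using sums_unique2[OF s[OF that] F(1)[OF that]] .
  show ?thesis by (rule has_derivative_transform[OF x eq F(2)[OF x]])
qed

text \<open>The majorant separates into a summable factor in \<open>l\<close> and an integrable
  factor in \<open>y\<close>. It is used with a constant \<open>w\<close> on one period and with a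
  multiple of the kernel weight on the half line.\<close>

lemma integral_infsum:
  fixes f :: "int \<Rightarrow> 'm \<Rightarrow> complex"
  assumes w: "integrable M w" and meas: "\<And>l. f l \<in> borel_measurable M"
    and bd: "\<And>l y. norm (f l y) \<le> D / jb l ^ 2 * w y"
  shows "integrable M (\<lambda>y. \<Sum>\<^sub>\<infinity>l. f l y)" "(\<integral>y. (\<Sum>\<^sub>\<infinity>l. f l y) \<partial>M) = (\<Sum>\<^sub>\<infinity>l. \<integral>y. f l y \<partial>M)"
proof -
  have int: "integrable M (f l)" for l
    by (rule Bochner_Integration.integrable_bound[OF integrable_mult_right[OF w, of "D / jb l ^ 2"] meas])
      (auto intro!: AE_I2 order_trans[OF bd abs_ge_self] simp del: times_divide_eq_left)
  have bdi: "(\<integral>y. norm (f l y) \<partial>M) \<le> (D * (\<integral>y. w y \<partial>M)) / jb l ^ 2" for l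
  proof -
    have "(\<integral>y. norm (f l y) \<partial>M) \<le> (\<integral>y. D / jb l ^ 2 * w y \<partial>M)"
      by (intro integral_mono integrable_norm int integrable_mult_right w bd)
    then show ?thesis by simp
  qed
  have pt: "norm (f l y) \<le> (D * w y) / jb l ^ 2" for l y using bd[of l y] by simp
  have s: "(\<lambda>n. f (int_decode n) y) sums (\<Sum>\<^sub>\<infinity>l. f l y)" for y
    by (rule sums_int_decode, rule infsum_jb_bound(1)[OF pt])
  have eq: "(\<lambda>y. \<Sum>\<^sub>\<infinity>l. f l y) = (\<lambda>y. \<Sum>n. f (int_decode n) y)" using s by (simp add: sums_iff)
  have i: "integrable M (f (int_decode n))" for n by (rule int)
  have sn: "AE y in M. summable (\<lambda>n. norm (f (int_decode n) y))"
    by (rule AE_I2, rule summable_comparison_test'[OF summable_jb_decode, of 0]) (use pt in auto)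
  have si: "summable (\<lambda>n. \<integral>y. norm (f (int_decode n) y) \<partial>M)"
    by (rule summable_comparison_test'[OF summable_jb_decode, of 0]) (use bdi in auto)
  show "integrable M (\<lambda>y. \<Sum>\<^sub>\<infinity>l. f l y)" unfolding eq by (rule integrable_suminf[OF i sn si])
  have "norm (\<integral>y. f l y \<partial>M) \<le> (D * (\<integral>y. w y \<partial>M)) / jb l ^ 2" for l
    using integral_norm_bound[of M "f l"] bdi[of l] by linarith
  from sums_int_decode[OF infsum_jb_bound(1)[OF this]] sums_integral[OF i sn si]
  show "(\<integral>y. (\<Sum>\<^sub>\<infinity>l. f l y) \<partial>M) = (\<Sum>\<^sub>\<infinity>l. \<integral>y. f l y \<partial>M)"
    unfolding eq by (rule sums_unique2[symmetric])
qed

section \<open>Characters and Fourier coefficients on the circle\<close>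

definition wave :: "int \<Rightarrow> real \<Rightarrow> complex" where
  "wave k x = cis (of_int k * x)"

lemma norm_wave [simp]: "norm (wave k x) = 1"
  by (simp add: wave_def)

lemma wave_add: "wave (j + k) x = wave j x * wave k x"
  by (simp add: wave_def cis_mult algebra_simps)

lemma wave_0 [simp]: "wave 0 x = 1" "wave k 0 = 1"
  by (auto simp: wave_def)

lemma wave_cnj: "cnj (wave k x) = wave (- k) x"
  by (simp add: wave_def cis_cnj)

lemma wave_inverse: "wave (- k) x * wave k x = 1"
  by (simp add: wave_add[symmetric])

lemma wave_plus: "wave k (x + y) = wave k x * wave k y"
  by (simp add: wave_def cis_mult algebra_simps)

lemma wave_2pi: "wave k (2 * pi) = 1"
proof -
  have "wave k (2 * pi) = cis (2 * pi * of_int k)" by (simp add: wave_def mult.commute)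
  then show ?thesis by (simp add: cis_multiple_2pi)
qed

lemma wave_periodic: "wave k (x + 2 * pi) = wave k x"
  by (simp add: wave_plus wave_2pi)

lemma wave_pi_eq: "wave k (- pi) = wave k pi"
  using wave_periodic[of k "- pi"] by simp

lemma has_vector_derivative_wave:
  "(wave k has_vector_derivative (\<i> * of_int k * wave k x)) (at x within S)"
proof -
  have "((\<lambda>x. cis (of_int k * x)) has_derivative (\<lambda>t. (of_int k * t) *\<^sub>R (\<i> * cis (of_int k * x)))) (at x within S)"
    by (auto intro!: derivative_eq_intros)
  then show ?thesis
    by (simp add: has_vector_derivative_def wave_def[abs_def] scaleR_conv_of_real mult_ac)
qed

lemma continuous_on_wave [continuous_intros]: "continuous_on S (wave k)"
  by (rule continuous_on_vector_derivative[OF has_vector_derivative_wave])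

definition fcoeff :: "(real \<Rightarrow> complex) \<Rightarrow> int \<Rightarrow> complex" where
  "fcoeff f k = integral {- pi..pi} (\<lambda>x. f x * wave (- k) x) / (2 * pi)"

lemma norm_fcoeff_le:
  assumes f: "continuous_on {- pi..pi} f" and B: "\<And>x. x \<in> {- pi..pi} \<Longrightarrow> norm (f x) \<le> B"
  shows "norm (fcoeff f k) \<le> B"
proof -
  have "norm (integral {- pi..pi} (\<lambda>x. f x * wave (- k) x)) \<le> B * (pi - (- pi))"
    by (rule integral_bound) (use B in \<open>auto intro!: continuous_intros f simp: norm_mult\<close>)
  then show ?thesis by (simp add: fcoeff_def norm_divide field_simps)
qed

text \<open>The boundary term is kept because the formula is also applied to polynomials, which are
  not periodic.\<close>

lemma fcoeff_by_parts:
  assumes der: "\<And>x. x \<in> {- pi..pi} \<Longrightarrow> (f has_vector_derivative f' x) (at x within {- pi..pi})"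
    and cont: "continuous_on {- pi..pi} f'"
  shows "fcoeff f' k = (f pi - f (- pi)) * wave (- k) pi / (2 * pi) + \<i> * of_int k * fcoeff f k"
proof -
  have fc: "continuous_on {- pi..pi} f" by (rule continuous_on_vector_derivative[OF der])
  define a where "a = \<i> * complex_of_int (- k)"
  have "((\<lambda>x. f x * (a * wave (- k) x) + f' x * wave (- k) x) has_integral
      (f pi * wave (- k) pi - f (- pi) * wave (- k) (- pi))) {- pi..pi}"
  proof (rule fundamental_theorem_of_calculus)
    fix x assume x: "x \<in> {- pi..pi}"
    show "((\<lambda>x. f x * wave (- k) x) has_vector_derivative (f x * (a * wave (- k) x) + f' x * wave (- k) x)) (at x within {- pi..pi})"
      unfolding a_def by (rule has_vector_derivative_mult[OF der[OF x] has_vector_derivative_wave])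
  qed simp
  then have "integral {- pi..pi} (\<lambda>x. f x * (a * wave (- k) x) + f' x * wave (- k) x) = (f pi - f (- pi)) * wave (- k) pi"
    by (simp add: integral_unique wave_pi_eq algebra_simps)
  moreover have "integral {- pi..pi} (\<lambda>x. f x * (a * wave (- k) x) + f' x * wave (- k) x)
     = integral {- pi..pi} (\<lambda>x. a * (f x * wave (- k) x)) + integral {- pi..pi} (\<lambda>x. f' x * wave (- k) x)"
    by (subst Henstock_Kurzweil_Integration.integral_add[symmetric])
      (auto intro!: integrable_continuous_real continuous_intros fc cont simp: mult_ac)
  moreover have "integral {- pi..pi} (\<lambda>x. a * (f x * wave (- k) x)) = a * integral {- pi..pi} (\<lambda>x. f x * wave (- k) x)"
    by (rule integral_mult_right)
  ultimately have e: "integral {- pi..pi} (\<lambda>x. f' x * wave (- k) x)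
      = (f pi - f (- pi)) * wave (- k) pi - a * integral {- pi..pi} (\<lambda>x. f x * wave (- k) x)"
    by (simp only: eq_diff_eq add.commute)
  show ?thesis unfolding fcoeff_def e by (simp add: a_def diff_divide_distrib add_divide_distrib)
qed

lemma fcoeff_derivative:
  assumes "f pi = f (- pi)"
    and "\<And>x. x \<in> {- pi..pi} \<Longrightarrow> (f has_vector_derivative f' x) (at x within {- pi..pi})"
    and "continuous_on {- pi..pi} f'"
  shows "fcoeff f' k = \<i> * of_int k * fcoeff f k"
  using fcoeff_by_parts[OF assms(2,3), of k] assms(1) by simp

text \<open>A uniformly close polynomial has coefficients of order \<open>1 / k\<close> by one
  integration by parts, and the uniform error bounds the coefficients of the remainder for all
  \<open>k\<close> at once.\<close>

lemma riemann_lebesgue: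
  assumes G: "continuous_on {- pi..pi} G" and e: "0 < e"
  obtains K where "0 < K" "\<And>k. K \<le> \<bar>real_of_int k\<bar> \<Longrightarrow> norm (fcoeff G k) < e"
proof -
  obtain p where p: "polynomial_function p" "\<And>x. x \<in> {- pi..pi} \<Longrightarrow> norm (G x - p x) < e / 2"
    using Stone_Weierstrass_polynomial_function[OF compact_Icc G, of "e / 2"] e by auto
  obtain p' where p': "polynomial_function p'" "\<And>x. (p has_vector_derivative p' x) (at x)"
    using has_vector_derivative_polynomial_function[OF p(1)] by blast
  have pc: "continuous_on S p" "continuous_on S p'" for S
    using p(1) p'(1) continuous_on_polymonial_function by blast+
  have "bounded (p' ` {- pi..pi})"
    by (rule compact_imp_bounded[OF compact_continuous_image[OF pc(2) compact_Icc]])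
  then obtain B where B: "\<And>x. x \<in> {- pi..pi} \<Longrightarrow> norm (p' x) \<le> B"
    unfolding bounded_iff by (meson image_eqI)
  define C where "C = norm (p pi - p (- pi)) + B * (2 * pi)"
  have B0: "0 \<le> B" by (rule order_trans[OF norm_ge_zero B[of 0]]) simp
  have C0: "0 \<le> C" using B0 by (simp add: C_def)
  have main: "norm (fcoeff p k) * (2 * pi * \<bar>real_of_int k\<bar>) \<le> C" for k
  proof -
    have "fcoeff p' k = (p pi - p (- pi)) * wave (- k) pi / (2 * pi) + \<i> * of_int k * fcoeff p k"
      by (rule fcoeff_by_parts[OF has_vector_derivative_at_within[OF p'(2)] pc(2)])
    then have "\<i> * of_int k * fcoeff p k * (2 * pi) = fcoeff p' k * (2 * pi) - (p pi - p (- pi)) * wave (- k) pi"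
      by (simp add: field_simps)
    then have "norm (\<i> * of_int k * fcoeff p k * (2 * pi)) \<le> norm (fcoeff p' k * (2 * pi)) + norm ((p pi - p (- pi)) * wave (- k) pi)"
      by (simp only: norm_triangle_ineq4)
    moreover have "norm (fcoeff p' k) * (2 * pi) \<le> B * (2 * pi)"
      by (intro mult_right_mono norm_fcoeff_le pc B) auto
    moreover have "norm (\<i> * of_int k * fcoeff p k * (2 * pi)) = norm (fcoeff p k) * (2 * pi * \<bar>real_of_int k\<bar>)"
      "norm (fcoeff p' k * (2 * pi)) = norm (fcoeff p' k) * (2 * pi)"
      "norm ((p pi - p (- pi)) * wave (- k) pi) = norm (p pi - p (- pi))"
      by (simp_all add: norm_mult)
    ultimately show ?thesis unfolding C_def by linarith
  qed
  have diff: "fcoeff G k = fcoeff (\<lambda>x. G x - p x) k + fcoeff p k" for k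
    unfolding fcoeff_def add_divide_distrib[symmetric]
    by (subst Henstock_Kurzweil_Integration.integral_add[symmetric])
      (auto intro!: integrable_continuous_real continuous_intros pc G simp: algebra_simps)
  show ?thesis
  \<comment> \<open>Beyond \<open>C / (e * pi)\<close> the estimate \<open>main\<close> puts the
    coefficient of \<open>p\<close> below \<open>e / 2\<close>; the summand 1 makes the threshold
    positive and the comparison strict.\<close>
  proof (rule that[of "C / (e * pi) + 1"])
    show "0 < C / (e * pi) + 1" using C0 e by (simp add: add_nonneg_pos)
    fix k assume k: "C / (e * pi) + 1 \<le> \<bar>real_of_int k\<bar>"
    then have kp: "0 < \<bar>real_of_int k\<bar>" using C0 e by (smt (verit) divide_nonneg_pos mult_pos_pos pi_gt_zero)
    have "C / (e * pi) < \<bar>real_of_int k\<bar>" using k by simp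
    then have "C < e / 2 * (2 * pi * \<bar>real_of_int k\<bar>)" using e by (simp add: field_simps)
    with main[of k] have "norm (fcoeff p k) * (2 * pi * \<bar>real_of_int k\<bar>) < e / 2 * (2 * pi * \<bar>real_of_int k\<bar>)" by linarith
    then have "norm (fcoeff p k) < e / 2" using kp by (simp add: mult_less_cancel_right)
    moreover have "norm (fcoeff (\<lambda>x. G x - p x) k) \<le> e / 2"
      by (rule norm_fcoeff_le) (use p(2) in \<open>auto intro!: continuous_intros G pc intro: less_imp_le\<close>)
    ultimately show "norm (fcoeff G k) < e"
      unfolding diff using norm_triangle_ineq[of "fcoeff (\<lambda>x. G x - p x) k" "fcoeff p k"] by linarith
  qed
qed

lemma fcoeff_wave: "fcoeff (wave j) k = (if j = k then 1 else 0)"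
proof (cases "j = k")
  case True
  have "wave k x * wave (- k) x = 1" for x using wave_inverse[of k x] by (simp add: mult.commute)
  then show ?thesis using True by (simp add: fcoeff_def scaleR_conv_of_real)
next
  case False
  \<comment> \<open>Differentiating \<open>wave j\<close> multiplies its coefficient at
    \<open>k\<close> by \<open>\<i> * k\<close> in general and by \<open>\<i> * j\<close> because it
    is an eigenfunction; for different frequencies the coefficient must vanish.\<close>
  have "fcoeff (\<lambda>x. \<i> * of_int j * wave j x) k = \<i> * of_int k * fcoeff (wave j) k"
    by (rule fcoeff_derivative) (auto simp: wave_pi_eq intro!: has_vector_derivative_wave continuous_intros)
  moreover have "fcoeff (\<lambda>x. \<i> * of_int j * wave j x) k = \<i> * of_int j * fcoeff (wave j) k"
    unfolding fcoeff_def mult.assoc by (subst integral_mult_right)+ simp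
  ultimately have "of_int j * fcoeff (wave j) k = of_int k * fcoeff (wave j) k" by simp
  then show ?thesis using False by simp
qed

lemma fcoeff_series:
  assumes d: "\<And>l. norm (d l) \<le> C / jb l ^ 2"
  shows "fcoeff (\<lambda>x. \<Sum>\<^sub>\<infinity>l. d l * wave l x) k = d k"
proof -
  let ?M = "lebesgue_on {- pi..pi}"
  have meas: "(\<lambda>x. d l * wave l x * wave (- k) x) \<in> borel_measurable ?M" for l
    by (intro continuous_imp_measurable_on_sets_lebesgue continuous_intros) auto
  have w: "integrable ?M (\<lambda>x. 1::real)"
    by (rule continuous_imp_integrable_real) (intro continuous_intros)
  have bd: "norm (d l * wave l x * wave (- k) x) \<le> C / jb l ^ 2 * 1" for l x
    using d[of l] by (simp add: norm_mult)
  have int: "integrable ?M (\<lambda>x. d l * wave l x * wave (- k) x)" for l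
    by (rule continuous_imp_integrable_real) (intro continuous_intros)
  have ser: "(\<Sum>\<^sub>\<infinity>l. d l * wave l x * wave (- k) x) = (\<Sum>\<^sub>\<infinity>l. d l * wave l x) * wave (- k) x" for x
    by (rule infsum_cmult_left')
  have "integral {- pi..pi} (\<lambda>x. (\<Sum>\<^sub>\<infinity>l. d l * wave l x) * wave (- k) x)
     = (\<integral>x. (\<Sum>\<^sub>\<infinity>l. d l * wave l x * wave (- k) x) \<partial>?M)"
    unfolding ser[symmetric]
    by (rule lebesgue_integral_eq_integral[symmetric, OF integral_infsum(1)[OF w meas bd]]) auto
  also have "\<dots> = (\<Sum>\<^sub>\<infinity>l. \<integral>x. d l * wave l x * wave (- k) x \<partial>?M)"
    by (rule integral_infsum(2)[OF w meas bd])
  also have "\<dots> = (\<Sum>\<^sub>\<infinity>l. (if l = k then 2 * pi * d k else 0))"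
  proof (rule infsum_cong)
    fix l
    have "(\<integral>x. d l * wave l x * wave (- k) x \<partial>?M) = integral {- pi..pi} (\<lambda>x. d l * (wave l x * wave (- k) x))"
      using lebesgue_integral_eq_integral[OF int[of l]] by (simp add: mult.assoc)
    also have "\<dots> = d l * (2 * pi * fcoeff (wave l) k)"
      unfolding fcoeff_def by (subst integral_mult_right) simp
    finally show "(\<integral>x. d l * wave l x * wave (- k) x \<partial>?M) = (if l = k then 2 * pi * d k else 0)"
      by (simp add: fcoeff_wave)
  qed
  also have "\<dots> = (\<Sum>\<^sub>\<infinity>l\<in>{k}. 2 * pi * d k)"
    by (rule infsum_cong_neutral) auto
  finally show ?thesis by (simp add: fcoeff_def)
qed

lemma series_has_vector_derivative:
  assumes d: "\<And>l. norm (d l) \<le> C / jb l ^ 3"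
  shows "((\<lambda>x. \<Sum>\<^sub>\<infinity>l. d l * wave l x) has_vector_derivative (\<Sum>\<^sub>\<infinity>l. \<i> * of_int l * d l * wave l x)) (at x)"
proof -
  have "((\<lambda>x. \<Sum>\<^sub>\<infinity>l. d l * wave l x) has_derivative (\<lambda>h. \<Sum>\<^sub>\<infinity>l. h *\<^sub>R (\<i> * of_int l * d l * wave l x))) (at x within UNIV)"
  proof (rule has_derivative_infsum[where D = C])
    show "((\<lambda>x. d l * wave l x) has_derivative (\<lambda>h. h *\<^sub>R (\<i> * of_int l * d l * wave l x))) (at x within UNIV)" for l x
      using has_vector_derivative_mult_right[OF has_vector_derivative_wave[of l x UNIV], of "d l"]
      by (simp add: has_vector_derivative_def mult_ac)
    fix l and x h :: real
    have "\<bar>real_of_int l\<bar> * norm (d l) \<le> jb l * (C / jb l ^ 3)"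
      by (intro mult_mono d abs_le_jb) auto
    also have "\<dots> = C / jb l ^ 2" by (simp add: power3_eq_cube power2_eq_square)
    finally have "\<bar>h\<bar> * (\<bar>real_of_int l\<bar> * norm (d l)) \<le> \<bar>h\<bar> * (C / jb l ^ 2)" by (intro mult_left_mono) auto
    then show "norm (h *\<^sub>R (\<i> * of_int l * d l * wave l x)) \<le> C / jb l ^ 2 * norm h"
      by (simp add: norm_mult mult_ac)
    show "norm (d l * wave l x) \<le> C / jb l ^ 2"
      using decay_weaken[OF d, of 2 l] by (simp add: norm_mult)
  qed auto
  moreover have "(\<Sum>\<^sub>\<infinity>l. h *\<^sub>R (\<i> * of_int l * d l * wave l x)) = h *\<^sub>R (\<Sum>\<^sub>\<infinity>l. \<i> * of_int l * d l * wave l x)" for h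
    unfolding scaleR_conv_of_real by (rule infsum_cmult_right')
  ultimately show ?thesis by (simp add: has_vector_derivative_def)
qed

section \<open>Pointwise Fourier inversion\<close>

lemma wave_1_neq_1: "s \<noteq> 0 \<Longrightarrow> \<bar>s\<bar> < 2 * pi \<Longrightarrow> wave 1 s \<noteq> 1"
proof
  assume s: "s \<noteq> 0" "\<bar>s\<bar> < 2 * pi" and "wave 1 s = 1"
  then have "cos s = 1" by (simp add: wave_def complex_eq_iff)
  then obtain n :: int where n: "s = of_int n * (2 * pi)" by (auto simp: cos_one_2pi_int)
  with s have "\<bar>real_of_int n\<bar> * (2 * pi) < 1 * (2 * pi)" by (simp add: abs_mult)
  then have "\<bar>real_of_int n\<bar> < 1" by (simp only: mult_less_cancel_right) auto
  then have "n = 0" by linarith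
  with n s show False by simp
qed

lemma sum_telescope_int:
  fixes a :: "int \<Rightarrow> 'a::ab_group_add"
  shows "(\<Sum>k\<in>{- int N..int N}. a (k - 1) - a k) = a (- int N - 1) - a (int N)"
proof (induction N)
  case (Suc N)
  have "{- int (Suc N)..int (Suc N)} = insert (int (Suc N)) (insert (- int (Suc N)) {- int N..int N})" by auto
  moreover have "a (- 1 - int N) = a (- int N - 1)" by (rule arg_cong[of _ _ a]) simp
  ultimately show ?case using Suc by (simp add: algebra_simps)
qed simp

text \<open>Allows an unordered sum to be evaluated along symmetric partial sums, where the
  telescoping takes place.\<close>

lemma filterlim_freqs: "filterlim (\<lambda>N. {- int N..int N}) (finite_subsets_at_top UNIV) sequentially"
  unfolding filterlim_finite_subsets_at_top
proof (intro allI impI)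
  fix X :: "int set" assume X: "finite X \<and> X \<subseteq> UNIV"
  then obtain N where N: "\<And>k. k \<in> X \<Longrightarrow> nat \<bar>k\<bar> \<le> N"
    using finite_imageI[of X "\<lambda>k. nat \<bar>k\<bar>"] finite_nat_set_iff_bounded_le[of "(\<lambda>k. nat \<bar>k\<bar>) ` X"] by auto
  show "\<forall>\<^sub>F N in sequentially. finite {- int N..int N} \<and> X \<subseteq> {- int N..int N} \<and> {- int N..int N} \<subseteq> UNIV"
    unfolding eventually_sequentially
  proof (intro exI allI impI conjI)
    fix n assume "N \<le> n"
    then have "nat \<bar>k\<bar> \<le> n" if "k \<in> X" for k using N[OF that] by simp
    then show "X \<subseteq> {- int n..int n}" by (force simp: nat_le_iff)
  qed auto
qed

lemma difference_quotient_tendsto: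
  assumes "(f has_vector_derivative f') (at x)"
  shows "((\<lambda>t. (f t - f x) / of_real (t - x)) \<longlongrightarrow> (f'::complex)) (at x)"
proof -
  have lim: "((\<lambda>t. (f t - f x - (t - x) *\<^sub>R f') /\<^sub>R norm (t - x)) \<longlongrightarrow> 0) (at x)"
    using assms by (simp add: has_vector_derivative_def has_derivative_at_within has_derivative_def)
  have "((\<lambda>t. (f t - f x) / of_real (t - x) - f') \<longlongrightarrow> 0) (at x)"
  proof (rule Lim_null_comparison[OF _ tendsto_norm_zero[OF lim]])
    show "\<forall>\<^sub>F t in at x. norm ((f t - f x) / of_real (t - x) - f') \<le> norm ((f t - f x - (t - x) *\<^sub>R f') /\<^sub>R norm (t - x))"
      unfolding eventually_at_filter
    proof (intro always_eventually allI impI)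
      fix t assume "t \<noteq> x"
      then have "(f t - f x) / of_real (t - x) - f' = (f t - f x - (t - x) *\<^sub>R f') / of_real (t - x)"
        by (simp add: field_simps scaleR_conv_of_real)
      then show "norm ((f t - f x) / of_real (t - x) - f') \<le> norm ((f t - f x - (t - x) *\<^sub>R f') /\<^sub>R norm (t - x))"
        by (simp add: norm_mult norm_inverse divide_inverse mult.commute del: of_real_diff)
    qed
  qed
  then show ?thesis by (simp add: LIM_zero_iff)
qed

text \<open>The partial sums telescope once \<open>f - f x0\<close> is divided by \<open>exp (\<i> * (t - x0)) - 1\<close>, and the two
  remaining boundary coefficients vanish in the limit by the Riemann--Lebesgue lemma.\<close>
lemma fourier_inversion_interior:
  assumes der: "\<And>x. (f has_vector_derivative f' x) (at x)"
    and sm: "(\<lambda>k. fcoeff f k * wave k x0) summable_on UNIV"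
    and x0: "- pi < x0" "x0 < pi"
  shows "(\<Sum>\<^sub>\<infinity>k. fcoeff f k * wave k x0) = f x0"
proof -
  have fc: "continuous_on S f" for S
    using der by (meson continuous_on_vector_derivative has_vector_derivative_at_within)
  \<comment> \<open>Numerator and denominator, each divided by \<open>t - x0\<close>, tend to
    \<open>f' x0\<close> and \<open>\<i>\<close>. The value at \<open>x0\<close> therefore makes
    \<open>G\<close> continuous, as \<open>riemann_lebesgue\<close> requires.\<close>
  define G where "G t = (if t = x0 then f' x0 / \<i> else (f t - f x0) / (wave 1 (t - x0) - 1))" for t
  \<comment> \<open>Since \<open>x0\<close> lies strictly inside,
    \<open>\<bar>t - x0\<bar> < 2 * pi\<close> on the closed interval and the denominator vanishes
    at \<open>x0\<close> only; for an endpoint it would vanish at both ends.\<close>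
  have nz: "wave 1 (t - x0) \<noteq> 1" if "t \<in> {- pi..pi}" "t \<noteq> x0" for t
    by (rule wave_1_neq_1) (use that x0 in auto)
  have wder: "((\<lambda>t. wave 1 (t - x0)) has_vector_derivative (\<i> * wave 1 (t - x0))) (at t)" for t
  proof -
    have "((\<lambda>t. t - x0) has_vector_derivative 1) (at t)" by (auto intro!: derivative_eq_intros)
    from vector_diff_chain_at[OF this has_vector_derivative_wave[of 1 "t - x0" UNIV]] show ?thesis
      by (simp add: o_def)
  qed
  have wc: "continuous_on S (\<lambda>t. wave 1 (t - x0))" for S
    using wder by (meson continuous_on_vector_derivative has_vector_derivative_at_within)
  have Gc: "continuous_on {- pi..pi} G"
    unfolding continuous_on_eq_continuous_within
  proof
    fix t assume t: "t \<in> {- pi..pi}"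
    show "continuous (at t within {- pi..pi}) G"
    proof (cases "t = x0")
      case False
      have "continuous (at t within {- pi..pi}) (\<lambda>t. (f t - f x0) / (wave 1 (t - x0) - 1))"
        using fc[of "{- pi..pi}"] wc[of "{- pi..pi}"] t nz[OF t False]
        by (intro continuous_intros) (auto simp: continuous_on_eq_continuous_within)
      then show ?thesis
        by (rule continuous_transform_within[where \<delta> = "\<bar>t - x0\<bar>"]) (use False t in \<open>auto simp: G_def dist_real_def\<close>)
    next
      case True
      have "((\<lambda>t. ((f t - f x0) / of_real (t - x0)) / ((wave 1 (t - x0) - wave 1 (x0 - x0)) / of_real (t - x0)))
          \<longlongrightarrow> f' x0 / \<i>) (at x0)"
        by (rule tendsto_eq_rhs[OF tendsto_divide[OF difference_quotient_tendsto[OF der] difference_quotient_tendsto[OF wder]]]) auto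
      then have "(G \<longlongrightarrow> f' x0 / \<i>) (at x0)"
        by (rule Lim_transform_eventually)
          (simp add: G_def eventually_at_filter always_eventually del: of_real_diff)
      then have "(G \<longlongrightarrow> G x0) (at x0 within {- pi..pi})"
        by (auto simp: G_def intro: tendsto_within_subset)
      then show ?thesis using True by (simp add: continuous_within)
    qed
  qed
  have fG: "f t - f x0 = G t * wave 1 t * wave (- 1) x0 - G t" if t: "t \<in> {- pi..pi}" for t
  proof (cases "t = x0")
    case True
    then show ?thesis using wave_inverse[of 1 x0] by (simp add: mult_ac)
  next
    case False
    have "wave 1 (t - x0) = wave 1 t * wave (- 1) x0" by (simp add: wave_def cis_mult)
    moreover have "f t - f x0 = G t * (wave 1 (t - x0) - 1)" using nz[OF t False] False by (simp add: G_def)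
    ultimately show ?thesis by (simp add: algebra_simps)
  qed
  define a where "a k = fcoeff G k * wave k x0" for k
  \<comment> \<open>Multiplication by \<open>wave 1\<close> shifts the coefficients of
    \<open>G\<close> by one frequency, so those of \<open>f - f x0\<close> become consecutive
    differences.\<close>
  have step: "fcoeff f k * wave k x0 - (if k = 0 then f x0 else 0) = a (k - 1) - a k" for k
  proof -
    have i: "(\<lambda>t. f t * wave (- k) t) integrable_on {- pi..pi}" "(\<lambda>t. f x0 * wave (- k) t) integrable_on {- pi..pi}"
      "(\<lambda>t. wave (- 1) x0 * (G t * wave (- (k - 1)) t)) integrable_on {- pi..pi}" "(\<lambda>t. G t * wave (- k) t) integrable_on {- pi..pi}"
      by (auto intro!: integrable_continuous_real continuous_intros fc Gc)
    have "integral {- pi..pi} (\<lambda>t. f t * wave (- k) t) - integral {- pi..pi} (\<lambda>t. f x0 * wave (- k) t)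
      = integral {- pi..pi} (\<lambda>t. f t * wave (- k) t - f x0 * wave (- k) t)"
      by (rule Henstock_Kurzweil_Integration.integral_diff[symmetric, OF i(1,2)])
    also have "\<dots> = integral {- pi..pi} (\<lambda>t. wave (- 1) x0 * (G t * wave (- (k - 1)) t) - G t * wave (- k) t)"
    proof (rule Henstock_Kurzweil_Integration.integral_cong)
      fix t assume t: "t \<in> {- pi..pi}"
      have "wave (- (k - 1)) t = wave 1 t * wave (- k) t" using wave_add[of 1 "- k" t] by simp
      moreover have "f t * wave (- k) t - f x0 * wave (- k) t = (G t * wave 1 t * wave (- 1) x0 - G t) * wave (- k) t"
        unfolding fG[OF t, symmetric] by (simp add: algebra_simps)
      ultimately show "f t * wave (- k) t - f x0 * wave (- k) t = wave (- 1) x0 * (G t * wave (- (k - 1)) t) - G t * wave (- k) t"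
        by (simp add: algebra_simps)
    qed
    also have "\<dots> = integral {- pi..pi} (\<lambda>t. wave (- 1) x0 * (G t * wave (- (k - 1)) t)) - integral {- pi..pi} (\<lambda>t. G t * wave (- k) t)"
      by (rule Henstock_Kurzweil_Integration.integral_diff[OF i(3,4)])
    finally have "integral {- pi..pi} (\<lambda>t. f t * wave (- k) t) - f x0 * integral {- pi..pi} (\<lambda>t. wave 0 t * wave (- k) t)
      = wave (- 1) x0 * integral {- pi..pi} (\<lambda>t. G t * wave (- (k - 1)) t) - integral {- pi..pi} (\<lambda>t. G t * wave (- k) t)"
      by simp
    then have "(integral {- pi..pi} (\<lambda>t. f t * wave (- k) t) - f x0 * integral {- pi..pi} (\<lambda>t. wave 0 t * wave (- k) t)) / (2 * pi)
      = (wave (- 1) x0 * integral {- pi..pi} (\<lambda>t. G t * wave (- (k - 1)) t) - integral {- pi..pi} (\<lambda>t. G t * wave (- k) t)) / (2 * pi)"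
      by simp
    then have "fcoeff f k - f x0 * fcoeff (wave 0) k = wave (- 1) x0 * fcoeff G (k - 1) - fcoeff G k"
      unfolding fcoeff_def by (simp add: diff_divide_distrib)
    then have "(fcoeff f k - (if k = 0 then f x0 else 0)) * wave k x0 = (wave (- 1) x0 * fcoeff G (k - 1) - fcoeff G k) * wave k x0"
      by (simp add: fcoeff_wave eq_commute[of 0 k] split: if_splits)
    moreover have "wave (k - 1) x0 = wave k x0 * wave (- 1) x0" using wave_add[of k "- 1" x0] by simp
    ultimately show ?thesis by (cases "k = 0") (simp_all add: a_def algebra_simps)
  qed
  have "(\<lambda>N. (\<Sum>k\<in>{- int N..int N}. fcoeff f k * wave k x0)) \<longlonglongrightarrow> (\<Sum>\<^sub>\<infinity>k. fcoeff f k * wave k x0)"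
    using has_sum_infsum[OF sm] filterlim_freqs unfolding has_sum_def by (rule filterlim_compose)
  moreover have "(\<lambda>N. (\<Sum>k\<in>{- int N..int N}. fcoeff f k * wave k x0)) \<longlonglongrightarrow> f x0"
  proof (rule LIMSEQ_I)
    fix e :: real assume e: "0 < e"
    then obtain K where K: "0 < K" "\<And>k. K \<le> \<bar>real_of_int k\<bar> \<Longrightarrow> norm (fcoeff G k) < e / 2"
      using riemann_lebesgue[OF Gc, of "e / 2"] by auto
    show "\<exists>N0. \<forall>N\<ge>N0. norm ((\<Sum>k\<in>{- int N..int N}. fcoeff f k * wave k x0) - f x0) < e"
    proof (intro exI allI impI)
      fix N assume N: "nat \<lceil>K\<rceil> \<le> N"
      then have KN: "K \<le> real N" by linarith
      have "(\<Sum>k\<in>{- int N..int N}. fcoeff f k * wave k x0) - f x0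
         = (\<Sum>k\<in>{- int N..int N}. fcoeff f k * wave k x0 - (if k = 0 then f x0 else 0))"
        by (simp add: sum_subtractf)
      also have "\<dots> = a (- int N - 1) - a (int N)" unfolding step by (rule sum_telescope_int)
      finally have "norm ((\<Sum>k\<in>{- int N..int N}. fcoeff f k * wave k x0) - f x0) \<le> norm (a (- int N - 1)) + norm (a (int N))"
        by (simp only: norm_triangle_ineq4)
      also have "\<dots> < e / 2 + e / 2"
        using K(2)[of "- int N - 1"] K(2)[of "int N"] KN by (intro add_strict_mono) (auto simp: a_def norm_mult)
      finally show "norm ((\<Sum>k\<in>{- int N..int N}. fcoeff f k * wave k x0) - f x0) < e" by simp
    qed
  qed
  ultimately show ?thesis by (rule LIMSEQ_unique)
qed

text \<open>Equality passes from the open period to the closed one by continuity and to the line by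
  translation. This supplies inversion at the endpoints, which the interior argument
  excludes.\<close>

lemma periodic_eqI:
  fixes f h :: "real \<Rightarrow> 'a::t2_space"
  assumes per: "\<And>x. f (x + 2 * pi) = f x" "\<And>x. h (x + 2 * pi) = h x"
    and cont: "continuous_on UNIV f" "continuous_on UNIV h"
    and eq: "\<And>x. - pi < x \<Longrightarrow> x < pi \<Longrightarrow> f x = h x"
  shows "f x = h x"
proof -
  have perf: "f (x + of_int n * (2 * pi)) = f x \<and> h (x + of_int n * (2 * pi)) = h x" for n x
  proof (induction n rule: int_induct[where k = 0])
    case (step1 i)
    then show ?case using per(1)[of "x + of_int i * (2 * pi)"] per(2)[of "x + of_int i * (2 * pi)"] by (simp add: algebra_simps)
  next
    case (step2 i)
    then show ?case using per(1)[of "x + of_int (i - 1) * (2 * pi)"] per(2)[of "x + of_int (i - 1) * (2 * pi)"] by (simp add: algebra_simps)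
  qed simp
  have cl: "f y = h y" if y: "y \<in> {- pi..pi}" for y
  proof -
    have "closed {y. f y = h y}" using cont by (intro closed_Collect_eq) auto
    moreover have "{- pi<..<pi} \<subseteq> {y. f y = h y}" using eq by auto
    ultimately have "closure {- pi<..<pi} \<subseteq> {y. f y = h y}" by (intro closure_minimal)
    then show ?thesis using y by (auto simp: closure_greaterThanLessThan)
  qed
  define n where "n = \<lfloor>(x + pi) / (2 * pi)\<rfloor>"
  have "of_int n \<le> (x + pi) / (2 * pi)" "(x + pi) / (2 * pi) < of_int n + 1" unfolding n_def by linarith+
  then have "of_int n * (2 * pi) \<le> x + pi" "x + pi < (of_int n + 1) * (2 * pi)"
    by (simp_all add: le_divide_eq divide_less_eq)
  then have "x - of_int n * (2 * pi) \<in> {- pi..pi}" by (simp add: algebra_simps)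
  from cl[OF this] perf[of "x - of_int n * (2 * pi)" n] show ?thesis by simp
qed

lemma series_continuous:
  assumes "\<And>l. norm (d l) \<le> C / jb l ^ 3"
  shows "continuous_on S (\<lambda>x. \<Sum>\<^sub>\<infinity>l. d l * wave l x)"
  using series_has_vector_derivative[OF assms]
  by (meson continuous_on_vector_derivative has_vector_derivative_at_within)

lemma series_periodic: "(\<Sum>\<^sub>\<infinity>l. d l * wave l (x + 2 * pi)) = (\<Sum>\<^sub>\<infinity>l. d l * wave l x)"
  by (simp add: wave_periodic)

theorem fourier_inversion:
  assumes per: "\<And>x. f (x + 2 * pi) = f x"
    and der: "\<And>x. (f has_vector_derivative f' x) (at x)"
    and decay: "\<And>k. norm (fcoeff f k) \<le> C / jb k ^ 3"
  shows "f x = (\<Sum>\<^sub>\<infinity>k. fcoeff f k * wave k x)"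
proof (rule periodic_eqI[of f "\<lambda>x. \<Sum>\<^sub>\<infinity>k. fcoeff f k * wave k x"])
  show "continuous_on UNIV f"
    using der by (meson continuous_on_vector_derivative has_vector_derivative_at_within)
  fix x assume x: "- pi < x" "x < pi"
  have "norm (fcoeff f k * wave k x) \<le> C / jb k ^ 2" for k
    using decay_weaken[OF decay, of 2 k] by (simp add: norm_mult)
  from fourier_inversion_interior[OF der infsum_jb_bound(1)[OF this] x]
  show "f x = (\<Sum>\<^sub>\<infinity>k. fcoeff f k * wave k x)" by simp
qed (use per series_periodic series_continuous[OF decay] in auto)

text \<open>Repeated integration by parts. The tower \<open>F\<close> is abstract so that both
  iterated \<open>deriv\<close> and the partial derivatives on the strip fit. Derivatives say
  nothing about frequency 0, hence the bound on \<open>F 0\<close>; at the others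
  \<open>jb k \<le> 2 * \<bar>k\<bar>\<close> produces the factor \<open>2 ^ s\<close>.\<close>

lemma fcoeff_decay:
  assumes per: "\<And>n. F n pi = F n (- pi)"
    and der: "\<And>n x. n < s \<Longrightarrow> (F n has_vector_derivative F (Suc n) x) (at x)"
    and cont: "continuous_on {- pi..pi} (F s)"
    and B: "\<And>x. x \<in> {- pi..pi} \<Longrightarrow> norm (F s x) \<le> B" "\<And>x. x \<in> {- pi..pi} \<Longrightarrow> norm (F 0 x) \<le> B"
  shows "norm (fcoeff (F 0) k) \<le> (2 ^ s * B) / jb k ^ s"
proof -
  have B0: "0 \<le> B" by (rule order_trans[OF norm_ge_zero B(1)[of 0]]) simp
  have c: "continuous_on {- pi..pi} (F n)" if "n \<le> s" for n
  proof (cases "n = s")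
    case False
    then have "n < s" using that by simp
    from der[OF this] show ?thesis by (meson continuous_on_vector_derivative has_vector_derivative_at_within)
  qed (simp add: cont)
  have tower: "n \<le> s \<Longrightarrow> fcoeff (F n) k = (\<i> * of_int k) ^ n * fcoeff (F 0) k" for n
  proof (induction n)
    case (Suc n)
    have "fcoeff (F (Suc n)) k = \<i> * of_int k * fcoeff (F n) k"
      by (rule fcoeff_derivative[OF per]) (use Suc.prems in \<open>auto intro!: has_vector_derivative_at_within[OF der] c\<close>)
    then show ?case using Suc by simp
  qed simp
  show ?thesis
  proof (cases "k = 0")
    case True
    have "norm (fcoeff (F 0) k) \<le> B" by (rule norm_fcoeff_le) (use c B in auto)
    also have "\<dots> \<le> 2 ^ s * B" using B0 by (simp add: mult_le_cancel_right1)
    finally show ?thesis using True by (simp add: jb_def)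
  next
    case False
    then have "jb k \<le> 2 * \<bar>real_of_int k\<bar>" by (auto simp: jb_def)
    then have "jb k ^ s \<le> (2 * \<bar>real_of_int k\<bar>) ^ s" by (intro power_mono) auto
    then have "jb k ^ s * norm (fcoeff (F 0) k) \<le> (2 * \<bar>real_of_int k\<bar>) ^ s * norm (fcoeff (F 0) k)"
      by (intro mult_right_mono) auto
    also have "\<dots> = 2 ^ s * norm (fcoeff (F s) k)"
      using tower[of s] by (simp add: norm_mult norm_power power_mult_distrib)
    also have "\<dots> \<le> 2 ^ s * B" by (intro mult_left_mono norm_fcoeff_le c B) auto
    finally show ?thesis by (simp add: field_simps)
  qed
qed

text \<open>The Cauchy product over the integers: absolute summability of the double family permits
  the shear \<open>(j, l) \<mapsto> (j + l, l)\<close>, which groups the terms by total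
  frequency.\<close>

lemma series_mult:
  assumes a: "\<And>l. norm (a l) \<le> C / jb l ^ 2" and b: "\<And>l. norm (b l) \<le> C' / jb l ^ 2"
  shows "(\<Sum>\<^sub>\<infinity>j. a j * wave j x) * (\<Sum>\<^sub>\<infinity>l. b l * wave l x) = (\<Sum>\<^sub>\<infinity>k. (\<Sum>\<^sub>\<infinity>l. a (k - l) * b l) * wave k x)"
proof -
  define A where "A j = a j * wave j x" for j
  define B where "B l = b l * wave l x" for l
  have bdA: "norm (A l) \<le> C / jb l ^ 2" and bdB: "norm (B l) \<le> C' / jb l ^ 2" for l
    using a[of l] b[of l] by (auto simp: A_def B_def norm_mult)
  have sA: "(\<lambda>l. norm (A l)) summable_on UNIV" and sB: "(\<lambda>l. norm (B l)) summable_on UNIV"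
    using infsum_jb_bound(1)[OF bdA] infsum_jb_bound(1)[OF bdB] by (simp_all add: summable_on_iff_abs_summable_on_complex)
  have prod: "(\<lambda>(j, l). A j * B l) summable_on UNIV \<times> UNIV"
  proof (rule abs_summable_summable, rule iffD2[OF Infinite_Sum.abs_summable_on_Sigma_iff[where f = "\<lambda>(j, l). A j * B l"]], intro conjI ballI)
    show "(\<lambda>l. norm (case (j, l) of (j, l) \<Rightarrow> A j * B l)) summable_on UNIV" for j
      using summable_on_cmult_right[OF sB, of "norm (A j)"] by (simp add: norm_mult)
    have "(\<Sum>\<^sub>\<infinity>l. norm (A j * B l)) = norm (A j) * (\<Sum>\<^sub>\<infinity>l. norm (B l))" for j
      unfolding norm_mult by (rule infsum_cmult_right')
    then show "(\<lambda>j. norm (\<Sum>\<^sub>\<infinity>l. norm (case (j, l) of (j, l) \<Rightarrow> A j * B l))) summable_on UNIV"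
      using summable_on_cmult_left[OF sA, of "\<Sum>\<^sub>\<infinity>l. norm (B l)"]
      by (simp add: infsum_nonneg abs_mult)
  qed
  have bij: "bij_betw (\<lambda>(k, l). (k - l, l)) (UNIV \<times> UNIV) (UNIV \<times> (UNIV::int set))"
    by (rule bij_betw_byWitness[where f' = "\<lambda>(j, l). (j + l, l)"]) auto
  have prod2: "(\<lambda>(k, l). A (k - l) * B l) summable_on UNIV \<times> UNIV"
    using summable_on_reindex_bij_betw[OF bij, of "\<lambda>(j, l). A j * B l"] prod by (simp add: case_prod_unfold)
  have "(\<Sum>\<^sub>\<infinity>j. A j) * (\<Sum>\<^sub>\<infinity>l. B l) = (\<Sum>\<^sub>\<infinity>j. A j * (\<Sum>\<^sub>\<infinity>l. B l))"
    by (rule infsum_cmult_left'[symmetric])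
  also have "\<dots> = (\<Sum>\<^sub>\<infinity>j. \<Sum>\<^sub>\<infinity>l. A j * B l)"
    by (simp add: infsum_cmult_right')
  also have "\<dots> = (\<Sum>\<^sub>\<infinity>(j, l)\<in>UNIV \<times> UNIV. A j * B l)"
    using infsum_Sigma_banach[OF prod] by simp
  also have "\<dots> = (\<Sum>\<^sub>\<infinity>(k, l)\<in>UNIV \<times> UNIV. A (k - l) * B l)"
    using infsum_reindex_bij_betw[OF bij, of "\<lambda>(j, l). A j * B l"] by (simp add: case_prod_unfold)
  also have "\<dots> = (\<Sum>\<^sub>\<infinity>k. \<Sum>\<^sub>\<infinity>l. A (k - l) * B l)"
    using infsum_Sigma_banach[OF prod2] by simp
  also have "\<dots> = (\<Sum>\<^sub>\<infinity>k. (\<Sum>\<^sub>\<infinity>l. a (k - l) * b l) * wave k x)"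
  proof (rule infsum_cong)
    fix k
    have "A (k - l) * B l = a (k - l) * b l * wave k x" for l
      using wave_add[of "k - l" l x] by (simp add: A_def B_def mult_ac)
    then show "(\<Sum>\<^sub>\<infinity>l. A (k - l) * B l) = (\<Sum>\<^sub>\<infinity>l. a (k - l) * b l) * wave k x"
      by (simp add: infsum_cmult_left')
  qed
  finally show ?thesis by (simp add: A_def B_def)
qed

section \<open>The operator as a Fourier multiplier\<close>

text \<open>The kernel times \<open>y\<close>, with the singularity at 0 removed. It has the
  primitive \<open>a / pi * arctan (y / a)\<close> and is the majorant for every integral
  below.\<close>

definition kernel_weight :: "real \<Rightarrow> real \<Rightarrow> real" where
  "kernel_weight a y = a\<^sup>2 / (pi * (y\<^sup>2 + a\<^sup>2))"

lemma kernel_weight_pos_le: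
  assumes "0 < a"
  shows "0 \<le> kernel_weight a y" "kernel_weight a y \<le> 1 / pi"
proof -
  have p: "0 < y\<^sup>2 + a\<^sup>2" using assms by (simp add: add_nonneg_pos)
  then show "0 \<le> kernel_weight a y" by (simp add: kernel_weight_def)
  have "a\<^sup>2 / (y\<^sup>2 + a\<^sup>2) \<le> 1" using p by simp
  then have "a\<^sup>2 / (y\<^sup>2 + a\<^sup>2) / pi \<le> 1 / pi" by (intro divide_right_mono) auto
  then show "kernel_weight a y \<le> 1 / pi" by (simp add: kernel_weight_def mult.commute)
qed

lemma kernel_eq_weight: "y \<noteq> 0 \<Longrightarrow> y * K_kernel a y = kernel_weight a y"
  by (simp add: K_kernel_def kernel_weight_def)

lemma kernel_pos: "0 < a \<Longrightarrow> 0 < y \<Longrightarrow> 0 < K_kernel a y"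
  by (simp add: K_kernel_def add_pos_pos)

lemma kernel_minus: "K_kernel a (- y) = - K_kernel a y"
  by (simp add: K_kernel_def)

lemma kernel_measurable [measurable]: "K_kernel a \<in> borel_measurable borel"
  unfolding K_kernel_def[abs_def] by measurable

lemma weight_measurable [measurable]: "kernel_weight a \<in> borel_measurable borel"
  unfolding kernel_weight_def[abs_def] by measurable

lemma weight_integrable:
  assumes a: "0 < a"
  shows "set_integrable lborel {0<..} (kernel_weight a)"
proof -
  have "(\<integral>\<^sup>+y. ennreal (kernel_weight a y) * indicator {0..} y \<partial>lborel) = ennreal (a / 2 - a / pi * arctan (0 / a))"
  proof (rule nn_integral_FTC_atLeast)
    fix y :: real
    have p: "0 < y\<^sup>2 + a\<^sup>2" using a by (simp add: add_nonneg_pos)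
    have "((\<lambda>y. a / pi * arctan (y / a)) has_real_derivative (a / pi * (inverse (1 + (y / a)\<^sup>2) * (1 / a)))) (at y)"
      by (auto intro!: derivative_eq_intros simp: a)
    moreover have "a / pi * (inverse (1 + (y / a)\<^sup>2) * (1 / a)) = kernel_weight a y"
      using a p by (simp add: kernel_weight_def field_simps power2_eq_square)
    ultimately show "((\<lambda>y. a / pi * arctan (y / a)) has_real_derivative kernel_weight a y) (at y)" by simp
  next
    have "filterlim (\<lambda>y. y / a) at_top at_top"
      using a by real_asymp
    from tendsto_mult[OF tendsto_const filterlim_compose[OF tendsto_arctan_at_top this], of "a / pi"]
    show "((\<lambda>y. a / pi * arctan (y / a)) \<longlongrightarrow> a / 2) at_top" by simp
  qed (use kernel_weight_pos_le[OF a] in auto)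
  then have fin: "(\<integral>\<^sup>+y. ennreal (kernel_weight a y) * indicator {0..} y \<partial>lborel) < \<infinity>" by simp
  have "set_integrable lborel {0..} (kernel_weight a)"
    unfolding set_integrable_def
  proof (rule integrableI_bounded)
    have "(\<integral>\<^sup>+y. ennreal (norm (indicator {0..} y *\<^sub>R kernel_weight a y)) \<partial>lborel)
       = (\<integral>\<^sup>+y. ennreal (kernel_weight a y) * indicator {0..} y \<partial>lborel)"
      by (intro nn_integral_cong) (auto simp: kernel_weight_pos_le[OF a] split: split_indicator)
    with fin show "(\<integral>\<^sup>+y. ennreal (norm (indicator {0..} y *\<^sub>R kernel_weight a y)) \<partial>lborel) < \<infinity>" by simp
  qed measurable
  then show ?thesis by (rule set_integrable_subset) auto
qed

lemma set_integrable_weight_bound: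
  fixes h :: "real \<Rightarrow> 'b::{banach, second_countable_topology}"
  assumes a: "0 < a" and meas: "h \<in> borel_measurable borel" and S: "S \<in> sets borel" "S \<subseteq> {0<..}"
    and bd: "\<And>y. y \<in> S \<Longrightarrow> norm (h y) \<le> C * kernel_weight a y"
  shows "set_integrable lborel S h"
proof (rule set_integrable_bound)
  show "set_integrable lborel S (\<lambda>y. C * kernel_weight a y)"
    using set_integrable_subset[OF weight_integrable[OF a], of S] S by (intro set_integrable_mult_right) auto
  show "set_borel_measurable lborel S h"
    unfolding set_borel_measurable_def using meas S(1) by measurable
qed (use bd in \<open>auto intro!: AE_I2 order_trans[OF _ abs_ge_self]\<close>)

lemma set_integral_near_zero:
  fixes h :: "real \<Rightarrow> real"
  assumes "set_integrable lborel {0<..<\<epsilon>} h" "\<And>y. y \<in> {0<..<\<epsilon>} \<Longrightarrow> \<bar>h y\<bar> \<le> B" "0 \<le> \<epsilon>"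
  shows "\<bar>LBINT y:{0<..<\<epsilon>}. h y\<bar> \<le> B * \<epsilon>"
proof -
  have "\<bar>LBINT y:{0<..<\<epsilon>}. h y\<bar> \<le> (LBINT y:{0<..<\<epsilon>}. norm (h y))"
    using set_integral_norm_bound[OF assms(1)] by simp
  also have "\<dots> \<le> (LBINT y:{0<..<\<epsilon>}. B)"
    using assms by (intro set_integral_mono set_integrable_norm) (auto simp: set_integrable_def)
  also have "\<dots> = B * \<epsilon>"
    using assms(3) by (subst set_integral_const) auto
  finally show ?thesis .
qed

lemma set_integral_split:
  fixes h :: "real \<Rightarrow> real"
  assumes "set_integrable lborel {0<..} h" "0 < \<epsilon>"
  shows "(LBINT y:{0<..}. h y) = (LBINT y:{0<..<\<epsilon>}. h y) + (LBINT y:{\<epsilon>..}. h y)"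
proof -
  have "{0<..} = {0<..<\<epsilon>} \<union> {\<epsilon>..}" using assms(2) by auto
  then have "(LBINT y:{0<..}. h y) = (LBINT y:{0<..<\<epsilon>} \<union> {\<epsilon>..}. h y)" by (rule arg_cong)
  also have "\<dots> = (LBINT y:{0<..<\<epsilon>}. h y) + (LBINT y:{\<epsilon>..}. h y)"
    by (intro set_integral_Un set_integrable_subset[OF assms(1)]) (use assms(2) in auto)
  finally show ?thesis .
qed

text \<open>The kernel is odd, so folding the negative half line onto the positive one leaves
  \<open>f (x - y) - f (x + y)\<close>, of size at most \<open>2 * L * y\<close>, which cancels the
  singularity. The folded integral converges absolutely and its part below \<open>\<epsilon>\<close>
  is at most \<open>2 * L / pi * \<epsilon>\<close>, so the principal value is an ordinary Lebesgue
  integral.\<close>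

theorem H_op_eq:
  assumes a: "0 < a" and cont: "continuous_on UNIV f" and B: "\<And>x. \<bar>f x\<bar> \<le> B"
    and L: "\<And>x y. \<bar>f x - f y\<bar> \<le> L * \<bar>x - y\<bar>"
  shows "H_op a f x = (LBINT y:{0<..}. (f (x - y) - f (x + y)) * K_kernel a y)"
    and "set_integrable lborel {0<..} (\<lambda>y. (f (x - y) - f (x + y)) * K_kernel a y)"
proof -
  define G where "G y = (f (x - y) - f (x + y)) * K_kernel a y" for y
  have fm [measurable]: "f \<in> borel_measurable borel" using cont by (rule borel_measurable_continuous_onI)
  have Gm: "G \<in> borel_measurable borel" unfolding G_def[abs_def] by measurable
  have G_le: "norm (G y) \<le> (2 * L) * kernel_weight a y" if y: "y \<in> {0<..}" for y
  proof -
    have "norm (G y) = \<bar>f (x - y) - f (x + y)\<bar> * K_kernel a y"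
      using kernel_pos[OF a, of y] y by (simp add: G_def abs_mult)
    also have "\<dots> \<le> (L * \<bar>(x - y) - (x + y)\<bar>) * K_kernel a y"
      using kernel_pos[OF a, of y] y by (intro mult_right_mono L) auto
    also have "\<dots> = 2 * L * (y * K_kernel a y)" using y by simp
    finally show ?thesis using kernel_eq_weight[of y a] y by simp
  qed
  show G_int: "set_integrable lborel {0<..} (\<lambda>y. (f (x - y) - f (x + y)) * K_kernel a y)"
    using set_integrable_weight_bound[OF a Gm _ order_refl G_le] by (simp add: G_def)
  have L0: "0 \<le> L" using L[of 0 1] by simp
  \<comment> \<open>At distance \<open>\<epsilon>\<close> from 0 the kernel is dominated by its
    weight over \<open>\<epsilon>\<close>, so for bounded \<open>f\<close> each half line is
    integrable separately. This identifies the gauge integral of the definition with a Lebesgue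
    integral and allows the reflection.\<close>
  have eps: "integral {y. \<epsilon> \<le> \<bar>y\<bar>} (\<lambda>y. f (x - y) * K_kernel a y) = (LBINT y:{\<epsilon>..}. G y)" if \<epsilon>: "0 < \<epsilon>" for \<epsilon>
  proof -
    let ?F = "\<lambda>y. f (x - y) * K_kernel a y" and ?F' = "\<lambda>y. f (x + y) * K_kernel a y"
    have bd: "norm (f z * K_kernel a y) \<le> (B / \<epsilon>) * kernel_weight a y" if y: "y \<in> {\<epsilon>..}" for y z
    proof -
      have "norm (f z * K_kernel a y) = \<bar>f z\<bar> * K_kernel a y"
        using kernel_pos[OF a, of y] y \<epsilon> by (simp add: abs_mult)
      also have "\<dots> \<le> B * (kernel_weight a y / \<epsilon>)"
      proof (intro mult_mono B)
        have "K_kernel a y * \<epsilon> \<le> K_kernel a y * y"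
          using kernel_pos[OF a, of y] y \<epsilon> by (intro mult_left_mono) auto
        then show "K_kernel a y \<le> kernel_weight a y / \<epsilon>"
          using kernel_eq_weight[of y a] y \<epsilon> by (simp add: field_simps)
        show "0 \<le> B" using B[of 0] by simp
      qed (use kernel_pos[OF a, of y] y \<epsilon> in auto)
      finally show ?thesis by simp
    qed
    have i1: "set_integrable lborel {\<epsilon>..} ?F" and i2: "set_integrable lborel {\<epsilon>..} ?F'"
      using \<epsilon> by (auto intro!: set_integrable_weight_bound[OF a _ _ _ bd])
    have refl: "indicator {..- \<epsilon>} (- y) *\<^sub>R ?F (- y) = - (indicator {\<epsilon>..} y *\<^sub>R ?F' y)" for y
      by (auto simp: kernel_minus split: split_indicator)
    have i3: "set_integrable lborel {..- \<epsilon>} ?F"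
    proof -
      have "integrable lborel (\<lambda>y. indicator {..- \<epsilon>} (0 + (-1) * y) *\<^sub>R ?F (0 + (-1) * y))"
        using integrable_minus[OF i2[unfolded set_integrable_def]]
        unfolding refl[symmetric] by (simp only: add_0 mult_minus1)
      then show ?thesis unfolding set_integrable_def
        by (subst (asm) lborel_integrable_real_affine_iff) auto
    qed
    have "{y. \<epsilon> \<le> \<bar>y\<bar>} = {..- \<epsilon>} \<union> {\<epsilon>..}" by auto
    then have "integral {y. \<epsilon> \<le> \<bar>y\<bar>} ?F = (LBINT y:{..- \<epsilon>} \<union> {\<epsilon>..}. ?F y)"
      using set_borel_integral_eq_integral(2)[OF set_integrable_Un[OF i3 i1]] by simp
    also have "\<dots> = (LBINT y:{..- \<epsilon>}. ?F y) + (LBINT y:{\<epsilon>..}. ?F y)"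
      using \<epsilon> by (intro set_integral_Un i1 i3) auto
    also have "(LBINT y:{..- \<epsilon>}. ?F y) = (LBINT y:{\<epsilon>..}. - ?F' y)"
    proof -
      have "(LBINT y:{..- \<epsilon>}. ?F y) = (LBINT y:{y. - y \<in> {..- \<epsilon>}}. ?F (- y))" by (rule set_integral_reflect)
      also have "{y. - y \<in> {..- \<epsilon>}} = {\<epsilon>..}" by auto
      finally show ?thesis by (simp add: kernel_minus)
    qed
    also have "(LBINT y:{\<epsilon>..}. - ?F' y) + (LBINT y:{\<epsilon>..}. ?F y) = (LBINT y:{\<epsilon>..}. - ?F' y + ?F y)"
      using set_integral_add(2)[OF _ i1, of "\<lambda>y. - ?F' y"] i2 by (simp add: set_integrable_def)
    also have "\<dots> = (LBINT y:{\<epsilon>..}. G y)" by (simp add: G_def algebra_simps)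
    finally show ?thesis .
  qed
  have "((\<lambda>\<epsilon>. LBINT y:{\<epsilon>..}. G y) \<longlongrightarrow> (LBINT y:{0<..}. G y)) (at_right 0)"
  proof (rule Lim_transform2)
    show "((\<lambda>\<epsilon>::real. LBINT y:{0<..}. G y) \<longlongrightarrow> (LBINT y:{0<..}. G y)) (at_right 0)" by simp
    show "((\<lambda>\<epsilon>. (LBINT y:{0<..}. G y) - (LBINT y:{\<epsilon>..}. G y)) \<longlongrightarrow> 0) (at_right 0)"
    proof (rule Lim_null_comparison)
      show "((\<lambda>\<epsilon>. (2 * L / pi) * \<epsilon>) \<longlongrightarrow> 0) (at_right 0)"
        by (rule tendsto_eq_rhs[OF tendsto_mult[OF tendsto_const tendsto_ident_at]]) simp
      show "\<forall>\<^sub>F \<epsilon> in at_right 0. norm ((LBINT y:{0<..}. G y) - (LBINT y:{\<epsilon>..}. G y)) \<le> (2 * L / pi) * \<epsilon>"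
        unfolding eventually_at_right_field
      proof (intro exI[of _ 1] conjI allI impI)
        fix \<epsilon> :: real assume \<epsilon>: "0 < \<epsilon>"
        have Gi: "set_integrable lborel {0<..} G" using G_int by (simp add: G_def[abs_def])
        have "\<bar>LBINT y:{0<..<\<epsilon>}. G y\<bar> \<le> (2 * L / pi) * \<epsilon>"
        proof (rule set_integral_near_zero)
          show "set_integrable lborel {0<..<\<epsilon>} G" by (rule set_integrable_subset[OF Gi]) auto
          fix y assume "y \<in> {0<..<\<epsilon>}"
          then have "\<bar>G y\<bar> \<le> 2 * L * kernel_weight a y" using G_le[of y] by simp
          also have "\<dots> \<le> 2 * L * (1 / pi)" using L0 by (intro mult_left_mono kernel_weight_pos_le[OF a]) auto
          finally show "\<bar>G y\<bar> \<le> 2 * L / pi" by simp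
        qed (use \<epsilon> in simp)
        then show "norm ((LBINT y:{0<..}. G y) - (LBINT y:{\<epsilon>..}. G y)) \<le> (2 * L / pi) * \<epsilon>"
          using set_integral_split[OF Gi \<epsilon>] by simp
      qed simp
    qed
  qed
  then have "((\<lambda>\<epsilon>. integral {y. \<epsilon> \<le> \<bar>y\<bar>} (\<lambda>y. f (x - y) * K_kernel a y)) \<longlongrightarrow> (LBINT y:{0<..}. G y)) (at_right 0)"
    by (rule Lim_transform_eventually) (auto simp: eps eventually_at_right_field intro!: exI[of _ 1])
  then show "H_op a f x = (LBINT y:{0<..}. (f (x - y) - f (x + y)) * K_kernel a y)"
    unfolding H_op_def G_def by (intro tendsto_Lim) auto
qed

text \<open>For positive \<open>k\<close> its value is \<open>(1 - exp (- a * k)) / 2\<close>, so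
  \<open>hilbert_mult\<close> is the symbol of the Hilbert transform, damped at low frequencies by
  \<open>1 - exp (- a * \<bar>k\<bar>)\<close>. The proof works with oddness and boundedness
  alone.\<close>

definition sine_coeff :: "real \<Rightarrow> int \<Rightarrow> real" where
  "sine_coeff a k = (LBINT y:{0<..}. sin (of_int k * y) * K_kernel a y)"

lemma sine_kernel_le:
  assumes a: "0 < a" and y: "0 < y"
  shows "\<bar>sin (of_int k * y) * K_kernel a y\<bar> \<le> \<bar>of_int k\<bar> * kernel_weight a y"
proof -
  have "\<bar>sin (of_int k * y) * K_kernel a y\<bar> \<le> \<bar>of_int k * y\<bar> * K_kernel a y"
    unfolding abs_mult[of "sin _"] using kernel_pos[OF a y]
    by (intro mult_mono abs_sin_x_le_abs_x) auto
  also have "\<dots> = \<bar>of_int k\<bar> * (y * K_kernel a y)" using y by (simp add: abs_mult)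
  finally show ?thesis using kernel_eq_weight[of y a] y by simp
qed

lemma sine_kernel_integrable:
  assumes a: "0 < a"
  shows "set_integrable lborel {0<..} (\<lambda>y. sin (of_int k * y) * K_kernel a y)"
  by (rule set_integrable_weight_bound[OF a, where C = "\<bar>of_int k\<bar>"])
    (use sine_kernel_le[OF a] in auto)

lemma sine_coeff_minus: "sine_coeff a (- k) = - sine_coeff a k"
  unfolding sine_coeff_def by (simp add: set_lebesgue_integral_def)

lemma kernel_derivative:
  assumes a: "0 < a" and y: "0 < y"
  shows "\<exists>D\<le>0. (K_kernel a has_real_derivative D) (at y)"
proof (intro exI conjI)
  have p: "0 < pi * y * (y\<^sup>2 + a\<^sup>2)" using a y by (simp add: add_pos_pos)
  have eq: "K_kernel a = (\<lambda>y. a\<^sup>2 * inverse (pi * y * (y\<^sup>2 + a\<^sup>2)))"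
    by (auto simp: K_kernel_def divide_inverse)
  let ?d = "pi * (y\<^sup>2 + a\<^sup>2) + pi * y * (2 * y)"
  have "((\<lambda>y. pi * y * (y\<^sup>2 + a\<^sup>2)) has_real_derivative ?d) (at y)"
    by (auto intro!: derivative_eq_intros)
  moreover have "pi * y * (y\<^sup>2 + a\<^sup>2) \<noteq> 0" using p less_irrefl by metis
  ultimately show "(K_kernel a has_real_derivative (a\<^sup>2 * - (inverse (pi * y * (y\<^sup>2 + a\<^sup>2)) * ?d * inverse (pi * y * (y\<^sup>2 + a\<^sup>2))))) (at y)"
    unfolding eq by (intro DERIV_cmult DERIV_inverse')
  have "0 \<le> inverse (pi * y * (y\<^sup>2 + a\<^sup>2)) * ?d * inverse (pi * y * (y\<^sup>2 + a\<^sup>2))"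
    using p y by (intro mult_nonneg_nonneg inverse_nonnegative_iff_nonnegative[THEN iffD2]) auto
  then show "a\<^sup>2 * - (inverse (pi * y * (y\<^sup>2 + a\<^sup>2)) * ?d * inverse (pi * y * (y\<^sup>2 + a\<^sup>2))) \<le> 0"
    unfolding mult_minus_right neg_le_0_iff_le by (intro mult_nonneg_nonneg[OF zero_le_power2])
qed

text \<open>Below \<open>1 / k\<close> the sine is estimated by its argument; above it, one integration by parts exploits
  that the kernel is decreasing.\<close>
lemma sine_coeff_bound_pos:
  assumes a: "0 < a" and k: "0 < k"
  shows "\<bar>sine_coeff a k\<bar> \<le> 3 / pi"
proof -
  define \<kappa> where "\<kappa> = real_of_int k"
  define \<delta> where "\<delta> = 1 / \<kappa>"
  have \<kappa>: "0 < \<kappa>" and \<delta>: "0 < \<delta>" using k by (auto simp: \<kappa>_def \<delta>_def)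
  let ?h = "\<lambda>y. sin (\<kappa> * y) * K_kernel a y"
  have hi: "set_integrable lborel {0<..} ?h" unfolding \<kappa>_def by (rule sine_kernel_integrable[OF a])
  have near: "\<bar>LBINT y:{0<..<\<delta>}. ?h y\<bar> \<le> (\<kappa> / pi) * \<delta>"
  proof (rule set_integral_near_zero)
    show "set_integrable lborel {0<..<\<delta>} ?h" by (rule set_integrable_subset[OF hi]) auto
    fix y assume "y \<in> {0<..<\<delta>}"
    then have "\<bar>?h y\<bar> \<le> \<kappa> * kernel_weight a y" using sine_kernel_le[OF a, of y k] k by (simp add: \<kappa>_def)
    also have "\<dots> \<le> \<kappa> * (1 / pi)" using \<kappa> by (intro mult_left_mono kernel_weight_pos_le[OF a]) auto
    finally show "\<bar>?h y\<bar> \<le> \<kappa> / pi" by simp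
  qed (use \<delta> in simp)
  have far: "\<bar>LBINT y:{\<delta>..r}. ?h y\<bar> \<le> 2 / pi" if r: "\<delta> \<le> r" for r
  proof -
    have "\<forall>y. \<exists>D. 0 < y \<longrightarrow> D \<le> 0 \<and> (K_kernel a has_real_derivative D) (at y)"
      using kernel_derivative[OF a] by blast
    then obtain K' where K': "\<And>y. 0 < y \<Longrightarrow> K' y \<le> 0" "\<And>y. 0 < y \<Longrightarrow> (K_kernel a has_real_derivative K' y) (at y)"
      by metis
    \<comment> \<open>The case \<open>s = 0\<close> is the boundary term of the integration by
      parts. With \<open>s = 1\<close> or \<open>s = - 1\<close> the leftover factor
      \<open>cos (\<kappa> * y) + s\<close> has a fixed sign, and as \<open>K'\<close> is
      nonpositive, \<open>P' 1\<close> majorises and \<open>P' (- 1)\<close> minorises the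
      integrand; no integral of \<open>K'\<close> has to be estimated.\<close>
    define P where "P s y = - cos (\<kappa> * y) * K_kernel a y / \<kappa> - s * K_kernel a y / \<kappa>" for s y :: real
    have P_eq: "P s y = - (cos (\<kappa> * y) * K_kernel a y / \<kappa>) - s * (K_kernel a y / \<kappa>)" for s y
      by (simp add: P_def)
    define P' where "P' s y = ?h y - (cos (\<kappa> * y) + s) * K' y / \<kappa>" for s y :: real
    have FTC: "(P' s has_integral (P s r - P s \<delta>)) {\<delta>..r}" for s
    proof (rule fundamental_theorem_of_calculus[OF r])
      fix y assume y: "y \<in> {\<delta>..r}"
      then have y0: "0 < y" using \<delta> by auto
      have "(P s has_real_derivative P' s y) (at y within {\<delta>..r})"
        unfolding P_def P'_def using \<kappa>
        by (auto intro!: derivative_eq_intros DERIV_subset[OF K'(2)[OF y0]] simp: field_simps)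
      then show "(P s has_vector_derivative P' s y) (at y within {\<delta>..r})"
        by (simp add: has_real_derivative_iff_has_vector_derivative)
    qed
    have hir: "set_integrable lborel {\<delta>..r} ?h" by (rule set_integrable_subset[OF hi]) (use \<delta> in auto)
    have hh: "(?h has_integral (LBINT y:{\<delta>..r}. ?h y)) {\<delta>..r}"
      using set_borel_integral_eq_integral[OF hir] by (simp add: has_integral_integral)
    have Kr: "0 < K_kernel a r" "0 < K_kernel a \<delta>" using kernel_pos[OF a] r \<delta> by auto
    \<comment> \<open>Here the choice \<open>\<delta> = 1 / \<kappa>\<close> enters: the left side
      is \<open>\<delta> * K_kernel a \<delta>\<close>, which \<open>kernel_weight\<close> bounds
      independently of \<open>k\<close> and \<open>a\<close>.\<close>
    have K\<delta>: "K_kernel a \<delta> / \<kappa> \<le> 1 / pi"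
      using kernel_eq_weight[of \<delta> a] kernel_weight_pos_le(2)[OF a, of \<delta>] \<delta> by (simp add: \<delta>_def)
    have term_le: "\<bar>cos (\<kappa> * y) * K_kernel a y / \<kappa>\<bar> \<le> K_kernel a y / \<kappa>" if "0 < K_kernel a y" for y
    proof -
      have "\<bar>cos (\<kappa> * y)\<bar> * K_kernel a y \<le> 1 * K_kernel a y" using that by (intro mult_right_mono) auto
      then show ?thesis using that \<kappa> by (simp add: abs_mult abs_divide divide_right_mono)
    qed
    have "(LBINT y:{\<delta>..r}. ?h y) \<le> P 1 r - P 1 \<delta>"
    proof (rule has_integral_le[OF hh FTC])
      fix y assume "y \<in> {\<delta>..r}"
      then have "0 < y" using \<delta> by auto
      moreover have "0 \<le> cos (\<kappa> * y) + 1" using cos_ge_minus_one[of "\<kappa> * y"] by linarith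
      ultimately have "(cos (\<kappa> * y) + 1) * K' y / \<kappa> \<le> 0"
        using K'(1)[of y] \<kappa> by (intro divide_nonpos_pos mult_nonneg_nonpos) auto
      then show "?h y \<le> P' 1 y" by (simp add: P'_def)
    qed
    also have "\<dots> \<le> 2 / pi"
      using term_le[OF Kr(1)] term_le[OF Kr(2)] K\<delta> unfolding P_eq by linarith
    finally have up: "(LBINT y:{\<delta>..r}. ?h y) \<le> 2 / pi" .
    have "P (-1) r - P (-1) \<delta> \<le> (LBINT y:{\<delta>..r}. ?h y)"
    proof (rule has_integral_le[OF FTC hh])
      fix y assume "y \<in> {\<delta>..r}"
      then have "0 < y" using \<delta> by auto
      moreover have "cos (\<kappa> * y) + - 1 \<le> 0" using cos_le_one[of "\<kappa> * y"] by simp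
      ultimately have "0 \<le> (cos (\<kappa> * y) + - 1) * K' y / \<kappa>"
        using K'(1)[of y] \<kappa> by (intro divide_nonneg_pos mult_nonpos_nonpos) auto
      then show "P' (-1) y \<le> ?h y" by (simp add: P'_def)
    qed
    moreover have "- (2 / pi) \<le> P (-1) r - P (-1) \<delta>"
      using term_le[OF Kr(1)] term_le[OF Kr(2)] K\<delta> unfolding P_eq by linarith
    ultimately show ?thesis using up by simp
  qed
  have "((\<lambda>r. LBINT y:{\<delta>..r}. ?h y) \<longlongrightarrow> (LBINT y:{\<delta>..}. ?h y)) at_top"
    by (intro tendsto_set_lebesgue_integral_at_top set_integrable_subset[OF hi]) (use \<delta> in auto)
  then have "\<bar>LBINT y:{\<delta>..}. ?h y\<bar> \<le> 2 / pi"
    by (intro tendsto_upperbound[OF tendsto_rabs]) (auto intro!: eventually_at_top_linorderI[of \<delta>] far)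
  moreover have "sine_coeff a k = (LBINT y:{0<..<\<delta>}. ?h y) + (LBINT y:{\<delta>..}. ?h y)"
    unfolding sine_coeff_def using set_integral_split[OF hi \<delta>] by (simp add: \<kappa>_def)
  moreover have "(\<kappa> / pi) * \<delta> = 1 / pi" using \<kappa> by (simp add: \<delta>_def)
  ultimately show ?thesis using near by (simp add: abs_le_iff)
qed

definition hilbert_mult :: "real \<Rightarrow> int \<Rightarrow> complex" where
  "hilbert_mult a k = - 2 * \<i> * of_real (sine_coeff a k)"

lemma hilbert_mult_cnj: "hilbert_mult a (- k) = cnj (hilbert_mult a k)"
  by (simp add: hilbert_mult_def sine_coeff_minus)

lemma hilbert_mult_bound:
  assumes "0 < a"
  shows "norm (hilbert_mult a k) \<le> 2"
proof -
  have "\<bar>sine_coeff a k\<bar> \<le> 3 / pi"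
  proof (cases k "0::int" rule: linorder_cases)
    case less
    then show ?thesis using sine_coeff_bound_pos[OF assms, of "- k"] by (simp add: sine_coeff_minus)
  next
    case equal
    then show ?thesis using sine_coeff_minus[of a 0] by simp
  next
    case greater
    then show ?thesis by (rule sine_coeff_bound_pos[OF assms])
  qed
  also have "\<dots> \<le> 1" using pi_gt3 by simp
  finally show ?thesis by (simp add: hilbert_mult_def norm_mult)
qed

text \<open>In the folded integral the difference of the shifted waves is \<open>wave l x\<close>
  times \<open>- 2 * \<i> * sin (l * y)\<close>, and the sine supplies the factor \<open>y\<close>
  that the kernel needs. This costs a factor \<open>\<bar>l\<bar>\<close>, which the third power of
  decay absorbs, so sum and integral may be exchanged.\<close>

theorem H_op_series:
  assumes a: "0 < a" and d: "\<And>l. norm (d l) \<le> C / jb l ^ 3"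
    and f: "\<And>x. complex_of_real (f x) = (\<Sum>\<^sub>\<infinity>l. d l * wave l x)"
  shows "complex_of_real (H_op a f x) = (\<Sum>\<^sub>\<infinity>l. (hilbert_mult a l * d l) * wave l x)"
proof -
  have d2: "norm (d l) \<le> C / jb l ^ 2" for l by (rule decay_weaken[OF d]) simp
  have ld: "\<bar>real_of_int l\<bar> * norm (d l) \<le> C / jb l ^ 2" for l
  proof -
    have "\<bar>real_of_int l\<bar> * norm (d l) \<le> jb l * (C / jb l ^ 3)" by (intro mult_mono d abs_le_jb) auto
    then show ?thesis by (simp add: power3_eq_cube power2_eq_square)
  qed
  have fder: "((\<lambda>x. complex_of_real (f x)) has_vector_derivative (\<Sum>\<^sub>\<infinity>l. \<i> * of_int l * d l * wave l x)) (at x)" for x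
    unfolding f by (rule series_has_vector_derivative[OF d])
  have cont: "continuous_on UNIV f"
  proof -
    have "continuous_on UNIV (\<lambda>x. complex_of_real (f x))" unfolding f by (rule series_continuous[OF d])
    from continuous_on_Re[OF this] show ?thesis by simp
  qed
  have B: "\<bar>f x\<bar> \<le> C * jsum" for x
  proof -
    have "norm (\<Sum>\<^sub>\<infinity>l. d l * wave l x) \<le> C * jsum"
      by (rule infsum_jb_bound(2)) (use d2 in \<open>simp add: norm_mult\<close>)
    then show ?thesis unfolding f[symmetric] by simp
  qed
  have L: "\<bar>f x - f y\<bar> \<le> (C * jsum) * \<bar>x - y\<bar>" for x y
  proof -
    have "norm (complex_of_real (f x) - complex_of_real (f y)) \<le> (C * jsum) * norm (x - y)"
    proof (rule differentiable_bound[of UNIV "\<lambda>x. complex_of_real (f x)"])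
      show "((\<lambda>x. complex_of_real (f x)) has_derivative (\<lambda>h. h *\<^sub>R (\<Sum>\<^sub>\<infinity>l. \<i> * of_int l * d l * wave l x))) (at x within UNIV)" for x
        using fder[of x] by (simp add: has_vector_derivative_def)
      show "onorm (\<lambda>h. h *\<^sub>R (\<Sum>\<^sub>\<infinity>l. \<i> * of_int l * d l * wave l x)) \<le> C * jsum" for x
      proof (rule onorm_le)
        fix h :: real
        have "norm (\<Sum>\<^sub>\<infinity>l. \<i> * of_int l * d l * wave l x) \<le> C * jsum"
          by (rule infsum_jb_bound(2)) (use ld in \<open>simp add: norm_mult\<close>)
        then have "\<bar>h\<bar> * norm (\<Sum>\<^sub>\<infinity>l. \<i> * of_int l * d l * wave l x) \<le> \<bar>h\<bar> * (C * jsum)"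
          by (intro mult_left_mono) auto
        then show "norm (h *\<^sub>R (\<Sum>\<^sub>\<infinity>l. \<i> * of_int l * d l * wave l x)) \<le> C * jsum * norm h"
          by (simp only: norm_scaleR real_norm_def mult.commute)
      qed
    qed auto
    then show ?thesis by (metis norm_of_real of_real_diff real_norm_def)
  qed
  note H = H_op_eq[OF a cont B L]
  define W where "W y = 2 * (indicator {0<..} y * kernel_weight a y)" for y :: real
  have W: "integrable lborel W"
    unfolding W_def using weight_integrable[OF a] by (intro integrable_mult_right) (simp add: set_integrable_def)
  define h where "h l y = indicator {0<..} y *\<^sub>R ((d l * wave l x) * (- 2 * \<i> * of_real (sin (of_int l * y) * K_kernel a y)))"
    for l and y :: real
  have hm: "h l \<in> borel_measurable lborel" for l
    unfolding h_def[abs_def] by measurable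
  have hW: "norm (h l y) \<le> C / jb l ^ 2 * W y" for l y
  proof (cases "0 < y")
    case True
    have "norm (h l y) = norm (d l) * (2 * \<bar>sin (of_int l * y) * K_kernel a y\<bar>)"
      using True by (simp add: h_def norm_mult abs_mult)
    also have "\<dots> \<le> norm (d l) * (2 * (\<bar>real_of_int l\<bar> * kernel_weight a y))"
      by (intro mult_left_mono sine_kernel_le[OF a True]) auto
    also have "\<dots> = (\<bar>real_of_int l\<bar> * norm (d l)) * W y" using True by (simp add: W_def)
    also have "\<dots> \<le> C / jb l ^ 2 * W y"
      using ld[of l] kernel_weight_pos_le[OF a, of y] by (intro mult_right_mono) (auto simp: W_def)
    finally show ?thesis .
  qed (simp add: h_def W_def)
  have point: "indicator {0<..} y *\<^sub>R complex_of_real ((f (x - y) - f (x + y)) * K_kernel a y) = (\<Sum>\<^sub>\<infinity>l. h l y)" for y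
  proof -
    have s: "(\<lambda>l. d l * wave l z) summable_on UNIV" for z
      by (rule infsum_jb_bound(1)) (use d2 in \<open>simp add: norm_mult\<close>)
    have wv: "wave l (x - y) - wave l (x + y) = wave l x * (- 2 * \<i> * of_real (sin (of_int l * y)))" for l
    proof -
      have "wave l (x - y) = wave l x * wave l (- y)" using wave_plus[of l x "- y"] by simp
      moreover have "wave l (- y) - wave l y = - 2 * \<i> * of_real (sin (of_int l * y))"
        by (simp add: wave_def complex_eq_iff)
      ultimately show ?thesis by (simp only: wave_plus right_diff_distrib[symmetric])
    qed
    have "complex_of_real (f (x - y) - f (x + y)) = (\<Sum>\<^sub>\<infinity>l. d l * wave l (x - y) - d l * wave l (x + y))"
      unfolding of_real_diff f by (rule infsum_difference[OF s s, symmetric])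
    also have "\<dots> = (\<Sum>\<^sub>\<infinity>l. d l * wave l x * (- 2 * \<i> * of_real (sin (of_int l * y))))"
      by (rule infsum_cong) (simp only: right_diff_distrib[symmetric] wv mult.assoc)
    finally have pe: "complex_of_real (f (x - y) - f (x + y)) = (\<Sum>\<^sub>\<infinity>l. d l * wave l x * (- 2 * \<i> * of_real (sin (of_int l * y))))" .
    have "indicator {0<..} y *\<^sub>R complex_of_real ((f (x - y) - f (x + y)) * K_kernel a y)
      = (of_real (indicator {0<..} y) * of_real (K_kernel a y)) * (\<Sum>\<^sub>\<infinity>l. d l * wave l x * (- 2 * \<i> * of_real (sin (of_int l * y))))"
      unfolding pe[symmetric] scaleR_conv_of_real of_real_mult by (simp only: mult_ac)
    also have "\<dots> = (\<Sum>\<^sub>\<infinity>l. h l y)"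
      unfolding infsum_cmult_right'[symmetric] by (intro infsum_cong) (simp add: h_def scaleR_conv_of_real)
    finally show ?thesis .
  qed
  have "complex_of_real (H_op a f x) = (\<integral>y. complex_of_real (indicator {0<..} y *\<^sub>R ((f (x - y) - f (x + y)) * K_kernel a y)) \<partial>lborel)"
    unfolding H(1) set_lebesgue_integral_def by (rule integral_complex_of_real[symmetric])
  also have "\<dots> = (\<integral>y. (\<Sum>\<^sub>\<infinity>l. h l y) \<partial>lborel)"
    unfolding point[symmetric] by (simp add: scaleR_conv_of_real)
  also have "\<dots> = (\<Sum>\<^sub>\<infinity>l. \<integral>y. h l y \<partial>lborel)" by (rule integral_infsum(2)[OF W hm hW])
  also have "\<dots> = (\<Sum>\<^sub>\<infinity>l. (hilbert_mult a l * d l) * wave l x)"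
  proof (rule infsum_cong)
    fix l
    have "(\<integral>y. h l y \<partial>lborel) = (\<integral>y. (- 2 * \<i> * d l * wave l x) * complex_of_real (indicator {0<..} y *\<^sub>R (sin (of_int l * y) * K_kernel a y)) \<partial>lborel)"
      unfolding h_def by (intro Bochner_Integration.integral_cong) (auto simp: scaleR_conv_of_real)
    also have "\<dots> = (- 2 * \<i> * d l * wave l x) * of_real (sine_coeff a l)"
      unfolding sine_coeff_def set_lebesgue_integral_def
      by (simp only: integral_mult_right_zero integral_complex_of_real)
    finally show "(\<integral>y. h l y \<partial>lborel) = (hilbert_mult a l * d l) * wave l x"
      by (simp add: hilbert_mult_def)
  qed
  finally show ?thesis .
qed

section \<open>Joint smoothness\<close>

context multiplier begin

definition rapid_on :: "real \<Rightarrow> (real \<Rightarrow> int \<Rightarrow> complex) \<Rightarrow> bool" where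
  "rapid_on T b \<longleftrightarrow> (\<forall>s. \<exists>C. \<forall>t\<in>{0..T}. \<forall>k. norm (b t k) \<le> C / jb k ^ s)"

lemma rapid_onE:
  assumes "rapid_on T b"
  obtains C where "\<And>t k. t \<in> {0..T} \<Longrightarrow> norm (b t k) \<le> C / jb k ^ s"
  using assms unfolding rapid_on_def by blast

lemma rapid_onI: "(\<And>s. \<exists>C. \<forall>t\<in>{0..T}. \<forall>k. norm (b t k) \<le> C / jb k ^ s) \<Longrightarrow> rapid_on T b"
  by (simp add: rapid_on_def)

lemma rapid_on_freq:
  assumes "rapid_on T b"
  shows "rapid_on T (\<lambda>t k. \<i> * of_int k * b t k)"
proof (rule rapid_onI)
  fix s
  obtain C where "\<And>t k. t \<in> {0..T} \<Longrightarrow> norm (b t k) \<le> C / jb k ^ Suc s" using rapid_onE[OF assms] by blast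
  then show "\<exists>C. \<forall>t\<in>{0..T}. \<forall>k. norm (\<i> * of_int k * b t k) \<le> C / jb k ^ s" using freq_decay by blast
qed

lemma rapid_on_add:
  assumes "rapid_on T a" "rapid_on T b"
  shows "rapid_on T (\<lambda>t k. a t k + b t k)"
proof (rule rapid_onI)
  fix s
  obtain C where C: "\<And>t k. t \<in> {0..T} \<Longrightarrow> norm (a t k) \<le> C / jb k ^ s" using rapid_onE[OF assms(1)] by blast
  obtain D where D: "\<And>t k. t \<in> {0..T} \<Longrightarrow> norm (b t k) \<le> D / jb k ^ s" using rapid_onE[OF assms(2)] by blast
  have "norm (a t k + b t k) \<le> (C + D) / jb k ^ s" if "t \<in> {0..T}" for t k
    using norm_triangle_mono[OF C[OF that] D[OF that]] by (simp add: add_divide_distrib)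
  then show "\<exists>C. \<forall>t\<in>{0..T}. \<forall>k. norm (a t k + b t k) \<le> C / jb k ^ s" by blast
qed

lemma rapid_on_adv:
  assumes "rapid_on T a" "rapid_on T b"
  shows "rapid_on T (\<lambda>t. adv (vel q (a t)) (b t))"
proof (rule rapid_onI)
  fix s
  obtain C where C: "\<And>t k. t \<in> {0..T} \<Longrightarrow> norm (a t k) \<le> C / jb k ^ s" using rapid_onE[OF assms(1)] by blast
  obtain D where D: "\<And>t k. t \<in> {0..T} \<Longrightarrow> norm (b t k) \<le> D / jb k ^ (s + 3)" using rapid_onE[OF assms(2)] by blast
  have "norm (adv (vel q (a t)) (b t) k) \<le> (Q * C * D * jsum) / jb k ^ s" if t: "t \<in> {0..T}" for t k
    by (rule advection_decay(2)[OF vel_decay[OF q_bound C[OF t]] D[OF t]])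
  then show "\<exists>C. \<forall>t\<in>{0..T}. \<forall>k. norm (adv (vel q (a t)) (b t) k) \<le> C / jb k ^ s" by blast
qed

lemma vel_has_vector_derivative:
  assumes "\<And>k. ((\<lambda>t. a t k) has_vector_derivative a' k) (at t within S)"
  shows "((\<lambda>t. vel q (a t) j) has_vector_derivative vel q a' j) (at t within S)"
  unfolding vel_def
  by (intro has_vector_derivative_mult_right has_vector_derivative_divide has_vector_derivative_add has_vector_derivative_cnj assms)

lemma adv_has_vector_derivative:
  assumes rap: "rapid_on T a" "rapid_on T a'" "rapid_on T b" "rapid_on T b'"
    and a: "\<And>t k. t \<in> {0..T} \<Longrightarrow> ((\<lambda>t. a t k) has_vector_derivative a' t k) (at t within {0..T})"
    and b: "\<And>t k. t \<in> {0..T} \<Longrightarrow> ((\<lambda>t. b t k) has_vector_derivative b' t k) (at t within {0..T})"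
    and t: "t \<in> {0..T}"
  shows "((\<lambda>t. adv (vel q (a t)) (b t) k) has_vector_derivative
    (adv (vel q (a' t)) (b t) k + adv (vel q (a t)) (b' t) k)) (at t within {0..T})"
proof -
  obtain A where A: "\<And>t k. t \<in> {0..T} \<Longrightarrow> norm (a t k) \<le> A / jb k ^ 0" using rapid_onE[OF rap(1)] by blast
  obtain A' where A': "\<And>t k. t \<in> {0..T} \<Longrightarrow> norm (a' t k) \<le> A' / jb k ^ 0" using rapid_onE[OF rap(2)] by blast
  obtain B where B: "\<And>t k. t \<in> {0..T} \<Longrightarrow> norm (b t k) \<le> B / jb k ^ (0 + 3)" using rapid_onE[OF rap(3)] by blast
  obtain B' where B': "\<And>t k. t \<in> {0..T} \<Longrightarrow> norm (b' t k) \<le> B' / jb k ^ (0 + 3)" using rapid_onE[OF rap(4)] by blast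
  define X where "X t l = vel q (a t) (k - l) * (\<i> * of_int l) * b t l" for t l
  define Y where "Y t l = vel q (a' t) (k - l) * (\<i> * of_int l) * b t l" for t l
  define Z where "Z t l = vel q (a t) (k - l) * (\<i> * of_int l) * b' t l" for t l
  have va: "norm (vel q (a t) j) \<le> (Q * A) / jb j ^ 0" and va': "norm (vel q (a' t) j) \<le> (Q * A') / jb j ^ 0"
    if "t \<in> {0..T}" for t j
    by (rule vel_decay[OF q_bound], rule A[OF that]) (rule vel_decay[OF q_bound], rule A'[OF that])
  have X: "norm (X t l) \<le> (Q * A * B) / jb l ^ 2" if t: "t \<in> {0..T}" for t l
  proof -
    have "norm (X t l) \<le> (Q * A * B / jb k ^ 0) / jb l ^ 2"
      unfolding X_def by (rule advection_term_decay) (rule va[OF t], rule B[OF t])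
    then show ?thesis by simp
  qed
  have Y: "norm (Y t l) \<le> (Q * A' * B) / jb l ^ 2" if t: "t \<in> {0..T}" for t l
  proof -
    have "norm (Y t l) \<le> (Q * A' * B / jb k ^ 0) / jb l ^ 2"
      unfolding Y_def by (rule advection_term_decay) (rule va'[OF t], rule B[OF t])
    then show ?thesis by simp
  qed
  have Z: "norm (Z t l) \<le> (Q * A * B') / jb l ^ 2" if t: "t \<in> {0..T}" for t l
  proof -
    have "norm (Z t l) \<le> (Q * A * B' / jb k ^ 0) / jb l ^ 2"
      unfolding Z_def by (rule advection_term_decay) (rule va[OF t], rule B'[OF t])
    then show ?thesis by simp
  qed
  have YZ: "norm (Y t l + Z t l) \<le> (Q * A' * B + Q * A * B') / jb l ^ 2" if "t \<in> {0..T}" for t l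
    using norm_triangle_mono[OF Y[OF that] Z[OF that]] by (simp add: add_divide_distrib)
  \<comment> \<open>A single constant has to dominate the terms as well as their
    derivatives.\<close>
  define D where "D = max (Q * A * B) (Q * A' * B + Q * A * B')"
  have D: "norm (X t l) \<le> D / jb l ^ 2" "norm (Y t l + Z t l) \<le> D / jb l ^ 2" if "t \<in> {0..T}" for t l
    by (rule order_trans[OF X[OF that]], intro divide_right_mono, auto simp: D_def)
      (rule order_trans[OF YZ[OF that]], intro divide_right_mono, auto simp: D_def)
  have "((\<lambda>t. \<Sum>\<^sub>\<infinity>l. X t l) has_derivative (\<lambda>h. \<Sum>\<^sub>\<infinity>l. h *\<^sub>R (Y t l + Z t l))) (at t within {0..T})"
  proof (rule has_derivative_infsum[where D = D])
    show "((\<lambda>t. X t l) has_derivative (\<lambda>h. h *\<^sub>R (Y t l + Z t l))) (at t within {0..T})" if t: "t \<in> {0..T}" for l t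
    proof -
      have "((\<lambda>t. vel q (a t) (k - l) * (\<i> * of_int l)) has_vector_derivative vel q (a' t) (k - l) * (\<i> * of_int l)) (at t within {0..T})"
        by (intro has_vector_derivative_mult_left vel_has_vector_derivative a t)
      from has_vector_derivative_mult[OF this b[OF t, of l]]
      show ?thesis by (simp add: X_def Y_def Z_def has_vector_derivative_def add.commute)
    qed
    show "norm (h *\<^sub>R (Y t l + Z t l)) \<le> D / jb l ^ 2 * norm h" if "t \<in> {0..T}" for l t and h :: real
      using mult_left_mono[OF D(2)[OF that, of l] abs_ge_zero[of h]] by (simp add: mult.commute)
  qed (use D t in auto)
  moreover have "(\<Sum>\<^sub>\<infinity>l. h *\<^sub>R (Y t l + Z t l)) = h *\<^sub>R ((\<Sum>\<^sub>\<infinity>l. Y t l) + (\<Sum>\<^sub>\<infinity>l. Z t l))" for h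
    unfolding scaleR_conv_of_real infsum_add[OF infsum_jb_bound(1)[OF Y[OF t]] infsum_jb_bound(1)[OF Z[OF t]], symmetric]
    by (rule infsum_cmult_right')
  ultimately show ?thesis by (simp add: has_vector_derivative_def adv_def X_def Y_def Z_def)
qed

end

text \<open>The coinduction invariant for joint smoothness. \<open>dx\<close> is the derivative in
  space, \<open>adv\<close> is there because it is the time derivative of \<open>c\<close>, and
  \<open>add\<close> because the product rule for \<open>adv\<close> yields two terms.\<close>

inductive generated :: "(int \<Rightarrow> complex) \<Rightarrow> (real \<Rightarrow> int \<Rightarrow> complex) \<Rightarrow> (real \<Rightarrow> int \<Rightarrow> complex) \<Rightarrow> bool"
  for q c where
  base: "generated q c c"
| dx: "generated q c b \<Longrightarrow> generated q c (\<lambda>t k. \<i> * of_int k * b t k)"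
| add: "generated q c a \<Longrightarrow> generated q c b \<Longrightarrow> generated q c (\<lambda>t k. a t k + b t k)"
| adv: "generated q c a \<Longrightarrow> generated q c b \<Longrightarrow> generated q c (\<lambda>t. adv (vel q (a t)) (b t))"

locale fourier_flow = multiplier +
  fixes T :: real and c :: "real \<Rightarrow> int \<Rightarrow> complex"
  assumes T: "0 < T" and c_rapid: "rapid_on T c"
    and c_ode: "t \<in> {0..T} \<Longrightarrow> ((\<lambda>t. c t k) has_vector_derivative adv (vel q (c t)) (c t) k) (at t within {0..T})"
begin

text \<open>Differentiating a generated family in time stays inside the class, because the equation expresses
  the time derivative of \<open>c\<close> by the advection form.\<close>
lemma generated_time_derivative:
  assumes "generated q c b"
  shows "rapid_on T b \<and> (\<exists>b'. generated q c b' \<and> rapid_on T b' \<and>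
    (\<forall>t\<in>{0..T}. \<forall>k. ((\<lambda>t. b t k) has_vector_derivative b' t k) (at t within {0..T})))"
  using assms
proof (induction rule: generated.induct)
  case base
  show ?case
    by (intro conjI exI[of _ "\<lambda>t. adv (vel q (c t)) (c t)"] ballI allI
        c_rapid c_ode rapid_on_adv generated.adv generated.base)
next
  case (dx b)
  then obtain b' where b': "generated q c b'" "rapid_on T b'"
    "\<And>t k. t \<in> {0..T} \<Longrightarrow> ((\<lambda>t. b t k) has_vector_derivative b' t k) (at t within {0..T})" by blast
  have "rapid_on T b" using dx.IH by blast
  then show ?case
    by (intro conjI exI[of _ "\<lambda>t k. \<i> * of_int k * b' t k"] ballI allI
        rapid_on_freq generated.dx has_vector_derivative_mult_right b')
next
  case (add a b)
  then obtain a' where a': "generated q c a'" "rapid_on T a'"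
    "\<And>t k. t \<in> {0..T} \<Longrightarrow> ((\<lambda>t. a t k) has_vector_derivative a' t k) (at t within {0..T})" by blast
  from add obtain b' where b': "generated q c b'" "rapid_on T b'"
    "\<And>t k. t \<in> {0..T} \<Longrightarrow> ((\<lambda>t. b t k) has_vector_derivative b' t k) (at t within {0..T})" by blast
  have "rapid_on T a" "rapid_on T b" using add.IH by auto
  then show ?case
    by (intro conjI exI[of _ "\<lambda>t k. a' t k + b' t k"] ballI allI
        rapid_on_add generated.add has_vector_derivative_add a' b')
next
  case (adv a b)
  then obtain a' where a': "generated q c a'" "rapid_on T a'"
    "\<And>t k. t \<in> {0..T} \<Longrightarrow> ((\<lambda>t. a t k) has_vector_derivative a' t k) (at t within {0..T})" by blast
  from adv obtain b' where b': "generated q c b'" "rapid_on T b'"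
    "\<And>t k. t \<in> {0..T} \<Longrightarrow> ((\<lambda>t. b t k) has_vector_derivative b' t k) (at t within {0..T})" by blast
  have ra: "rapid_on T a" and rb: "rapid_on T b" using adv.IH by auto
  have "generated q c (\<lambda>t k. adv (vel q (a' t)) (b t) k + adv (vel q (a t)) (b' t) k)"
    by (intro generated.add generated.adv a' b' adv.hyps)
  moreover have "rapid_on T (\<lambda>t k. adv (vel q (a' t)) (b t) k + adv (vel q (a t)) (b' t) k)"
    by (intro rapid_on_add rapid_on_adv a' b' ra rb)
  ultimately show ?case
    by (intro conjI exI[of _ "\<lambda>t k. adv (vel q (a' t)) (b t) k + adv (vel q (a t)) (b' t) k"] ballI allI
        rapid_on_adv ra rb adv_has_vector_derivative a' b')
qed

definition evolve :: "(real \<Rightarrow> int \<Rightarrow> complex) \<Rightarrow> real \<times> real \<Rightarrow> complex" where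
  "evolve b p = (\<Sum>\<^sub>\<infinity>k. b (snd p) k * wave k (fst p))"

text \<open>Each term is a function of time multiplied by a wave in space, so the product rule gives
  its total derivative; one more power of decay is drawn from \<open>b\<close> than from
  \<open>b'\<close>, to absorb the frequency.\<close>

lemma evolve_has_derivative:
  assumes rb: "rapid_on T b" and rb': "rapid_on T b'"
    and der: "\<And>t k. t \<in> {0..T} \<Longrightarrow> ((\<lambda>t. b t k) has_vector_derivative b' t k) (at t within {0..T})"
    and p: "p \<in> UNIV \<times> {0..<T}"
  shows "(evolve b has_derivative (\<lambda>h. fst h *\<^sub>R evolve (\<lambda>t k. \<i> * of_int k * b t k) p + snd h *\<^sub>R evolve b' p))
    (at p within UNIV \<times> {0..<T})"
proof -
  let ?S = "UNIV \<times> {0..<T} :: (real \<times> real) set"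
  obtain B where B: "\<And>t k. t \<in> {0..T} \<Longrightarrow> norm (b t k) \<le> B / jb k ^ Suc 2" using rapid_onE[OF rb] by blast
  obtain B' where B': "\<And>t k. t \<in> {0..T} \<Longrightarrow> norm (b' t k) \<le> B' / jb k ^ 2" using rapid_onE[OF rb'] by blast
  define X where "X k p = b (snd p) k * wave k (fst p)" for k and p :: "real \<times> real"
  define Y where "Y k p = \<i> * of_int k * b (snd p) k * wave k (fst p)" for k and p :: "real \<times> real"
  define Z where "Z k p = b' (snd p) k * wave k (fst p)" for k and p :: "real \<times> real"
  have bX: "norm (X k p) \<le> B / jb k ^ 2" and bY: "norm (Y k p) \<le> B / jb k ^ 2" and bZ: "norm (Z k p) \<le> B' / jb k ^ 2"
    if "p \<in> ?S" for k p
  proof -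
    have t: "snd p \<in> {0..T}" using that by auto
    show "norm (X k p) \<le> B / jb k ^ 2" using decay_weaken[OF B[OF t, of k], of 2] by (simp add: X_def norm_mult)
    show "norm (Y k p) \<le> B / jb k ^ 2" using freq_decay[OF B[OF t, of k]] by (simp add: Y_def norm_mult)
    show "norm (Z k p) \<le> B' / jb k ^ 2" using B'[OF t, of k] by (simp add: Z_def norm_mult)
  qed
  define D where "D = B + B'"
  have T0: "0 \<in> {0..T}" using T by simp
  have B0': "0 \<le> B'" by (rule decay_const_nonneg[OF B'[OF T0]])
  have "((\<lambda>p. \<Sum>\<^sub>\<infinity>k. X k p) has_derivative (\<lambda>h. \<Sum>\<^sub>\<infinity>k. fst h *\<^sub>R Y k p + snd h *\<^sub>R Z k p)) (at p within ?S)"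
  proof (rule has_derivative_infsum[where D = D])
    show "convex ?S" by (intro convex_Times) auto
    show "(X k has_derivative (\<lambda>h. fst h *\<^sub>R Y k p + snd h *\<^sub>R Z k p)) (at p within ?S)" if p: "p \<in> ?S" for k p
    proof -
      have t: "snd p \<in> {0..T}" using p by auto
      have sub: "snd ` ?S \<subseteq> {0..T}" by auto
      have "((\<lambda>t. b t k) has_derivative (\<lambda>h. h *\<^sub>R b' (snd p) k)) (at (snd p) within snd ` ?S)"
        using has_derivative_subset[OF der[OF t, unfolded has_vector_derivative_def] sub] .
      from has_derivative_in_compose[OF has_derivative_snd[OF has_derivative_ident] this]
      have 1: "((\<lambda>p. b (snd p) k) has_derivative (\<lambda>h. snd h *\<^sub>R b' (snd p) k)) (at p within ?S)" .
      have "(wave k has_derivative (\<lambda>h. h *\<^sub>R (\<i> * of_int k * wave k (fst p)))) (at (fst p) within fst ` ?S)"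
        using has_vector_derivative_wave[of k "fst p"] by (simp add: has_vector_derivative_def)
      from has_derivative_in_compose[OF has_derivative_fst[OF has_derivative_ident] this]
      have 2: "((\<lambda>p. wave k (fst p)) has_derivative (\<lambda>h. fst h *\<^sub>R (\<i> * of_int k * wave k (fst p)))) (at p within ?S)" .
      from has_derivative_mult[OF 1 2] show ?thesis
        by (simp add: X_def[abs_def] Y_def Z_def scaleR_conv_of_real algebra_simps)
    qed
    show "norm (fst h *\<^sub>R Y k p + snd h *\<^sub>R Z k p) \<le> D / jb k ^ 2 * norm h" if p: "p \<in> ?S" for k p and h :: "real \<times> real"
    proof -
      have h: "\<bar>fst h\<bar> \<le> norm h" "\<bar>snd h\<bar> \<le> norm h" 
        using norm_fst_le[of "fst h" "snd h"] norm_snd_le[of "snd h" "fst h"] by simp_all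
      have "norm (fst h *\<^sub>R Y k p + snd h *\<^sub>R Z k p) \<le> \<bar>fst h\<bar> * norm (Y k p) + \<bar>snd h\<bar> * norm (Z k p)"
        by (rule order_trans[OF norm_triangle_ineq]) simp
      also have "\<dots> \<le> norm h * (B / jb k ^ 2) + norm h * (B' / jb k ^ 2)"
        by (intro add_mono mult_mono h bY bZ p) auto
      finally show ?thesis by (simp add: D_def add_divide_distrib algebra_simps)
    qed
    show "norm (X k p) \<le> D / jb k ^ 2" if "p \<in> ?S" for k p
    proof -
      have "B / jb k ^ 2 \<le> D / jb k ^ 2" using B0' by (intro divide_right_mono) (auto simp: D_def)
      with bX[OF that, of k] show ?thesis by linarith
    qed
  qed (rule p)
  moreover have "(\<Sum>\<^sub>\<infinity>k. fst h *\<^sub>R Y k p + snd h *\<^sub>R Z k p) = fst h *\<^sub>R (\<Sum>\<^sub>\<infinity>k. Y k p) + snd h *\<^sub>R (\<Sum>\<^sub>\<infinity>k. Z k p)" for h :: "real \<times> real"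
  proof -
    have sY: "(\<lambda>k. Y k p) summable_on UNIV" and sZ: "(\<lambda>k. Z k p) summable_on UNIV"
      by (rule infsum_jb_bound(1)[OF bY[OF p]], rule infsum_jb_bound(1)[OF bZ[OF p]])
    have "(\<Sum>\<^sub>\<infinity>k. fst h *\<^sub>R Y k p + snd h *\<^sub>R Z k p) = (\<Sum>\<^sub>\<infinity>k. fst h *\<^sub>R Y k p) + (\<Sum>\<^sub>\<infinity>k. snd h *\<^sub>R Z k p)"
      by (intro infsum_add summable_on_scaleR_right sY sZ)
    then show ?thesis unfolding scaleR_conv_of_real infsum_cmult_right' .
  qed
  ultimately show ?thesis unfolding evolve_def[abs_def] X_def Y_def Z_def by simp
qed

text \<open>Coinduction along the real parts of evolved generated families:
  \<open>generated.dx\<close> and \<open>generated_time_derivative\<close> supply the two partial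
  derivatives at every level.\<close>

lemma smooth_strip_evolve:
  assumes "generated q c b"
  shows "smooth_strip T (\<lambda>p. Re (evolve b p))"
proof (rule smooth_strip.coinduct[of "\<lambda>F. \<exists>b. generated q c b \<and> F = (\<lambda>p. Re (evolve b p))"])
  show "\<exists>b'. generated q c b' \<and> (\<lambda>p. Re (evolve b p)) = (\<lambda>p. Re (evolve b' p))" using assms by blast
next
  fix F assume "\<exists>b. generated q c b \<and> F = (\<lambda>p. Re (evolve b p))"
  then obtain b where b: "generated q c b" "F = (\<lambda>p. Re (evolve b p))" by blast
  from generated_time_derivative[OF b(1)] obtain b' where rb: "rapid_on T b" and b': "generated q c b'" "rapid_on T b'"
    "\<And>t k. t \<in> {0..T} \<Longrightarrow> ((\<lambda>t. b t k) has_vector_derivative b' t k) (at t within {0..T})" by blast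
  let ?bx = "\<lambda>t k. \<i> * of_int k * b t k"
  have "(F has_derivative (\<lambda>h. fst h * Re (evolve ?bx p) + snd h * Re (evolve b' p))) (at p within UNIV \<times> {0..<T})"
    if "p \<in> UNIV \<times> {0..<T}" for p
    using has_derivative_Re[OF evolve_has_derivative[OF rb b'(2,3) that]] by (simp add: b(2))
  then show "\<exists>F' Fx Ft. F = F' \<and>
      (\<forall>x. x \<in> UNIV \<times> {0..<T} \<longrightarrow> (F' has_derivative (\<lambda>h. fst h * Fx x + snd h * Ft x)) (at x within UNIV \<times> {0..<T})) \<and>
      ((\<exists>b. generated q c b \<and> Fx = (\<lambda>p. Re (evolve b p))) \<or> smooth_strip T Fx) \<and>
      ((\<exists>b. generated q c b \<and> Ft = (\<lambda>p. Re (evolve b p))) \<or> smooth_strip T Ft)"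
    by (intro exI[of _ F] exI[of _ "\<lambda>p. Re (evolve ?bx p)"] exI[of _ "\<lambda>p. Re (evolve b' p)"] conjI refl allI impI
        disjI1 exI[of _ ?bx] exI[of _ b'] generated.dx b b')
qed

end

section \<open>Partial derivatives on the strip and smoothness in space\<close>

lemma strip_partial_derivatives:
  fixes F :: "real \<times> real \<Rightarrow> real"
  assumes "(F has_derivative (\<lambda>h. fst h * Fx + snd h * Ft)) (at (x, t) within UNIV \<times> {0..<T})" and t: "t \<in> {0..<T}"
  shows "((\<lambda>s. F (x, s)) has_real_derivative Ft) (at t within {0..<T})"
    and "((\<lambda>y. F (y, t)) has_real_derivative Fx) (at x)"
proof -
  have "((\<lambda>s. (x, s)) has_derivative (\<lambda>h. (0, h))) (at t within {0..<T})"
    by (intro has_derivative_Pair has_derivative_const has_derivative_ident)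
  moreover have "(F has_derivative (\<lambda>h. fst h * Fx + snd h * Ft)) (at (x, t) within (\<lambda>s. (x, s)) ` {0..<T})"
    by (rule has_derivative_subset[OF assms(1)]) auto
  ultimately have "((\<lambda>s. F (x, s)) has_derivative (\<lambda>h. fst (0::real, h) * Fx + snd (0::real, h) * Ft)) (at t within {0..<T})"
    by (rule has_derivative_in_compose)
  then show "((\<lambda>s. F (x, s)) has_real_derivative Ft) (at t within {0..<T})"
    by (simp add: has_field_derivative_def mult.commute[of _ Ft])
  have "((\<lambda>y. (y, t)) has_derivative (\<lambda>h. (h, 0))) (at x within UNIV)"
    by (intro has_derivative_Pair has_derivative_const has_derivative_ident)
  moreover have "(F has_derivative (\<lambda>h. fst h * Fx + snd h * Ft)) (at (x, t) within (\<lambda>y. (y, t)) ` UNIV)"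
    by (rule has_derivative_subset[OF assms(1)]) (use t in auto)
  ultimately have "((\<lambda>y. F (y, t)) has_derivative (\<lambda>h. fst (h, 0::real) * Fx + snd (h, 0::real) * Ft)) (at x within UNIV)"
    by (rule has_derivative_in_compose)
  then show "((\<lambda>y. F (y, t)) has_real_derivative Fx) (at x)"
    by (simp add: has_field_derivative_def mult.commute[of _ Fx])
qed

lemma C_inf_T_series:
  assumes "\<And>s. \<exists>C. \<forall>k. norm (d k) \<le> C / jb k ^ s"
  shows "C_inf_T (\<lambda>x. Re (\<Sum>\<^sub>\<infinity>k. d k * wave k x))"
proof -
  define f where "f n x = Re (\<Sum>\<^sub>\<infinity>k. (\<i> * of_int k) ^ n * d k * wave k x)" for n x
  have dec: "\<exists>C. \<forall>k. norm ((\<i> * of_int k) ^ n * d k) \<le> C / jb k ^ s" for n s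
  proof -
    obtain C where C: "\<And>k. norm (d k) \<le> C / jb k ^ (n + s)" using assms by blast
    have "norm ((\<i> * of_int k) ^ n * d k) \<le> C / jb k ^ s" for k
    proof -
      have "norm ((\<i> * of_int k) ^ n * d k) = \<bar>real_of_int k\<bar> ^ n * norm (d k)" by (simp add: norm_mult norm_power)
      also have "\<dots> \<le> jb k ^ n * (C / jb k ^ (n + s))" by (intro mult_mono power_mono C abs_le_jb) auto
      finally show ?thesis by (simp add: power_add)
    qed
    then show ?thesis by blast
  qed
  have der: "(f n has_real_derivative f (Suc n) x) (at x)" for n x
  proof -
    obtain C where "\<And>k. norm ((\<i> * of_int k) ^ n * d k) \<le> C / jb k ^ 3" using dec by blast
    from series_has_vector_derivative[OF this, of x]
    have "((\<lambda>x. \<Sum>\<^sub>\<infinity>k. (\<i> * of_int k) ^ n * d k * wave k x) has_vector_derivative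
        (\<Sum>\<^sub>\<infinity>k. (\<i> * of_int k) ^ Suc n * d k * wave k x)) (at x)" by (simp add: mult_ac)
    from bounded_linear.has_vector_derivative[OF bounded_linear_Re this] show ?thesis
      unfolding f_def[abs_def] has_real_derivative_iff_has_vector_derivative .
  qed
  have iter: "(deriv ^^ n) (f 0) = f n" for n
  proof (induction n)
    case (Suc n)
    have "deriv (f n) = f (Suc n)" by (rule ext) (rule DERIV_imp_deriv[OF der])
    then show ?case using Suc by simp
  qed simp
  have f0: "f 0 = (\<lambda>x. Re (\<Sum>\<^sub>\<infinity>k. d k * wave k x))" by (simp add: f_def[abs_def])
  show ?thesis unfolding C_inf_T_def f0[symmetric] iter
  proof (intro conjI allI)
    show "f 0 (x + 2 * pi) = f 0 x" for x by (simp add: f_def wave_periodic)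
    show "f n differentiable_on UNIV" for n
      using der by (auto simp: differentiable_on_def real_differentiable_def)
    show "bounded (range (f n))" for n
    proof -
      obtain C where C: "\<And>k. norm ((\<i> * of_int k) ^ n * d k) \<le> C / jb k ^ 2" using dec by blast
      have "\<bar>f n x\<bar> \<le> C * jsum" for x
      proof -
        have "\<bar>f n x\<bar> \<le> norm (\<Sum>\<^sub>\<infinity>k. (\<i> * of_int k) ^ n * d k * wave k x)"
          unfolding f_def by (rule abs_Re_le_cmod)
        also have "\<dots> \<le> C * jsum" by (rule infsum_jb_bound(2)) (use C in \<open>simp add: norm_mult\<close>)
        finally show ?thesis .
      qed
      then show ?thesis by (auto simp: bounded_iff)
    qed
  qed
qed

section \<open>Well-posedness\<close>

lemma periodic_derivative:
  fixes f :: "real \<Rightarrow> real"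
  assumes "\<And>x. f (x + p) = f x" "\<And>x. (f has_real_derivative f' x) (at x)"
  shows "f' (x + p) = f' x"
proof -
  have "((\<lambda>x. f (x + p)) has_real_derivative f' (x + p)) (at x)"
    using assms(2)[of "x + p"] by (simp add: DERIV_shift)
  then have "(f has_real_derivative f' (x + p)) (at x)" by (simp add: assms(1))
  then show ?thesis by (rule DERIV_unique) (rule assms(2))
qed

lemma of_real_has_vector_derivative:
  "(f has_real_derivative f') (at x within S) \<Longrightarrow> ((\<lambda>x. complex_of_real (f x)) has_vector_derivative of_real f') (at x within S)"
  unfolding has_real_derivative_iff_has_vector_derivative
  by (rule bounded_linear.has_vector_derivative[OF bounded_linear_of_real])

lemma C_inf_T_fourier:
  assumes f: "C_inf_T f"
  shows "\<exists>C. \<forall>k. norm (fcoeff (\<lambda>x. of_real (f x)) k) \<le> C / jb k ^ s"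
    and "complex_of_real (f x) = (\<Sum>\<^sub>\<infinity>k. fcoeff (\<lambda>x. of_real (f x)) k * wave k x)"
proof -
  define F where "F n = (deriv ^^ n) f" for n
  have F0: "F 0 = f" by (simp add: F_def)
  have der: "(F n has_real_derivative F (Suc n) x) (at x)" for n x
  proof -
    have "F n differentiable (at x)" using f by (auto simp: C_inf_T_def F_def differentiable_on_def)
    then have "(F n has_real_derivative deriv (F n) x) (at x)" by (simp add: DERIV_deriv_iff_real_differentiable)
    then show ?thesis by (simp add: F_def)
  qed
  have per: "F n (x + 2 * pi) = F n x" for n x
  proof (induction n arbitrary: x)
    case 0
    then show ?case using f by (simp add: F_def C_inf_T_def)
  next
    case (Suc n)
    show ?case by (rule periodic_derivative[OF Suc der])
  qed
  have "\<exists>B. \<forall>x. \<bar>F n x\<bar> \<le> B" for n using f by (auto simp: C_inf_T_def F_def bounded_iff)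
  then obtain B where B: "\<And>n x. \<bar>F n x\<bar> \<le> B n" by metis
  have decay: "norm (fcoeff (\<lambda>x. of_real (f x)) k) \<le> (2 ^ s * max (B s) (B 0)) / jb k ^ s" for s k
    unfolding F0[symmetric]
  proof (rule fcoeff_decay[of "\<lambda>n x. of_real (F n x)"])
    show "complex_of_real (F n pi) = of_real (F n (- pi))" for n using per[of n "- pi"] by simp
    show "((\<lambda>x. complex_of_real (F n x)) has_vector_derivative of_real (F (Suc n) x)) (at x)" for n x
      by (rule of_real_has_vector_derivative[OF der])
    show "continuous_on {- pi..pi} (\<lambda>x. complex_of_real (F s x))"
      by (rule continuous_on_vector_derivative[OF of_real_has_vector_derivative[OF DERIV_subset[OF der subset_UNIV]]])
  qed (use B in \<open>auto simp: le_max_iff_disj\<close>)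
  then show "\<exists>C. \<forall>k. norm (fcoeff (\<lambda>x. of_real (f x)) k) \<le> C / jb k ^ s" by blast
  show "complex_of_real (f x) = (\<Sum>\<^sub>\<infinity>k. fcoeff (\<lambda>x. of_real (f x)) k * wave k x)"
    by (rule fourier_inversion[OF _ _ decay])
      (use per[of 0] der[of 0] in \<open>auto simp: F0 intro!: of_real_has_vector_derivative\<close>)
qed

lemma fcoeff_real:
  assumes "continuous_on {- pi..pi} f"
  shows "cnj (fcoeff (\<lambda>x. complex_of_real (f x)) (- k)) = fcoeff (\<lambda>x. of_real (f x)) k"
proof -
  have i: "(\<lambda>x. complex_of_real (f x) * wave k x) integrable_on {- pi..pi}"
    by (intro integrable_continuous_real continuous_intros assms)
  have "cnj (integral {- pi..pi} (\<lambda>x. complex_of_real (f x) * wave k x))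
    = integral {- pi..pi} (cnj \<circ> (\<lambda>x. complex_of_real (f x) * wave k x))"
    by (rule integral_linear[OF i bounded_linear_cnj, symmetric])
  then show ?thesis by (simp add: fcoeff_def o_def wave_cnj)
qed

text \<open>Conjugation turns \<open>wave k\<close> into \<open>wave (- k)\<close>, and averaging a
  series with its conjugate gives the real part; hence \<open>vel\<close> produces the velocity of
  the real part of a complex flow.\<close>

lemma Re_series:
  assumes d: "\<And>k. norm (d k) \<le> C / jb k ^ 2"
  shows "complex_of_real (Re (\<Sum>\<^sub>\<infinity>k. d k * wave k x)) = (\<Sum>\<^sub>\<infinity>k. (d k + cnj (d (- k))) / 2 * wave k x)"
proof -
  have s1: "(\<lambda>k. d k * wave k x) summable_on UNIV"
    by (rule infsum_jb_bound(1)) (use d in \<open>simp add: norm_mult\<close>)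
  have s2: "(\<lambda>k. cnj (d (- k)) * wave k x) summable_on UNIV"
  proof (rule infsum_jb_bound(1))
    show "norm (cnj (d (- l)) * wave l x) \<le> C / jb l ^ 2" for l using d[of "- l"] by (simp add: norm_mult)
  qed
  have "cnj (\<Sum>\<^sub>\<infinity>k. d k * wave k x) = (\<Sum>\<^sub>\<infinity>k. cnj (d k) * wave (- k) x)"
    unfolding infsum_cnj[symmetric] by (simp add: wave_cnj)
  also have "\<dots> = (\<Sum>\<^sub>\<infinity>k. cnj (d (- k)) * wave k x)"
    by (rule infsum_reindex_bij_witness[of _ uminus uminus]) auto
  finally have c: "cnj (\<Sum>\<^sub>\<infinity>k. d k * wave k x) = (\<Sum>\<^sub>\<infinity>k. cnj (d (- k)) * wave k x)" .
  have "complex_of_real (Re z) = (1 / 2) * (z + cnj z)" for z by (simp add: complex_add_cnj)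
  then have "complex_of_real (Re (\<Sum>\<^sub>\<infinity>k. d k * wave k x)) = (1 / 2) * (\<Sum>\<^sub>\<infinity>k. d k * wave k x + cnj (d (- k)) * wave k x)"
    unfolding infsum_add[OF s1 s2] c[symmetric] .
  also have "\<dots> = (\<Sum>\<^sub>\<infinity>k. (1 / 2) * (d k * wave k x + cnj (d (- k)) * wave k x))"
    by (rule infsum_cmult_right'[symmetric])
  finally show ?thesis by (simp add: algebra_simps add_divide_distrib)
qed

lemma adv_series:
  assumes v: "\<And>k. norm (v k) \<le> C / jb k ^ 2" and b: "\<And>k. norm (b k) \<le> D / jb k ^ Suc 2"
  shows "(\<Sum>\<^sub>\<infinity>k. adv v b k * wave k x) = (\<Sum>\<^sub>\<infinity>k. v k * wave k x) * (\<Sum>\<^sub>\<infinity>k. \<i> * of_int k * b k * wave k x)"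
proof -
  have "norm (\<i> * of_int k * b k) \<le> D / jb k ^ 2" for k
    by (rule freq_decay[OF b])
  from series_mult[OF v this, of x] show ?thesis by (simp add: adv_def mult.assoc)
qed

lemma at_within_strip: "0 < t \<Longrightarrow> t < T \<Longrightarrow> at t within {0..<T} = at (t::real)"
  by (rule at_within_interior) simp

text \<open>The minus sign moves the transport term to the right-hand side, so that the system reads
  \<open>c' = adv (vel q c) c\<close>.\<close>

definition velocity_mult :: "real \<Rightarrow> real \<Rightarrow> int \<Rightarrow> complex" where
  "velocity_mult a g k = - of_real g * hilbert_mult a k"

lemma multiplier_velocity_mult:
  assumes "0 < a" "0 < g"
  shows "multiplier (velocity_mult a g) (2 * g)"
proof
  show "velocity_mult a g (- j) = cnj (velocity_mult a g j)" for j
    by (simp add: velocity_mult_def hilbert_mult_cnj)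
  show "norm (velocity_mult a g j) \<le> 2 * g" for j
    using mult_left_mono[OF hilbert_mult_bound[OF assms(1), of j], of g] assms(2)
    by (simp add: velocity_mult_def norm_mult mult.commute)
qed

lemma velocity_series:
  assumes a: "0 < a" and d: "\<And>l. norm (d l) \<le> C / jb l ^ 3"
    and f: "\<And>x. complex_of_real (f x) = (\<Sum>\<^sub>\<infinity>l. d l * wave l x)"
  shows "(\<Sum>\<^sub>\<infinity>l. (velocity_mult a g l * d l) * wave l x) = of_real (- g * H_op a f x)"
proof -
  have "(\<Sum>\<^sub>\<infinity>l. (velocity_mult a g l * d l) * wave l x) = (\<Sum>\<^sub>\<infinity>l. - of_real g * (hilbert_mult a l * d l * wave l x))"
    by (simp add: velocity_mult_def mult.assoc)
  also have "\<dots> = - of_real g * of_real (H_op a f x)"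
    unfolding H_op_series[OF a d f] by (rule infsum_cmult_right')
  finally show ?thesis by simp
qed

lemma fourier_flow_is_solution:
  assumes a: "0 < a" and g: "0 < g" and flow: "fourier_flow (velocity_mult a g) (2 * g) T c"
    and ini: "\<And>x. complex_of_real (rho0 x) = (\<Sum>\<^sub>\<infinity>k. c 0 k * wave k x)"
  shows "is_solution a g rho0 T (\<lambda>x t. Re (\<Sum>\<^sub>\<infinity>k. c t k * wave k x))"
proof -
  interpret fourier_flow "velocity_mult a g" "2 * g" T c by fact
  let ?q = "velocity_mult a g"
  let ?S = "UNIV \<times> {0..<T} :: (real \<times> real) set"
  define rho where "rho x t = Re (\<Sum>\<^sub>\<infinity>k. c t k * wave k x)" for x t
  have rho: "(\<lambda>p. rho (fst p) (snd p)) = (\<lambda>p. Re (evolve c p))" by (simp add: rho_def evolve_def)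
  obtain C where C: "\<And>t k. t \<in> {0..T} \<Longrightarrow> norm (c t k) \<le> C / jb k ^ 3" using rapid_onE[OF c_rapid] by blast
  have C2: "norm (c t k) \<le> C / jb k ^ 2" if "t \<in> {0..T}" for t k by (rule decay_weaken[OF C[OF that]]) simp
  have "is_solution a g rho0 T rho"
    unfolding is_solution_def
  proof (intro conjI ballI allI)
    show "smooth_strip T (\<lambda>p. rho (fst p) (snd p))"
      unfolding rho by (rule smooth_strip_evolve[OF generated.base])
    have "\<bar>rho x t\<bar> \<le> C * jsum" if "t \<in> {0..<T}" for x t
    proof -
      have t: "t \<in> {0..T}" using that by simp
      have "\<bar>rho x t\<bar> \<le> norm (\<Sum>\<^sub>\<infinity>k. c t k * wave k x)" unfolding rho_def by (rule abs_Re_le_cmod)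
      also have "\<dots> \<le> C * jsum" by (rule infsum_jb_bound(2)) (use C2[OF t] in \<open>simp add: norm_mult\<close>)
      finally show ?thesis .
    qed
    then show "bounded ((\<lambda>p. rho (fst p) (snd p)) ` ?S)"
      by (auto simp: bounded_iff intro!: exI[of _ "C * jsum"])
    show "C_inf_T (\<lambda>x. rho x t)" if "t \<in> {0..<T}" for t
      unfolding rho_def
    proof (rule C_inf_T_series)
      fix s
      obtain D where "\<And>t k. t \<in> {0..T} \<Longrightarrow> norm (c t k) \<le> D / jb k ^ s" using rapid_onE[OF c_rapid] by blast
      moreover have "t \<in> {0..T}" using that by simp
      ultimately show "\<exists>C. \<forall>k. norm (c t k) \<le> C / jb k ^ s" by blast
    qed
    show "rho x 0 = rho0 x" for x unfolding rho_def ini[symmetric] by simp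
    fix x t assume t: "t \<in> {0<..<T}"
    then have tT: "t \<in> {0..T}" and ts: "t \<in> {0..<T}" and p: "(x, t) \<in> ?S" by auto
    define v where "v = vel ?q (c t)"
    have "(evolve c has_derivative (\<lambda>h. fst h *\<^sub>R evolve (\<lambda>t k. \<i> * of_int k * c t k) (x, t) + snd h *\<^sub>R evolve (\<lambda>t. adv (vel ?q (c t)) (c t)) (x, t)))
      (at (x, t) within ?S)"
      by (rule evolve_has_derivative[OF c_rapid rapid_on_adv[OF c_rapid c_rapid] c_ode p])
    from has_derivative_Re[OF this]
    have "((\<lambda>p. rho (fst p) (snd p)) has_derivative
        (\<lambda>h. fst h * Re (evolve (\<lambda>t k. \<i> * of_int k * c t k) (x, t)) + snd h * Re (evolve (\<lambda>t. adv (vel ?q (c t)) (c t)) (x, t))))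
      (at (x, t) within ?S)" unfolding rho by simp
    note pd = strip_partial_derivatives[OF this ts]
    have dt: "deriv (\<lambda>s. rho x s) t = Re (\<Sum>\<^sub>\<infinity>k. adv v (c t) k * wave k x)"
      using DERIV_imp_deriv[of "\<lambda>s. rho x s"] pd(1) at_within_strip[of t T] t by (simp add: evolve_def v_def)
    have dx: "deriv (\<lambda>y. rho y t) x = Re (\<Sum>\<^sub>\<infinity>k. \<i> * of_int k * c t k * wave k x)"
      using DERIV_imp_deriv[of "\<lambda>y. rho y t"] pd(2) by (simp add: evolve_def)
    have vd: "norm (v k) \<le> (2 * g * C) / jb k ^ 2" for k
      unfolding v_def by (rule vel_decay[OF q_bound]) (rule C2[OF tT])
    have rd: "norm ((c t k + cnj (c t (- k))) / 2) \<le> C / jb k ^ 3" for k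
    proof -
      have "norm (c t k + cnj (c t (- k))) \<le> C / jb k ^ 3 + C / jb k ^ 3"
        using C[OF tT, of k] C[OF tT, of "- k"] by (intro norm_triangle_mono) auto
      then show ?thesis by (simp add: norm_divide mult.commute)
    qed
    have "(\<Sum>\<^sub>\<infinity>l. v l * wave l x) = of_real (- g * H_op a (\<lambda>y. rho y t) x)"
      unfolding v_def vel_def
    proof (rule velocity_series[OF a rd])
      show "complex_of_real (rho x t) = (\<Sum>\<^sub>\<infinity>l. (c t l + cnj (c t (- l))) / 2 * wave l x)" for x
        unfolding rho_def by (rule Re_series) (rule C2[OF tT])
    qed
    then have "(\<Sum>\<^sub>\<infinity>k. adv v (c t) k * wave k x) = of_real (- g * H_op a (\<lambda>y. rho y t) x) * (\<Sum>\<^sub>\<infinity>k. \<i> * of_int k * c t k * wave k x)"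
      using adv_series[OF vd, of "c t" C x] C[OF tT] by (simp add: numeral_3_eq_3 numeral_2_eq_2)
    \<comment> \<open>The velocity is a real number, so the real part passes through the product and
      the complex flow yields the equation for its real part.\<close>
    then show "deriv (\<lambda>s. rho x s) t + g * H_op a (\<lambda>y. rho y t) x * deriv (\<lambda>y. rho y t) x = 0"
      unfolding dt dx by (simp add: Re_complex_of_real)
  qed
  then show ?thesis by (simp add: rho_def[abs_def])
qed

section \<open>Coefficients of an arbitrary smooth solution\<close>

lemma smooth_strip_step:
  assumes "smooth_strip T F"
  obtains Fx Ft where "\<And>p. p \<in> UNIV \<times> {0..<T} \<Longrightarrow>
      (F has_derivative (\<lambda>h. fst h * Fx p + snd h * Ft p)) (at p within UNIV \<times> {0..<T})"
    "smooth_strip T Fx" "smooth_strip T Ft"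
  using assms by (cases rule: smooth_strip.cases) blast

lemma smooth_strip_continuous: "smooth_strip T F \<Longrightarrow> continuous_on (UNIV \<times> {0..<T}) F"
  by (erule smooth_strip_step) (rule has_derivative_continuous_on)

text \<open>The coinductive predicate gives one pair of derivatives at a time; dependent choice
  assembles a sequence. Its members are jointly continuous, whereas \<open>C_inf_T\<close> bounds
  the derivatives at each time separately.\<close>

lemma smooth_strip_tower:
  assumes "smooth_strip T F"
  obtains G where "G 0 = F" "\<And>n. smooth_strip T (G n)"
    "\<And>n x t. t \<in> {0..<T} \<Longrightarrow> ((\<lambda>y. G n (y, t)) has_real_derivative G (Suc n) (x, t)) (at x)"
proof -
  have "\<exists>G. \<forall>n. (smooth_strip T (G n) \<and> (n = 0 \<longrightarrow> G n = F)) \<and>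
     (\<forall>x. \<forall>t\<in>{0..<T}. ((\<lambda>y. G n (y, t)) has_real_derivative G (Suc n) (x, t)) (at x))"
  proof (rule dependent_nat_choice)
    show "\<exists>x. smooth_strip T x \<and> ((0::nat) = 0 \<longrightarrow> x = F)" using assms by blast
    fix G :: "real \<times> real \<Rightarrow> real" and n :: nat assume "smooth_strip T G \<and> (n = 0 \<longrightarrow> G = F)"
    then have "smooth_strip T G" by simp
    then obtain Gx Gt where G: "\<And>p. p \<in> UNIV \<times> {0..<T} \<Longrightarrow>
      (G has_derivative (\<lambda>h. fst h * Gx p + snd h * Gt p)) (at p within UNIV \<times> {0..<T})"
      "smooth_strip T Gx" "smooth_strip T Gt" by (rule smooth_strip_step) (rule that)
    have "((\<lambda>y. G (y, t)) has_real_derivative Gx (x, t)) (at x)" if "t \<in> {0..<T}" for x t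
      by (rule strip_partial_derivatives(2)[OF G(1) that]) (use that in auto)
    then show "\<exists>G'. (smooth_strip T G' \<and> (Suc n = 0 \<longrightarrow> G' = F)) \<and>
        (\<forall>x. \<forall>t\<in>{0..<T}. ((\<lambda>y. G (y, t)) has_real_derivative G' (x, t)) (at x))"
      using G(2) by blast
  qed
  then show ?thesis using that by blast
qed

text \<open>Brings any competing solution under \<open>fourier_solution_unique\<close>. Since
  \<open>{0..\<tau>}\<close> stops before \<open>T\<close>, a period times this interval is a
  compact part of the strip, and joint continuity of the space derivatives gives decay constants
  uniform in time.\<close>

lemma solution_fourier:
  assumes a: "0 < a" and g: "0 < g" and sol: "is_solution a g rho0 T rho" and \<tau>: "0 \<le> \<tau>" "\<tau> < T"
  defines "b \<equiv> \<lambda>t. fcoeff (\<lambda>x. of_real (rho x t))"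
  shows "\<exists>C. \<forall>t\<in>{0..\<tau>}. \<forall>k. norm (b t k) \<le> C / jb k ^ 6"
    and "continuous_on {0..\<tau>} (\<lambda>t. b t k)"
    and "0 < t \<Longrightarrow> t < \<tau> \<Longrightarrow>
      ((\<lambda>t. b t k) has_vector_derivative adv (vel (velocity_mult a g) (b t)) (b t) k) (at t)"
    and "t \<in> {0..\<tau>} \<Longrightarrow> complex_of_real (rho x t) = (\<Sum>\<^sub>\<infinity>k. b t k * wave k x)"
proof -
  interpret multiplier "velocity_mult a g" "2 * g" by (rule multiplier_velocity_mult[OF a g])
  let ?S = "UNIV \<times> {0..<T} :: (real \<times> real) set"
  let ?F = "\<lambda>p. rho (fst p) (snd p)"
  have smooth: "smooth_strip T ?F" and per: "\<And>t. t \<in> {0..<T} \<Longrightarrow> C_inf_T (\<lambda>x. rho x t)"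
    and pde: "\<And>x t. t \<in> {0<..<T} \<Longrightarrow> deriv (\<lambda>s. rho x s) t + g * H_op a (\<lambda>y. rho y t) x * deriv (\<lambda>y. rho y t) x = 0"
    using sol by (auto simp: is_solution_def)
  obtain G where G: "G 0 = ?F" "\<And>n. smooth_strip T (G n)"
    "\<And>n x t. t \<in> {0..<T} \<Longrightarrow> ((\<lambda>y. G n (y, t)) has_real_derivative G (Suc n) (x, t)) (at x)"
    using smooth_strip_tower[OF smooth] by blast
  have Gper: "G n (x + 2 * pi, t) = G n (x, t)" if t: "t \<in> {0..<T}" for n x t
  proof (induction n arbitrary: x)
    case 0
    then show ?case using per[OF t] by (simp add: G(1) C_inf_T_def)
  next
    case (Suc n)
    show ?case by (rule periodic_derivative[of "\<lambda>x. G n (x, t)" "2 * pi" "\<lambda>x. G (Suc n) (x, t)"]) (rule Suc, rule G(3)[OF t])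
  qed
  let ?K = "{- pi..pi} \<times> {0..\<tau>}"
  have "\<exists>B. \<forall>p\<in>?K. \<bar>G n p\<bar> \<le> B" for n
  proof -
    have "continuous_on ?K (G n)"
      by (rule continuous_on_subset[OF smooth_strip_continuous[OF G(2)]]) (use \<tau> in auto)
    then have "compact (G n ` ?K)" by (intro compact_continuous_image compact_Times compact_Icc)
    then show ?thesis using compact_imp_bounded by (fastforce simp: bounded_iff)
  qed
  then obtain B where B: "\<And>n p. p \<in> ?K \<Longrightarrow> \<bar>G n p\<bar> \<le> B n" by metis
  define C where "C = 2 ^ 6 * max (B 6) (B 0)"
  have decay: "norm (b t k) \<le> C / jb k ^ 6" if t: "t \<in> {0..\<tau>}" for t k
  proof -
    have ts: "t \<in> {0..<T}" using t \<tau> by auto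
    have "norm (fcoeff (\<lambda>x. complex_of_real (G 0 (x, t))) k) \<le> (2 ^ 6 * max (B 6) (B 0)) / jb k ^ 6"
    proof (rule fcoeff_decay[of "\<lambda>n x. of_real (G n (x, t))"])
      show "complex_of_real (G n (pi, t)) = of_real (G n (- pi, t))" for n using Gper[OF ts, of n "- pi"] by simp
      show "((\<lambda>x. complex_of_real (G n (x, t))) has_vector_derivative of_real (G (Suc n) (x, t))) (at x)" for n x
        by (rule of_real_has_vector_derivative[OF G(3)[OF ts]])
      show "continuous_on {- pi..pi} (\<lambda>x. complex_of_real (G 6 (x, t)))"
        by (rule continuous_on_vector_derivative[OF of_real_has_vector_derivative[OF DERIV_subset[OF G(3)[OF ts] subset_UNIV]]])
      show "norm (complex_of_real (G 6 (x, t))) \<le> max (B 6) (B 0)" if "x \<in> {- pi..pi}" for x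
        using B[of "(x, t)" 6] t that by (auto simp: le_max_iff_disj)
      show "norm (complex_of_real (G 0 (x, t))) \<le> max (B 6) (B 0)" if "x \<in> {- pi..pi}" for x
        using B[of "(x, t)" 0] t that by (auto simp: le_max_iff_disj)
    qed
    then show ?thesis by (simp add: b_def C_def G(1))
  qed
  then show "\<exists>C. \<forall>t\<in>{0..\<tau>}. \<forall>k. norm (b t k) \<le> C / jb k ^ 6" by blast
  show inv: "complex_of_real (rho x t) = (\<Sum>\<^sub>\<infinity>k. b t k * wave k x)" if "t \<in> {0..\<tau>}" for x t
    unfolding b_def by (rule C_inf_T_fourier(2)[OF per]) (use that \<tau> in auto)
  obtain Fx Ft where F: "\<And>p. p \<in> ?S \<Longrightarrow> (?F has_derivative (\<lambda>h. fst h * Fx p + snd h * Ft p)) (at p within ?S)"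
    and sFt: "smooth_strip T Ft" using smooth_strip_step[OF smooth] by blast
  have Fd: "((\<lambda>s. rho x s) has_real_derivative Ft (x, t)) (at t within {0..<T})"
     "((\<lambda>y. rho y t) has_real_derivative Fx (x, t)) (at x)" if "t \<in> {0..<T}" for x t
    using strip_partial_derivatives[OF F that, of x] that by auto
  have xcont: "continuous_on {- pi..pi} (\<lambda>x. rho x t)" if "t \<in> {0..<T}" for t
    using Fd(2)[OF that] by (meson DERIV_isCont continuous_at_imp_continuous_on)
  have bder: "((\<lambda>t. b t k) has_vector_derivative fcoeff (\<lambda>x. of_real (Ft (x, t))) k) (at t within {0..<T})"
    if t: "t \<in> {0..<T}" for t k
  proof -
    \<comment> \<open>Differentiation under the integral rests on joint continuity of
      \<open>Ft\<close>, which the next level of \<open>smooth_strip\<close> provides.\<close>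
    have "((\<lambda>t. integral (cbox (- pi) pi) (\<lambda>x. complex_of_real (rho x t) * wave (- k) x)) has_vector_derivative
       integral (cbox (- pi) pi) (\<lambda>x. of_real (Ft (x, t)) * wave (- k) x)) (at t within {0..<T})"
    proof (rule leibniz_rule_vector_derivative[OF _ _ _ t])
      show "((\<lambda>t. complex_of_real (rho x t) * wave (- k) x) has_vector_derivative of_real (Ft (x, t)) * wave (- k) x) (at t within {0..<T})"
        if "t \<in> {0..<T}" for t x
        by (intro has_vector_derivative_mult_left of_real_has_vector_derivative Fd that)
      show "(\<lambda>x. complex_of_real (rho x t) * wave (- k) x) integrable_on cbox (- pi) pi" if "t \<in> {0..<T}" for t
        unfolding cbox_interval by (intro integrable_continuous_real continuous_intros xcont that)
      have "continuous_on ({0..<T} \<times> cbox (- pi) pi) (\<lambda>p. Ft (snd p, fst p))"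
        by (rule continuous_on_compose2[OF smooth_strip_continuous[OF sFt]]) (auto intro!: continuous_intros)
      moreover have "continuous_on ({0..<T} \<times> cbox (- pi) pi) (\<lambda>p. wave (- k) (snd p))"
        by (rule continuous_on_compose2[OF continuous_on_wave[of UNIV]]) (auto intro!: continuous_intros)
      ultimately show "continuous_on ({0..<T} \<times> cbox (- pi) pi) (\<lambda>(t, x). of_real (Ft (x, t)) * wave (- k) x)"
        unfolding case_prod_unfold by (intro continuous_intros)
    qed simp
    from has_vector_derivative_divide[OF this, of "2 * pi"] show ?thesis by (simp add: b_def fcoeff_def)
  qed
  show "continuous_on {0..\<tau>} (\<lambda>t. b t k)"
    by (rule continuous_on_subset[OF continuous_on_vector_derivative[OF bder]]) (use \<tau> in auto)
  show "((\<lambda>t. b t k) has_vector_derivative adv (vel (velocity_mult a g) (b t)) (b t) k) (at t)" if t: "0 < t" "t < \<tau>"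
  proof -
    let ?q = "velocity_mult a g"
    have ts: "t \<in> {0..<T}" and t\<tau>: "t \<in> {0..\<tau>}" and to: "t \<in> {0<..<T}" using t \<tau> by auto
    have at: "at t within {0..<T} = at t" using to by (intro at_within_strip) auto
    have real: "cnj (b t (- j)) = b t j" for j unfolding b_def by (rule fcoeff_real[OF xcont[OF ts]])
    \<comment> \<open>The coefficients of a real function are conjugate symmetric, so the averaging
      in \<open>vel\<close> acts as the identity.\<close>
    have v: "vel ?q (b t) = (\<lambda>j. ?q j * b t j)" by (rule ext) (simp add: vel_def real)
    have d3: "norm (b t k) \<le> C / jb k ^ 3" for k by (rule decay_weaken[OF decay[OF t\<tau>]]) simp
    have vd: "norm (?q j * b t j) \<le> (2 * g * C) / jb j ^ 2" for j
      unfolding fun_cong[OF v, symmetric] by (rule vel_decay[OF q_bound]) (rule decay_weaken[OF decay[OF t\<tau>]], simp)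
    have dx: "complex_of_real (deriv (\<lambda>y. rho y t) x) = (\<Sum>\<^sub>\<infinity>k. \<i> * of_int k * b t k * wave k x)" for x
    proof -
      have "((\<lambda>y. complex_of_real (rho y t)) has_vector_derivative (\<Sum>\<^sub>\<infinity>k. \<i> * of_int k * b t k * wave k x)) (at x)"
        unfolding inv[OF t\<tau>] by (rule series_has_vector_derivative[OF d3])
      moreover have "((\<lambda>y. complex_of_real (rho y t)) has_vector_derivative of_real (Fx (x, t))) (at x)"
        by (rule of_real_has_vector_derivative[OF Fd(2)[OF ts]])
      ultimately have "of_real (Fx (x, t)) = (\<Sum>\<^sub>\<infinity>k. \<i> * of_int k * b t k * wave k x)"
        by (rule vector_derivative_unique_at[symmetric])
      then show ?thesis using DERIV_imp_deriv[OF Fd(2)[OF ts]] by simp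
    qed
    have "complex_of_real (Ft (x, t)) = (\<Sum>\<^sub>\<infinity>k. adv (vel ?q (b t)) (b t) k * wave k x)" for x
    proof -
      have "Ft (x, t) = deriv (\<lambda>s. rho x s) t"
        using DERIV_imp_deriv[OF Fd(1)[OF ts, unfolded at]] by simp
      also have "\<dots> = (- g * H_op a (\<lambda>y. rho y t) x) * deriv (\<lambda>y. rho y t) x"
        using pde[OF to, of x] by simp
      finally have "complex_of_real (Ft (x, t)) = of_real (- g * H_op a (\<lambda>y. rho y t) x) * of_real (deriv (\<lambda>y. rho y t) x)"
        by simp
      also have "of_real (- g * H_op a (\<lambda>y. rho y t) x) = (\<Sum>\<^sub>\<infinity>l. (?q l * b t l) * wave l x)"
        by (rule velocity_series[OF a d3 inv[OF t\<tau>], symmetric])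
      also have "\<dots> * of_real (deriv (\<lambda>y. rho y t) x) = (\<Sum>\<^sub>\<infinity>k. adv (vel ?q (b t)) (b t) k * wave k x)"
        unfolding dx v using adv_series[OF vd, of "b t" C x] d3 by (simp add: numeral_3_eq_3 numeral_2_eq_2)
      finally show ?thesis .
    qed
    \<comment> \<open>The two sides agree as functions of \<open>x\<close>, and
      \<open>fcoeff_series\<close> reads the coefficients off the series; this turns the
      differential equation for the function into the system.\<close>
    then have "fcoeff (\<lambda>x. of_real (Ft (x, t))) k = fcoeff (\<lambda>x. \<Sum>\<^sub>\<infinity>k. adv (vel ?q (b t)) (b t) k * wave k x) k"
      by simp
    also have "\<dots> = adv (vel ?q (b t)) (b t) k"
    proof (rule fcoeff_series)
      show "norm (adv (vel ?q (b t)) (b t) l) \<le> (2 * g * C * C * jsum) / jb l ^ 2" for l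
        unfolding v by (rule advection_decay(2)) (rule vd, rule decay_weaken[OF decay[OF t\<tau>]], simp)
    qed
    finally show ?thesis using bder[OF ts, of k] unfolding at by simp
  qed
qed

text \<open>A competing solution may live for a shorter or a longer time than \<open>rho\<close>, so
  the comparison is made on the common lifespan.\<close>

theorem theorem1p1:
  fixes a g :: real
  assumes "a > 0" and "g > 0"
  shows "\<forall>rho0. C_inf_T rho0 \<longrightarrow>
    (\<exists>T > 0. \<exists>rho. is_solution a g rho0 T rho
       \<and> (\<forall>T' rho'. T' > 0 \<and> is_solution a g rho0 T' rho' \<longrightarrow>
            (\<forall>x. \<forall>t\<in>{0..<min T T'}. rho' x t = rho x t)))"
proof (intro allI impI)
  fix rho0 assume rho0: "C_inf_T rho0"
  interpret multiplier "velocity_mult a g" "2 * g" by (rule multiplier_velocity_mult[OF assms])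
  define c0 where "c0 = fcoeff (\<lambda>x. complex_of_real (rho0 x))"
  have "rapid c0" using C_inf_T_fourier(1)[OF rho0] by (simp add: rapid_def c0_def)
  then obtain T c where T: "0 < T" and c0: "\<And>k. c 0 k = c0 k"
    and cd: "\<And>s. \<exists>C. \<forall>t\<in>{0..T}. \<forall>k. norm (c t k) \<le> C / jb k ^ s"
    and code: "\<And>t k. t \<in> {0..T} \<Longrightarrow>
      ((\<lambda>t. c t k) has_vector_derivative adv (vel (velocity_mult a g) (c t)) (c t) k) (at t within {0..T})"
    by (rule fourier_solution_exists) (rule that)
  interpret fourier_flow "velocity_mult a g" "2 * g" T c
    by unfold_locales (use T cd code in \<open>auto simp: rapid_on_def\<close>)
  define rho where "rho x t = Re (\<Sum>\<^sub>\<infinity>k. c t k * wave k x)" for x t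
  have sol: "is_solution a g rho0 T rho"
    unfolding rho_def
  proof (rule fourier_flow_is_solution[OF assms])
    show "fourier_flow (velocity_mult a g) (2 * g) T c" by unfold_locales
    show "complex_of_real (rho0 x) = (\<Sum>\<^sub>\<infinity>k. c 0 k * wave k x)" for x
      unfolding c0 c0_def by (rule C_inf_T_fourier(2)[OF rho0])
  qed
  \<comment> \<open>One time \<open>\<tau>\<close> below both lifespans is treated at once, since
    the uniform decay of the coefficients of \<open>rho'\<close> comes from a closed interval
    \<open>{0..\<tau>}\<close> inside its lifespan.\<close>
  have unique: "rho' x \<tau> = rho x \<tau>" if sol': "is_solution a g rho0 T' rho'" and \<tau>: "\<tau> \<in> {0..<min T T'}" for T' rho' x \<tau>
  proof -
    have \<tau>': "0 \<le> \<tau>" "\<tau> < T'" "\<tau> < T" using \<tau> by auto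
    define b where "b t = fcoeff (\<lambda>x. complex_of_real (rho' x t))" for t
    note b = solution_fourier[OF assms sol' \<tau>'(1,2), folded b_def]
    obtain C1 where C1: "\<And>t k. t \<in> {0..\<tau>} \<Longrightarrow> norm (b t k) \<le> C1 / jb k ^ 6" using b(1) by blast
    obtain C2 where C2: "\<And>t k. t \<in> {0..T} \<Longrightarrow> norm (c t k) \<le> C2 / jb k ^ 6" using cd by blast
    have "b \<tau> k = c \<tau> k" for k
    proof (rule fourier_solution_unique[where C = "max C1 C2"])
      show "norm (b t k) \<le> max C1 C2 / jb k ^ 6" if "t \<in> {0..\<tau>}" for t k
        by (rule order_trans[OF C1[OF that]]) (intro divide_right_mono, auto)
      show "norm (c t k) \<le> max C1 C2 / jb k ^ 6" if "t \<in> {0..\<tau>}" for t k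
        by (rule order_trans[OF C2]) (use that \<tau>' in \<open>auto intro: divide_right_mono\<close>)
      show "continuous_on {0..\<tau>} (\<lambda>t. c t k)" for k
        by (rule continuous_on_subset[OF continuous_on_vector_derivative[OF code]]) (use \<tau>' in auto)
      show "((\<lambda>t. c t k) has_vector_derivative adv (vel (velocity_mult a g) (c t)) (c t) k) (at t)" if "0 < t" "t < \<tau>" for t k
        using code[of t k] that \<tau>' at_within_Icc_at[of 0 t T] by simp
      have "rho' x 0 = rho0 x" for x using sol' by (simp add: is_solution_def)
      then show "b 0 k = c 0 k" for k by (simp add: b_def c0 c0_def)
    qed (use b \<tau>' in auto)
    moreover have "complex_of_real (rho' x \<tau>) = (\<Sum>\<^sub>\<infinity>k. b \<tau> k * wave k x)" by (rule b(4)) (use \<tau>' in auto)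
    ultimately show ?thesis unfolding rho_def by (metis (no_types, lifting) Re_complex_of_real infsum_cong)
  qed
  show "\<exists>T > 0. \<exists>rho. is_solution a g rho0 T rho
       \<and> (\<forall>T' rho'. T' > 0 \<and> is_solution a g rho0 T' rho' \<longrightarrow>
            (\<forall>x. \<forall>t\<in>{0..<min T T'}. rho' x t = rho x t))"
    by (intro exI[of _ T] exI[of _ rho] conjI T sol allI impI ballI, elim conjE) (rule unique)
qed

end
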